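(* Let $q$ be an odd prime power. Then there exists an algorithm which computes $\mathrm{DI}_q$ in time $q^{9/4+o(1)}$ and constructs the set $\mathscr{DI}_q$ in time $q^{5/2+o(1)}$.
   Context: $\mathbb{F}_q$ is the finite field with $q$ elements. For $f\in\mathbb{F}_q[X]$ define the iterates $f^{(0)}(X)=X$ and $f^{(n)}(X)=f(f^{(n-1)}(X))$ for $n\ge 1$. The polynomial $f$ is called dynamically irreducible (over $\mathbb{F}_q$) if all iterates $f^{(n)}$, $n=1,2,\ldots$, are irreducible over $\mathbb{F}_q$. $\mathscr{DI}_q$ denotes the set of all dynamically irreducible quadratic polynomials $aX^2+bX+c\in\mathbb{F}_q[X]$, $a\ne 0$ (not necessarily monic), and $\mathrm{DI}_q=\#\mathscr{DI}_q$ is its cardinality. Constructing the set means listing all of its elements. Time means the number of elementary operations; the cost of a single arithmetic operation in $\mathbb{F}_q$ is absorbed in the factor $q^{o(1)}$. Here $o(1)$ denotes a quantity $\varepsilon(q)$ depending only on $q$ with $\varepsilon(q)\to 0$ as $q\to\infty$. *)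

theory Defs
  imports
    Complex_Main
    "HOL-Library.Log_Nat"
    "HOL-Number_Theory.Prime_Powers"
    "HOL-Algebra.Polynomial_Divisibility"
begin

section \<open>Dynamically irreducible polynomials\<close>

text \<open>
  Univariate polynomials are those of HOL-Algebra: coefficient lists with the leading coefficient
  first, so \<open>[a, b, c]\<close> is $aX^2 + bX + c$. The composition $f(g(X))$ is the value of \<open>f\<close>, with
  coefficients embedded as constants, at the element \<open>g\<close> of the polynomial ring.
\<close>

definition poly_comp :: "('a, 'b) ring_scheme \<Rightarrow> 'a list \<Rightarrow> 'a list \<Rightarrow> 'a list" where
  "poly_comp R f g = ring.eval (poly_ring R) (map (ring.poly_of_const R) f) g"

fun poly_iterate :: "('a, 'b) ring_scheme \<Rightarrow> 'a list \<Rightarrow> nat \<Rightarrow> 'a list" where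
  "poly_iterate R f 0 = X\<^bsub>R\<^esub>"
| "poly_iterate R f (Suc n) = poly_comp R f (poly_iterate R f n)"

definition dynamically_irreducible :: "('a, 'b) ring_scheme \<Rightarrow> 'a list \<Rightarrow> bool" where
  "dynamically_irreducible R f \<longleftrightarrow>
     f \<in> carrier (poly_ring R) \<and> (\<forall>n\<ge>1. pirreducible\<^bsub>R\<^esub> (carrier R) (poly_iterate R f n))"

definition DI_set :: "('a, 'b) ring_scheme \<Rightarrow> 'a list set" where
  "DI_set R = {[a, b, c] | a b c.
     a \<in> carrier R \<and> b \<in> carrier R \<and> c \<in> carrier R \<and> a \<noteq> \<zero>\<^bsub>R\<^esub> \<and>
     dynamically_irreducible R [a, b, c]}"


section \<open>Model of computation\<close>

text \<open>
  A random access machine over natural numbers, programmed in a structured language, with the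
  logarithmic cost measure: each step costs a constant plus the bit lengths of the values and of the
  indirect addresses it handles. (With unit costs, multiplication of unbounded numbers would
  count as elementary.) Registers named directly in an instruction are fixed by the program and
  contribute only a constant factor.

  The machine also has the arithmetic of a field \<open>R\<close> available as instructions. In use,
  \<open>carrier R = {..<q}\<close>, so field elements are stored as numbers below \<open>q\<close>, but the encoding is
  otherwise arbitrary: in particular \<open>\<zero>\<^bsub>R\<^esub>\<close> and \<open>\<one>\<^bsub>R\<^esub>\<close> need not be the numbers 0 and 1. A program can
  enumerate the field by counting, and compare elements by comparing their codes.
\<close>

datatype nat_op = Add | Sub | Mul | Div

fun nat_op_val :: "nat_op \<Rightarrow> nat \<Rightarrow> nat \<Rightarrow> nat" where
  "nat_op_val Add x y = x + y"
| "nat_op_val Sub x y = x - y"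
| "nat_op_val Mul x y = x * y"
| "nat_op_val Div x y = x div y"

datatype field_op = FAdd | FSub | FMul | FDiv

text \<open>Operands that do not encode field elements, and division by zero, give the number 0.\<close>

fun field_op_val :: "nat ring \<Rightarrow> field_op \<Rightarrow> nat \<Rightarrow> nat \<Rightarrow> nat" where
  "field_op_val R FAdd x y =
     (if x \<in> carrier R \<and> y \<in> carrier R then x \<oplus>\<^bsub>R\<^esub> y else 0)"
| "field_op_val R FSub x y =
     (if x \<in> carrier R \<and> y \<in> carrier R then x \<ominus>\<^bsub>R\<^esub> y else 0)"
| "field_op_val R FMul x y =
     (if x \<in> carrier R \<and> y \<in> carrier R then x \<otimes>\<^bsub>R\<^esub> y else 0)"
| "field_op_val R FDiv x y =
     (if x \<in> carrier R \<and> y \<in> carrier R \<and> y \<noteq> \<zero>\<^bsub>R\<^esub> then x \<otimes>\<^bsub>R\<^esub> inv\<^bsub>R\<^esub> y else 0)"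

text \<open>
  The arguments of type \<^typ>\<open>nat\<close> are register numbers, except for the second one of \<open>Const\<close>, which
  is the value loaded. \<open>Load r s\<close> and \<open>Store r s\<close> are indirect: with \<open>m\<close> the memory they perform
  \<open>m[r] := m[m[s]]\<close> and \<open>m[m[r]] := m[s]\<close>. \<open>While r\<close> and \<open>If r\<close> test whether register \<open>r\<close> is nonzero.
\<close>

datatype com =
    Const nat nat
  | FZero nat
  | FOne nat
  | Load nat nat
  | Store nat nat
  | NatOp nat_op nat nat nat
  | FieldOp field_op nat nat nat
  | Emit nat
  | Seq com com
  | If nat com com
  | While nat com

text \<open>
  The output tape records each emitted number together with the time at which it was emitted, in
  order of emission.
\<close>

record state =
  mem :: "nat \<Rightarrow> nat"
  clock :: nat
  tape :: "(nat \<times> nat) list"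

abbreviation bits :: "nat \<Rightarrow> nat" where
  "bits \<equiv> floorlog 2"

definition tick :: "nat \<Rightarrow> state \<Rightarrow> state" where
  "tick t s = s\<lparr>clock := clock s + 1 + t\<rparr>"

definition assign :: "nat \<Rightarrow> nat \<Rightarrow> state \<Rightarrow> state" where
  "assign r v s = tick (bits v) (s\<lparr>mem := (mem s)(r := v)\<rparr>)"

definition append_tape :: "nat \<Rightarrow> state \<Rightarrow> state" where
  "append_tape v s = (let s' = tick (bits v) s in s'\<lparr>tape := tape s' @ [(v, clock s')]\<rparr>)"

inductive exec :: "nat ring \<Rightarrow> com \<Rightarrow> state \<Rightarrow> state \<Rightarrow> bool" for R :: "nat ring" where
  Const: "exec R (Const r v) s (assign r v s)"
| FZero: "exec R (FZero r) s (assign r \<zero>\<^bsub>R\<^esub> s)"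
| FOne: "exec R (FOne r) s (assign r \<one>\<^bsub>R\<^esub> s)"
| Load: "exec R (Load r p) s (tick (bits (mem s p)) (assign r (mem s (mem s p)) s))"
| Store: "exec R (Store p r) s (tick (bits (mem s p)) (assign (mem s p) (mem s r) s))"
| NatOp: "exec R (NatOp f r x y) s
    (tick (bits (mem s x) + bits (mem s y)) (assign r (nat_op_val f (mem s x) (mem s y)) s))"
| FieldOp: "exec R (FieldOp f r x y) s
    (tick (bits (mem s x) + bits (mem s y)) (assign r (field_op_val R f (mem s x) (mem s y)) s))"
| Emit: "exec R (Emit r) s (append_tape (mem s r) s)"
| Seq: "exec R c s s' \<Longrightarrow> exec R d s' s'' \<Longrightarrow> exec R (Seq c d) s s''"
| IfTrue: "mem s r \<noteq> 0 \<Longrightarrow> exec R c (tick (bits (mem s r)) s) s' \<Longrightarrow> exec R (If r c d) s s'"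
| IfFalse: "mem s r = 0 \<Longrightarrow> exec R d (tick (bits (mem s r)) s) s' \<Longrightarrow> exec R (If r c d) s s'"
| WhileTrue: "mem s r \<noteq> 0 \<Longrightarrow> exec R c (tick (bits (mem s r)) s) s' \<Longrightarrow>
    exec R (While r c) s' s'' \<Longrightarrow> exec R (While r c) s s''"
| WhileFalse: "mem s r = 0 \<Longrightarrow> exec R (While r c) s (tick (bits (mem s r)) s)"

text \<open>Execution is deterministic, so a terminating run determines its output and running time.\<close>

lemma exec_deterministic: "exec R c s s' \<Longrightarrow> exec R c s s'' \<Longrightarrow> s'' = s'"
proof (induction arbitrary: s'' rule: exec.induct)
  case (Seq c s s' d t)
  from Seq.prems show ?case by cases (use Seq.IH in metis)
next
  case (IfTrue s r c s' d)
  from IfTrue.prems show ?case by cases (use IfTrue in metis)+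
next
  case (IfFalse s r d s' c)
  from IfFalse.prems show ?case by cases (use IfFalse in metis)+
next
  case (WhileTrue s r c s' t)
  from WhileTrue.prems show ?case by cases (use WhileTrue in metis)+
next
  case (WhileFalse s r c)
  from WhileFalse.prems show ?case by cases (use WhileFalse in metis)+
qed (erule exec.cases; simp)+

definition initial_state :: "nat \<Rightarrow> state" where
  "initial_state q = \<lparr>mem = (\<lambda>_. 0)(0 := q), clock = 0, tape = []\<rparr>"

text \<open>
  On the field \<open>R\<close> with \<open>q\<close> elements, program \<open>A\<close> first outputs the number of dynamically irreducible
  quadratic polynomials, by time \<open>T\<close>, and then a list of all of them without repetition, each one
  given by its three coefficients, and it halts by time \<open>T'\<close>.
\<close>

definition computes_and_constructs_DI :: "com \<Rightarrow> nat \<Rightarrow> nat ring \<Rightarrow> real \<Rightarrow> real \<Rightarrow> bool" where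
  "computes_and_constructs_DI A q R T T' \<longleftrightarrow>
     (\<exists>s t out fs. exec R A (initial_state q) s \<and>
        tape s = (card (DI_set R), t) # out \<and> real t \<le> T \<and>
        map fst out = concat fs \<and> distinct fs \<and> set fs = DI_set R \<and> real (clock s) \<le> T')"

end

theory Submission
  imports Defs "HOL-Real_Asymp.Real_Asymp"
begin

text \<open>After scaling, a quadratic polynomial is \<open>(X - t)^2 + t + d\<close>, with critical orbit \<open>t + z_n\<close>, where
  \<open>z_0 = d\<close> and \<open>z_(n+1) = z_n^2 + d\<close>. Over a finite field it is dynamically irreducible if and only if
  \<open>-(t + d)\<close> and all \<open>t + z_n\<close> with \<open>n \<ge> 1\<close> are nonsquares. For each pair \<open>(d, t)\<close> the algorithm walks
  along the orbit, with Floyd's cycle detection, until it meets a square or a cycle.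

  If \<open>t + s\<close> is a nonsquare for all \<open>s \<in> S\<close> and \<open>t \<in> T\<close>, then \<open>|S| |T| \<le> q\<close> because the quadratic
  character is almost orthogonal to its translates; so for each \<open>d\<close> only about \<open>q / n\<close> values of \<open>t\<close>
  survive \<open>n\<close> steps, and all walks together take \<open>q^(2 + o(1))\<close> steps. The number of dynamically
  irreducible polynomials, hence the length of the list, is \<open>q^(5/2 + o(1))\<close>: the character sums of
  products of about \<open>log q\<close> distinct linear factors are bounded by Stepanov's method, which leaves
  \<open>q^(1/2 + o(1))\<close> values of \<open>t\<close> for each \<open>d\<close> with a long critical orbit, and few \<open>d\<close> have a short one.\<close>

section \<open>The quadratic character\<close>

text \<open>The recursion for \<open>z_n\<close> does not involve \<open>t\<close>, so for fixed
  \<open>d\<close> all conditions with \<open>n \<ge> 1\<close> concern translates of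
  \<open>t\<close> by one fixed set; averaging over \<open>t\<close> and character sums both rest on
  this. The leading coefficient does not enter the conditions, so q^2 pairs have to be examined, and
  each good pair stands for q - 1 polynomials. Counting needs only the orthogonality argument; the
  bound on character sums serves solely for the length of the list. Two obstacles shape its proof.
  Vanishing to an order M near sqrt q cannot be tested by derivatives, because M may exceed the
  characteristic; expansions in powers of X - t, with coefficients that are polynomials in t, take
  their place. And the auxiliary polynomial comes from counting instead of linear algebra: as the
  field is finite, the pigeonhole principle gives two polynomials with the same local data, and
  their difference vanishes to high order. The number of orbit points used is about log sqrt q. More
  points would make collisions (equations for \<open>d\<close> of degree up to 2^K) too frequent,
  fewer would leave too many \<open>t\<close>.\<close>

locale finite_odd_field = field R for R (structure) +
  assumes finite_carrier: "finite (carrier R)"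
    and odd_order: "odd (order R)"
begin

lemma order_ge_3: "order R \<ge> 3"
proof -
  have "card {\<zero>, \<one>} \<le> order R"
    unfolding order_def by (rule card_mono[OF finite_carrier]) auto
  then have "order R \<ge> 2" by simp
  moreover have "order R \<noteq> 2" using odd_order by auto
  ultimately show ?thesis by linarith
qed

lemma card_nonzero: "card (carrier R - {\<zero>}) = order R - 1"
  by (simp add: order_def finite_carrier)

lemma pow_order_minus_1:
  assumes "x \<in> carrier R" "x \<noteq> \<zero>"
  shows "x [^] (order R - 1) = \<one>"
proof -
  interpret M: group "Multiplicative_Group.mult_of R" by (rule field_mult_group)
  have "x [^]\<^bsub>Multiplicative_Group.mult_of R\<^esub> order (Multiplicative_Group.mult_of R) = \<one>\<^bsub>Multiplicative_Group.mult_of R\<^esub>"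
    by (rule M.pow_order_eq_1) (use assms in auto)
  then show ?thesis
    by (simp add: Multiplicative_Group.nat_pow_mult_of order_mult_of[OF finite_carrier])
qed

lemma pow_order:
  assumes "x \<in> carrier R"
  shows "x [^] order R = x"
proof (cases "x = \<zero>")
  case True
  then show ?thesis using order_ge_3 by (simp add: nat_pow_zero)
next
  case False
  obtain k where k: "order R = Suc k" using order_ge_3 by (cases "order R") auto
  then have "x [^] k = \<one>" using pow_order_minus_1[OF assms False] by simp
  then show ?thesis using assms k by simp
qed

text \<open>By Lagrange in the additive group, \<open>order R\<close> annihilates
  \<open>\<one>\<close>. It is odd, so if 2 annihilated \<open>\<one>\<close> as well,
  \<open>\<one>\<close> would be zero.\<close>

lemma one_neq_minus_one: "\<one> \<noteq> \<ominus> \<one>"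
proof
  assume *: "\<one> = \<ominus> \<one>"
  have "\<one> \<oplus> \<one> = \<zero>"
    by (subst (2) *) (simp add: r_neg)
  then have two: "add_pow R (2::nat) \<one> = \<zero>"
    by (simp add: numeral_2_eq_2)
  have "add_pow R (order R) \<one> = \<zero>"
    using add.pow_order_eq_1[of \<one>] by (simp add: order_def add_pow_def)
  moreover obtain k where "order R = k * 2 + 1" using odd_order by (metis oddE mult.commute)
  ultimately have "add_pow R (k * 2 + 1) \<one> = \<zero>" by simp
  then have "add_pow R (k * 2) \<one> \<oplus> \<one> = \<zero>" by simp
  moreover have "add_pow R (k * 2) \<one> = \<zero>"
    using add.nat_pow_pow[OF one_closed, of k 2, symmetric] two
    by (simp only: mult.commute[of 2 k] add.nat_pow_one)
  ultimately show False by simp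
qed

lemma two_nonzero: "\<one> \<oplus> \<one> \<noteq> \<zero>"
  using one_neq_minus_one by (metis one_closed minus_equality)

definition is_square :: "'a \<Rightarrow> bool" where
  "is_square x \<longleftrightarrow> (\<exists>y\<in>carrier R. x = y \<otimes> y)"

lemma is_square_zero: "is_square \<zero>"
  unfolding is_square_def by (rule bexI[of _ \<zero>]) auto

lemma half_order: "2 * (order R div 2) = order R - 1"
  using odd_order by (metis odd_two_times_div_two_nat)

text \<open>Euler's criterion. For the converse write x = g^i with a generator g of the
  multiplicative group: its order q - 1 divides i (q - 1) / 2, so i is even.\<close>

lemma is_square_iff_pow_half:
  assumes x: "x \<in> carrier R" "x \<noteq> \<zero>"
  shows "is_square x \<longleftrightarrow> x [^] (order R div 2) = \<one>"
proof
  assume "is_square x"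
  then obtain y where y: "y \<in> carrier R" "x = y \<otimes> y" unfolding is_square_def by auto
  then have "y \<noteq> \<zero>" using x by auto
  have "x [^] (order R div 2) = y [^] (2 * (order R div 2))"
    using y by (simp add: nat_pow_distrib nat_pow_mult mult_2)
  then show "x [^] (order R div 2) = \<one>"
    using pow_order_minus_1[OF y(1) \<open>y \<noteq> \<zero>\<close>] half_order by simp
next
  assume one: "x [^] (order R div 2) = \<one>"
  interpret M: group "Multiplicative_Group.mult_of R" by (rule field_mult_group)
  obtain g where g: "g \<in> carrier (Multiplicative_Group.mult_of R)"
    "carrier (Multiplicative_Group.mult_of R) = {g [^] i | i::nat. i \<in> UNIV}"
    using finite_field_mult_group_has_gen[OF finite_carrier] by auto
  have fin: "finite (carrier (Multiplicative_Group.mult_of R))" using finite_carrier by simp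
  have "carrier (Multiplicative_Group.mult_of R) = {g [^]\<^bsub>Multiplicative_Group.mult_of R\<^esub> i | i. i \<in> (UNIV::nat set)}"
    using g(2) by (simp add: Multiplicative_Group.nat_pow_mult_of)
  also have "\<dots> = {g [^]\<^bsub>Multiplicative_Group.mult_of R\<^esub> i | i. i \<in> {0..M.ord g - 1}}"
    using M.ord_elems[OF fin g(1)] by simp
  also have "\<dots> = (\<lambda>i. g [^]\<^bsub>Multiplicative_Group.mult_of R\<^esub> i) ` {0..M.ord g - 1}" by auto
  finally have "card (carrier (Multiplicative_Group.mult_of R)) \<le> card {0..M.ord g - 1}"
    by (metis card_image_le finite_atLeastAtMost)
  moreover have "M.ord g > 0" using M.ord_ge_1[OF fin g(1)] by simp
  ultimately have le: "order R - 1 \<le> M.ord g" using card_nonzero by simp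
  have "M.ord g dvd order R - 1"
    using M.ord_dvd_group_order[OF g(1)] by (simp add: order_mult_of[OF finite_carrier])
  then have ord: "M.ord g = order R - 1"
    using le order_ge_3 dvd_imp_le[of "M.ord g" "order R - 1"] by simp
  obtain i where i: "x = g [^] (i::nat)" using g(2) x by auto
  have gc: "g \<in> carrier R" using g(1) by simp
  have "g [^] (i * (order R div 2)) = \<one>"
    using one i gc by (simp add: nat_pow_pow)
  then have "g [^]\<^bsub>Multiplicative_Group.mult_of R\<^esub> (i * (order R div 2)) = \<one>\<^bsub>Multiplicative_Group.mult_of R\<^esub>"
    by (simp add: Multiplicative_Group.nat_pow_mult_of)
  then have "M.ord g dvd i * (order R div 2)" using M.pow_eq_id[OF g(1)] by blast
  then have "2 * (order R div 2) dvd i * (order R div 2)" using ord half_order by simp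
  then have "2 dvd i" using order_ge_3 by simp
  then obtain k where "i = k + k" by (metis evenE mult_2)
  then have "x = g [^] k \<otimes> g [^] k" using i gc by (simp add: nat_pow_mult)
  then show "is_square x" unfolding is_square_def using gc by blast
qed

lemma square_eq_one:
  assumes "z \<in> carrier R" "z \<otimes> z = \<one>"
  shows "z = \<one> \<or> z = \<ominus> \<one>"
proof -
  have "(z \<ominus> \<one>) \<otimes> (z \<oplus> \<one>) = z \<otimes> z \<ominus> \<one>"
    using assms(1) by algebra
  then have "(z \<ominus> \<one>) \<otimes> (z \<oplus> \<one>) = \<zero>" using assms(2) by (simp add: r_neg minus_eq)
  then have "z \<ominus> \<one> = \<zero> \<or> z \<oplus> \<one> = \<zero>" using assms(1) by (intro integral) auto
  then show ?thesis using assms(1)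
    by (metis minus_equality one_closed r_right_minus_eq add.m_comm)
qed

lemma pow_half_nonsquare:
  assumes x: "x \<in> carrier R" "\<not> is_square x"
  shows "x [^] (order R div 2) = \<ominus> \<one>"
proof -
  have nz: "x \<noteq> \<zero>" using x is_square_zero by auto
  have "x [^] (order R div 2) \<otimes> x [^] (order R div 2) = x [^] (order R - 1)"
    using x half_order by (simp add: nat_pow_mult mult_2[symmetric])
  then have "x [^] (order R div 2) \<otimes> x [^] (order R div 2) = \<one>"
    using pow_order_minus_1[OF x(1) nz] by simp
  then show ?thesis
    using square_eq_one[of "x [^] (order R div 2)"] is_square_iff_pow_half[OF x(1) nz] x by auto
qed

definition chi :: "'a \<Rightarrow> int" where
  "chi x = (if x = \<zero> then 0 else if is_square x then 1 else -1)"

lemma chi_eq_minus_one: "chi x = -1 \<longleftrightarrow> \<not> is_square x"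
  using is_square_zero by (auto simp: chi_def)

lemma chi_zero [simp]: "chi \<zero> = 0"
  by (simp add: chi_def)

lemma chi_one [simp]: "chi \<one> = 1"
proof -
  have "is_square \<one>" unfolding is_square_def by (rule bexI[of _ \<one>]) auto
  then show ?thesis by (simp add: chi_def)
qed

text \<open>Because 1 and -1 differ in the field, the integer \<open>chi x\<close> can be read off
  from the power x^((q-1)/2). Multiplicativity of \<open>chi\<close> is inherited from the power in
  this way.\<close>

lemma embed_chi:
  assumes "x \<in> carrier R" "x \<noteq> \<zero>"
  shows "(chi x = 1 \<longleftrightarrow> x [^] (order R div 2) = \<one>) \<and>
    (chi x = -1 \<longleftrightarrow> x [^] (order R div 2) = \<ominus> \<one>)"
  using assms is_square_iff_pow_half[OF assms] pow_half_nonsquare[OF assms(1)] one_neq_minus_one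
  by (auto simp: chi_def)

lemma chi_cases: "chi x = 0 \<or> chi x = 1 \<or> chi x = -1"
  by (auto simp: chi_def)

lemma chi_mult:
  assumes "x \<in> carrier R" "y \<in> carrier R"
  shows "chi (x \<otimes> y) = chi x * chi y"
proof (cases "x = \<zero> \<or> y = \<zero>")
  case True
  then show ?thesis using assms by auto
next
  case False
  then have nz: "x \<otimes> y \<noteq> \<zero>" using assms integral by blast
  have c: "chi z = 1 \<or> chi z = -1" if "z \<noteq> \<zero>" for z using that by (auto simp: chi_def)
  have pow: "(x \<otimes> y) [^] (order R div 2) = x [^] (order R div 2) \<otimes> y [^] (order R div 2)"
    using assms by (simp add: nat_pow_distrib)
  have m: "\<ominus> \<one> \<otimes> \<ominus> \<one> = \<one>" by algebra
  from False c[of x] c[of y] show ?thesis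
    using embed_chi[OF assms(1)] embed_chi[OF assms(2)] embed_chi[OF m_closed[OF assms] nz] pow m
    by auto
qed

lemma chi_prod:
  assumes "finite A" "\<And>i. i \<in> A \<Longrightarrow> h i \<in> carrier R"
  shows "chi (\<Otimes>i\<in>A. h i) = (\<Prod>i\<in>A. chi (h i))"
  using assms
proof (induction A)
  case (insert i A)
  then have "(\<Otimes>j\<in>insert i A. h j) = h i \<otimes> (\<Otimes>j\<in>A. h j)"
    by (intro finprod_insert) auto
  then show ?case using insert by (simp add: chi_mult finprod_closed Pi_def)
qed simp

text \<open>Otherwise, by Euler's criterion, all q - 1 nonzero elements would be roots of a
  polynomial of degree (q - 1) / 2.\<close>

lemma exists_nonsquare: "\<exists>n\<in>carrier R. \<not> is_square n"
proof (rule ccontr)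
  assume "\<not> ?thesis"
  then have sq: "\<And>x. x \<in> carrier R \<Longrightarrow> is_square x" by auto
  have "carrier R - {\<zero>} \<subseteq> {x \<in> carrier R. x [^] (order R div 2) = \<one>}"
    using sq is_square_iff_pow_half by auto
  then have "order R - 1 \<le> card {x \<in> carrier R. x [^] (order R div 2) = \<one>}"
    using card_mono[of "{x \<in> carrier R. x [^] (order R div 2) = \<one>}" "carrier R - {\<zero>}"]
      finite_carrier card_nonzero by simp
  also have "\<dots> \<le> order R div 2"
    using num_roots_le_deg[OF finite_carrier] order_ge_3 by simp
  finally show False using order_ge_3 half_order by linarith
qed

section \<open>Sums of the character and of products of its translates\<close>

lemma bij_mult:
  assumes "c \<in> carrier R" "c \<noteq> \<zero>"
  shows "bij_betw (\<lambda>x. c \<otimes> x) (carrier R) (carrier R)"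
proof (rule bij_betwI[of _ _ _ "\<lambda>x. inv c \<otimes> x"])
  have i: "inv c \<in> carrier R" "inv c \<otimes> c = \<one>" "c \<otimes> inv c = \<one>" using assms by (auto simp: field_Units)
  show "(\<lambda>x. c \<otimes> x) \<in> carrier R \<rightarrow> carrier R" "(\<lambda>x. inv c \<otimes> x) \<in> carrier R \<rightarrow> carrier R"
    using assms i by auto
  show "\<And>x. x \<in> carrier R \<Longrightarrow> inv c \<otimes> (c \<otimes> x) = x"
    using assms i by (simp add: m_assoc[symmetric])
  show "\<And>x. x \<in> carrier R \<Longrightarrow> c \<otimes> (inv c \<otimes> x) = x"
    using assms i by (simp add: m_assoc[symmetric])
qed

lemma bij_add:
  assumes "c \<in> carrier R"
  shows "bij_betw (\<lambda>x. x \<oplus> c) (carrier R) (carrier R)"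
proof (rule bij_betwI[of _ _ _ "\<lambda>x. x \<ominus> c"])
  show "\<And>x. x \<in> carrier R \<Longrightarrow> x \<oplus> c \<ominus> c = x" "\<And>x. x \<in> carrier R \<Longrightarrow> x \<ominus> c \<oplus> c = x"
    using assms by algebra+
qed (use assms in auto)

text \<open>The substitution of n x for x, with a nonsquare n, reverses the sign of the sum.\<close>

lemma sum_chi: "(\<Sum>x\<in>carrier R. chi x) = 0"
proof -
  obtain n where n: "n \<in> carrier R" "\<not> is_square n" using exists_nonsquare by auto
  then have "n \<noteq> \<zero>" using is_square_zero by auto
  have "(\<Sum>x\<in>carrier R. chi x) = (\<Sum>x\<in>carrier R. chi (n \<otimes> x))"
    using sum.reindex_bij_betw[OF bij_mult[OF n(1) \<open>n \<noteq> \<zero>\<close>], of chi] by simp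
  also have "\<dots> = (\<Sum>x\<in>carrier R. - chi x)"
    using n by (intro sum.cong refl) (simp add: chi_mult chi_eq_minus_one[THEN iffD2])
  finally show ?thesis by (simp add: sum_negf)
qed

text \<open>For \<open>x \<noteq> 0\<close> the value of \<open>chi (x (x + c))\<close> is that of \<open>chi (1 + c / x)\<close>, and \<open>1 + c / x\<close> runs
  through all elements but 1.\<close>

lemma sum_chi_mult_shift:
  assumes c: "c \<in> carrier R" "c \<noteq> \<zero>"
  shows "(\<Sum>x\<in>carrier R. chi x * chi (x \<oplus> c)) = -1"
proof -
  have fin: "finite (carrier R)" by (rule finite_carrier)
  have "(\<Sum>x\<in>carrier R. chi x * chi (x \<oplus> c)) = (\<Sum>x\<in>carrier R - {\<zero>}. chi x * chi (x \<oplus> c))"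
    using fin by (intro sum.mono_neutral_right) auto
  also have "\<dots> = (\<Sum>y\<in>carrier R - {\<one>}. chi y)"
  proof (rule sum.reindex_bij_witness[of _ "\<lambda>y. c \<otimes> inv (y \<ominus> \<one>)" "\<lambda>x. \<one> \<oplus> c \<otimes> inv x"])
    fix x assume "x \<in> carrier R - {\<zero>}"
    then have x: "x \<in> carrier R" "x \<noteq> \<zero>" by auto
    then have i: "inv x \<in> carrier R" "inv x \<otimes> x = \<one>" "x \<otimes> inv x = \<one>" by (auto simp: field_Units)
    have e: "\<one> \<oplus> c \<otimes> inv x \<ominus> \<one> = c \<otimes> inv x" using c i by algebra
    have nz: "c \<otimes> inv x \<noteq> \<zero>" using c i integral x by (metis r_null one_not_zero)
    have "inv (c \<otimes> inv x) = inv c \<otimes> x"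
      using c x i by (intro comm_inv_char) (auto simp: field_Units m_ac, metis c field_Units DiffI Units_r_inv insertE l_one m_assoc m_comm emptyE Units_inv_closed i)
    moreover have "c \<otimes> (inv c \<otimes> x) = x" using c x by (simp add: m_assoc[symmetric] field_Units)
    ultimately show "c \<otimes> inv (\<one> \<oplus> c \<otimes> inv x \<ominus> \<one>) = x" by (simp add: e)
    show "\<one> \<oplus> c \<otimes> inv x \<in> carrier R - {\<one>}"
      using c i nz e by (metis DiffI singletonD a_closed m_closed one_closed r_right_minus_eq)
    have "x \<oplus> c = x \<otimes> (\<one> \<oplus> c \<otimes> inv x)"
    proof -
      have "x \<otimes> (\<one> \<oplus> c \<otimes> inv x) = x \<oplus> c \<otimes> (x \<otimes> inv x)" using c x(1) i(1) by algebra
      then show ?thesis using c x i by simp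
    qed
    then have "chi x * chi (x \<oplus> c) = chi x * chi x * chi (\<one> \<oplus> c \<otimes> inv x)"
      using x c i by (simp add: chi_mult)
    moreover have "chi x * chi x = 1" using x by (auto simp: chi_def)
    ultimately show "chi (\<one> \<oplus> c \<otimes> inv x) = chi x * chi (x \<oplus> c)" by simp
  next
    fix y assume "y \<in> carrier R - {\<one>}"
    then have y: "y \<in> carrier R" "y \<ominus> \<one> \<noteq> \<zero>" by auto
    let ?z = "y \<ominus> \<one>"
    have z: "?z \<in> carrier R" "?z \<noteq> \<zero>" using y by auto
    then have i: "inv ?z \<in> carrier R" "inv ?z \<otimes> ?z = \<one>" "?z \<otimes> inv ?z = \<one>" by (auto simp: field_Units)
    have ic: "inv c \<in> carrier R" "c \<otimes> inv c = \<one>" using c by (auto simp: field_Units)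
    have "inv (c \<otimes> inv ?z) = inv c \<otimes> ?z"
    proof (rule comm_inv_char)
      have "c \<otimes> inv ?z \<otimes> (inv c \<otimes> ?z) = (c \<otimes> inv c) \<otimes> (?z \<otimes> inv ?z)"
        using c(1) ic(1) i(1) z(1) by algebra
      then show "c \<otimes> inv ?z \<otimes> (inv c \<otimes> ?z) = \<one>" using ic i by simp
    qed (use c ic i z in auto)
    then have "c \<otimes> inv (c \<otimes> inv ?z) = (c \<otimes> inv c) \<otimes> ?z" using c(1) ic(1) z(1) by (simp only: m_assoc)
    then have "c \<otimes> inv (c \<otimes> inv ?z) = ?z" using ic z by simp
    then show "\<one> \<oplus> c \<otimes> inv (c \<otimes> inv ?z) = y" using y(1) by (simp, algebra)
    show "c \<otimes> inv ?z \<in> carrier R - {\<zero>}"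
    proof -
      have "inv ?z \<noteq> \<zero>" using i(2) z(1) by auto
      then show ?thesis using c i(1) integral[of c "inv ?z"] by auto
    qed
  qed
  also have "\<dots> = (\<Sum>y\<in>carrier R. chi y) - chi \<one>"
    using fin by (subst sum_diff1) auto
  finally show ?thesis using sum_chi by simp
qed

lemma sum_chi_correlation:
  assumes s: "s \<in> carrier R" "s' \<in> carrier R" "s \<noteq> s'"
  shows "(\<Sum>t\<in>carrier R. chi (t \<oplus> s) * chi (t \<oplus> s')) = -1"
proof -
  have "(\<Sum>t\<in>carrier R. chi (t \<oplus> s) * chi (t \<oplus> s')) =
      (\<Sum>t\<in>carrier R. chi (t \<oplus> s) * chi (t \<oplus> s \<oplus> (s' \<ominus> s)))"
  proof (intro sum.cong refl)
    fix t assume "t \<in> carrier R"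
    then have "t \<oplus> s \<oplus> (s' \<ominus> s) = t \<oplus> s'" using s(1,2) by algebra
    then show "chi (t \<oplus> s) * chi (t \<oplus> s') = chi (t \<oplus> s) * chi (t \<oplus> s \<oplus> (s' \<ominus> s))" by simp
  qed
  also have "\<dots> = (\<Sum>x\<in>carrier R. chi x * chi (x \<oplus> (s' \<ominus> s)))"
    by (rule sum.reindex_bij_betw[OF bij_add[OF s(1)], of "\<lambda>x. chi x * chi (x \<oplus> (s' \<ominus> s))"])
  also have "\<dots> = -1"
    using s by (intro sum_chi_mult_shift) auto
  finally show ?thesis .
qed

text \<open>Second moment: each \<open>t \<in> T\<close> contributes |S|^2 to the sum of (\<Sum>s.
  chi (t + s))^2. Extended to all t and expanded, this sum has off-diagonal correlations -1, which
  may be dropped, and its diagonal is at most |S| q.\<close>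

lemma card_mult_card_le_order:
  assumes S: "S \<subseteq> carrier R" and T: "T \<subseteq> carrier R"
    and ns: "\<And>s t. s \<in> S \<Longrightarrow> t \<in> T \<Longrightarrow> \<not> is_square (t \<oplus> s)"
  shows "card T * card S \<le> order R"
proof (cases "card S = 0")
  case False
  have fin: "finite S" "finite T" using S T finite_carrier finite_subset by blast+
  let ?D = "\<lambda>t. \<Sum>s\<in>S. chi (t \<oplus> s)"
  have "(\<Sum>t\<in>T. (?D t)\<^sup>2) = (\<Sum>t\<in>T. (int (card S))\<^sup>2)"
  proof (intro sum.cong refl)
    fix t assume "t \<in> T"
    then have "?D t = (\<Sum>s\<in>S. -1)" using ns by (intro sum.cong refl) (simp add: chi_eq_minus_one)
    then show "(?D t)\<^sup>2 = (int (card S))\<^sup>2" by simp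
  qed
  then have "int (card T) * (int (card S))\<^sup>2 = (\<Sum>t\<in>T. (?D t)\<^sup>2)" by simp
  also have "\<dots> \<le> (\<Sum>t\<in>carrier R. (?D t)\<^sup>2)"
    using T finite_carrier by (intro sum_mono2) auto
  also have "\<dots> = (\<Sum>t\<in>carrier R. \<Sum>s\<in>S. \<Sum>s'\<in>S. chi (t \<oplus> s) * chi (t \<oplus> s'))"
    by (simp add: power2_eq_square sum_product)
  also have "\<dots> = (\<Sum>s\<in>S. \<Sum>s'\<in>S. \<Sum>t\<in>carrier R. chi (t \<oplus> s) * chi (t \<oplus> s'))"
    by (simp add: sum.swap[of _ _ "carrier R"])
  also have "\<dots> \<le> (\<Sum>s\<in>S. \<Sum>s'\<in>S. if s' = s then int (order R) else 0)"
  proof (intro sum_mono)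
    fix s s' assume ss: "s \<in> S" "s' \<in> S"
    show "(\<Sum>t\<in>carrier R. chi (t \<oplus> s) * chi (t \<oplus> s')) \<le> (if s' = s then int (order R) else 0)"
    proof (cases "s' = s")
      case True
      have "(\<Sum>t\<in>carrier R. chi (t \<oplus> s) * chi (t \<oplus> s')) \<le> (\<Sum>t\<in>carrier R. 1)"
        using True by (intro sum_mono) (auto simp: chi_def)
      then show ?thesis using True by (simp add: order_def)
    next
      case False
      then show ?thesis using sum_chi_correlation[of s s'] subsetD[OF S ss(1)] subsetD[OF S ss(2)] by simp
    qed
  qed
  also have "\<dots> = int (card S) * int (order R)" using fin by simp
  finally have "int (card S) * (int (card T) * int (card S)) \<le> int (card S) * int (order R)"
    by (simp add: power2_eq_square mult_ac)
  then have "int (card T) * int (card S) \<le> int (order R)"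
    using False by simp
  then show ?thesis by (metis of_nat_le_iff of_nat_mult)
qed simp

end

section \<open>Polynomials\<close>

context finite_odd_field
begin

abbreviation P :: "'a list ring" where "P \<equiv> poly_ring R"

abbreviation poly_mult_op (infixl "*\<^sub>P" 70) where "p *\<^sub>P q \<equiv> p \<otimes>\<^bsub>P\<^esub> q"
abbreviation poly_add_op (infixl "+\<^sub>P" 65) where "p +\<^sub>P q \<equiv> p \<oplus>\<^bsub>P\<^esub> q"
abbreviation poly_minus_op (infixl "-\<^sub>P" 65) where "p -\<^sub>P q \<equiv> p \<ominus>\<^bsub>P\<^esub> q"
abbreviation poly_uminus_op ("-\<^sub>P _" [81] 80) where "-\<^sub>P p \<equiv> \<ominus>\<^bsub>P\<^esub> p"
abbreviation poly_pow_op :: "'a list \<Rightarrow> nat \<Rightarrow> 'a list" (infixr "^\<^sub>P" 75)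
  where "p ^\<^sub>P n \<equiv> p [^]\<^bsub>P\<^esub> n"
abbreviation poly_zero_op ("0\<^sub>P") where "0\<^sub>P \<equiv> \<zero>\<^bsub>P\<^esub>"
abbreviation poly_one_op ("1\<^sub>P") where "1\<^sub>P \<equiv> \<one>\<^bsub>P\<^esub>"
abbreviation poly_dvd_op (infix "dvd\<^sub>P" 50) where "p dvd\<^sub>P q \<equiv> p divides\<^bsub>P\<^esub> q"

interpretation UP: principal_domain P
  by (rule univ_poly_is_principal[OF carrier_is_subfield])

lemmas sr = carrier_is_subring
lemmas sf = carrier_is_subfield

abbreviation cst :: "'a \<Rightarrow> 'a list" where "cst \<equiv> poly_of_const"

abbreviation lin :: "'a \<Rightarrow> 'a list" where "lin c \<equiv> [\<one>, c]"

lemma P_zero: "0\<^sub>P = []"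
  by (rule univ_poly_zero)

lemma P_one: "1\<^sub>P = [\<one>]"
  by (rule univ_poly_one)

lemma cst_hom: "ring_hom_ring R P cst"
  using canonical_embedding_ring_hom[OF sr] by simp

lemma cst_closed [simp]: "c \<in> carrier R \<Longrightarrow> cst c \<in> carrier P"
  using ring_hom_ring.homh[OF cst_hom] ring_hom_closed by fastforce

lemma cst_add: "a \<in> carrier R \<Longrightarrow> b \<in> carrier R \<Longrightarrow> cst (a \<oplus> b) = cst a +\<^sub>P cst b"
  using ring_hom_ring.homh[OF cst_hom] ring_hom_add by fastforce

lemma cst_mult: "a \<in> carrier R \<Longrightarrow> b \<in> carrier R \<Longrightarrow> cst (a \<otimes> b) = cst a *\<^sub>P cst b"
  using ring_hom_ring.homh[OF cst_hom] ring_hom_mult by fastforce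

lemma cst_one: "cst \<one> = 1\<^sub>P"
  using ring_hom_ring.homh[OF cst_hom] ring_hom_one by fastforce

lemma cst_zero: "cst \<zero> = 0\<^sub>P"
  by (simp add: poly_of_const_def P_zero)

lemma cst_minus: "a \<in> carrier R \<Longrightarrow> cst (\<ominus> a) = -\<^sub>P cst a"
proof -
  interpret h: ring_hom_ring R P cst by (rule cst_hom)
  show "a \<in> carrier R \<Longrightarrow> cst (\<ominus> a) = -\<^sub>P cst a" by simp
qed

lemma cst_pow: "a \<in> carrier R \<Longrightarrow> cst (a [^] (n::nat)) = cst a ^\<^sub>P n"
  by (induction n) (simp_all add: cst_one cst_mult)

lemma cst_list: "cst c = (if c = \<zero> then [] else [c])"
  by (simp add: poly_of_const_def)

lemma length_cst: "length (cst c) \<le> 1"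
  by (simp add: cst_list)

lemma eval_cst [simp]: "c \<in> carrier R \<Longrightarrow> x \<in> carrier R \<Longrightarrow> eval (cst c) x = c"
  by (simp add: cst_list)

lemma eval_hom: "x \<in> carrier R \<Longrightarrow> ring_hom_cring P R (\<lambda>p. eval p x)"
  by (rule eval_cring_hom[OF sr])

lemma eval_closed [simp]: "p \<in> carrier P \<Longrightarrow> x \<in> carrier R \<Longrightarrow> eval p x \<in> carrier R"
  using eval_poly_in_carrier[of "carrier R" p x] using carrier_is_subring by (simp add: univ_poly_carrier)

lemma eval_add [simp]:
  "p \<in> carrier P \<Longrightarrow> q \<in> carrier P \<Longrightarrow> x \<in> carrier R \<Longrightarrow> eval (p +\<^sub>P q) x = eval p x \<oplus> eval q x"
  by (rule ring_hom_add[OF eval_is_hom[OF sr]])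

lemma eval_mult [simp]:
  "p \<in> carrier P \<Longrightarrow> q \<in> carrier P \<Longrightarrow> x \<in> carrier R \<Longrightarrow> eval (p *\<^sub>P q) x = eval p x \<otimes> eval q x"
  by (rule ring_hom_mult[OF eval_is_hom[OF sr]])

lemma eval_one [simp]: "x \<in> carrier R \<Longrightarrow> eval 1\<^sub>P x = \<one>"
  by (rule ring_hom_one[OF eval_is_hom[OF sr]])

lemma eval_zero [simp]: "eval 0\<^sub>P x = \<zero>"
  by (simp add: P_zero)

lemma eval_uminus [simp]: "p \<in> carrier P \<Longrightarrow> x \<in> carrier R \<Longrightarrow> eval (-\<^sub>P p) x = \<ominus> eval p x"
proof -
  assume a: "p \<in> carrier P" "x \<in> carrier R"
  interpret h: ring_hom_cring P R "\<lambda>p. eval p x" by (rule eval_hom[OF a(2)])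
  show ?thesis using a by simp
qed

lemma eval_minus [simp]:
  "p \<in> carrier P \<Longrightarrow> q \<in> carrier P \<Longrightarrow> x \<in> carrier R \<Longrightarrow> eval (p -\<^sub>P q) x = eval p x \<ominus> eval q x"
  by (simp add: UP.minus_eq minus_eq)

lemma eval_pow [simp]:
  "p \<in> carrier P \<Longrightarrow> x \<in> carrier R \<Longrightarrow> eval (p ^\<^sub>P (n::nat)) x = eval p x [^] n"
  by (induction n) simp_all

lemma X_closed [simp]: "X \<in> carrier P"
  by (rule var_closed(1)[OF sr])

lemma lin_closed [simp]: "c \<in> carrier R \<Longrightarrow> lin c \<in> carrier P"
  by (simp add: univ_poly_carrier[symmetric] polynomial_def)

lemma eval_X [simp]: "x \<in> carrier R \<Longrightarrow> eval X x = x"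
  by (rule eval_var)

lemma lin_eq: "c \<in> carrier R \<Longrightarrow> lin c = X +\<^sub>P cst c"
  by (cases "c = \<zero>") (simp_all add: univ_poly_add var_def cst_list)

lemma eval_lin [simp]: "c \<in> carrier R \<Longrightarrow> x \<in> carrier R \<Longrightarrow> eval (lin c) x = x \<oplus> c"
  by (subst lin_eq) auto

lemma length_add: "length (p +\<^sub>P q) \<le> max (length p) (length q)"
  unfolding univ_poly_add by (rule poly_add_length_le)

lemma length_add_le: "length p \<le> n \<Longrightarrow> length q \<le> n \<Longrightarrow> length (p +\<^sub>P q) \<le> n"
  using length_add[of p q] by simp

lemma length_uminus: "p \<in> carrier P \<Longrightarrow> length (-\<^sub>P p) = length p"
  by (rule univ_poly_a_inv_length[OF sr])

lemma length_minus_le: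
  "p \<in> carrier P \<Longrightarrow> q \<in> carrier P \<Longrightarrow> length p \<le> n \<Longrightarrow> length q \<le> n \<Longrightarrow> length (p -\<^sub>P q) \<le> n"
  unfolding UP.minus_eq by (rule length_add_le) (simp_all add: length_uminus)

lemma mult_eq_Nil_iff:
  "p \<in> carrier P \<Longrightarrow> q \<in> carrier P \<Longrightarrow> p *\<^sub>P q = [] \<longleftrightarrow> p = [] \<or> q = []"
  using UP.integral_iff by (simp add: P_zero)

lemma length_mult:
  assumes "p \<in> carrier P" "q \<in> carrier P" "p \<noteq> []" "q \<noteq> []"
  shows "length (p *\<^sub>P q) = length p + length q - 1"
proof -
  have "degree (p *\<^sub>P q) = degree p + degree q"
    using poly_mult_degree_eq[OF sr, of p q] assms by (simp add: univ_poly_mult univ_poly_carrier)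
  moreover have "p *\<^sub>P q \<noteq> []" using assms mult_eq_Nil_iff by blast
  moreover have "length p > 0" "length q > 0" using assms by auto
  moreover have "length (p *\<^sub>P q) > 0" using calculation(2) by simp
  ultimately show ?thesis by linarith
qed

lemma length_mult_le:
  assumes "p \<in> carrier P" "q \<in> carrier P" "length p \<le> m" "length q \<le> n"
  shows "length (p *\<^sub>P q) \<le> m + n - 1"
proof (cases "p = [] \<or> q = []")
  case True
  then show ?thesis using mult_eq_Nil_iff[OF assms(1,2)] by simp
next
  case False
  then show ?thesis using length_mult[OF assms(1,2)] assms(3,4) by simp
qed

lemma length_pow:
  assumes "p \<in> carrier P" "p \<noteq> []"
  shows "length (p ^\<^sub>P (n::nat)) = n * (length p - 1) + 1"
proof (induction n)
  case 0
  then show ?case by (simp add: P_one)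
next
  case (Suc n)
  have nz: "p ^\<^sub>P n \<noteq> []" by (rule polynomial_pow_not_zero[OF assms])
  have "length p > 0" using assms by simp
  then show ?case using length_mult[OF UP.nat_pow_closed[OF assms(1)] assms(1) nz assms(2)] Suc by simp
qed

lemma length_pow_le:
  assumes "p \<in> carrier P" "length p \<le> Suc d"
  shows "length (p ^\<^sub>P (n::nat)) \<le> n * d + 1"
proof (cases "p = []")
  case True
  then show ?thesis
    using UP.nat_pow_zero[of n] by (cases n) (simp_all add: P_one P_zero)
next
  case False
  have "length p - 1 \<le> d" using assms by simp
  then show ?thesis using length_pow[OF assms(1) False, of n] by simp
qed

lemma X_list: "X = [\<one>, \<zero>]"
  by (simp add: var_def)

section \<open>Counting polynomials and their zeros\<close>

lemma card_bounded_length: "card {p \<in> carrier P. length p \<le> n} = order R ^ n"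
proof -
  let ?L = "{xs. set xs \<subseteq> carrier R \<and> length xs = n}"
  \<comment> \<open>Polynomials of bounded length correspond to coefficient lists of full length,
    padded with leading zeros. This count plays the role of the dimension in
    \<open>stepanov\<close>.\<close>
  have "bij_betw normalize ?L {p \<in> carrier P. length p \<le> n}"
  proof (rule bij_betwI[of _ _ _ "\<lambda>p. replicate (n - length p) \<zero> @ p"])
    show "normalize \<in> ?L \<rightarrow> {p \<in> carrier P. length p \<le> n}"
      using normalize_gives_polynomial normalize_length_le by (auto simp: univ_poly_carrier[symmetric])
    show "(\<lambda>p. replicate (n - length p) \<zero> @ p) \<in> {p \<in> carrier P. length p \<le> n} \<rightarrow> ?L"
      by (auto simp: univ_poly_carrier[symmetric] polynomial_def)
    show "replicate (n - length (normalize x)) \<zero> @ normalize x = x" if "x \<in> ?L" for x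
      using normalize_trick[of x] that by simp
    show "normalize (replicate (n - length y) \<zero> @ y) = y" if "y \<in> {p \<in> carrier P. length p \<le> n}" for y
      using that by (auto simp: normalize_replicate_zero normalize_polynomial univ_poly_carrier[symmetric])
  qed
  then have "card {p \<in> carrier P. length p \<le> n} = card ?L" by (simp add: bij_betw_same_card)
  also have "\<dots> = order R ^ n"
    by (simp add: card_lists_length_eq finite_carrier order_def)
  finally show ?thesis .
qed

lemma finite_bounded_length: "finite {p \<in> carrier P. length p \<le> n}"
  using card_bounded_length[of n] order_ge_3 by (intro card_ge_0_finite) simp

text \<open>Adds up the multiplicities of the roots in \<open>A\<close>. In \<open>stepanov\<close>
  it turns zeros of order M on a set into a bound for its size by the degree divided by M.\<close>

lemma multiplicity_bound:
  assumes p: "p \<in> carrier P" "p \<noteq> []" and A: "A \<subseteq> carrier R"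
    and mult: "\<And>t. t \<in> A \<Longrightarrow> (lin (\<ominus> t) ^\<^sub>P (M::nat)) dvd\<^sub>P p"
  shows "M * card A < length p"
proof -
  have finA: "finite A" using A finite_carrier finite_subset by blast
  have "M \<le> count (roots p) t" if "t \<in> A" for t
    using alg_multE(2)[OF subsetD[OF A that] p, of M] mult[OF that]
    by (simp add: pdivides_def alg_mult_eq_count_roots[OF p(1), symmetric])
  then have "M * card A \<le> (\<Sum>t\<in>A. count (roots p) t)"
    using sum_bounded_below[of A M "count (roots p)"] by (simp add: mult.commute)
  also have "\<dots> = (\<Sum>t\<in>A. count (filter_mset (\<lambda>x. x \<in> A) (roots p)) t)" by simp
  also have "\<dots> = size (filter_mset (\<lambda>x. x \<in> A) (roots p))"
    using finA by (subst size_multiset_overloaded_eq)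
      (intro sum.mono_neutral_right, auto simp: not_in_iff)
  also have "\<dots> \<le> size (roots p)" by (rule size_filter_mset_lesseq)
  also have "\<dots> \<le> degree p" by (rule size_roots_le_degree[OF p(1)])
  also have "\<dots> < length p" using p by simp
  finally show ?thesis .
qed

lemma lin_divides:
  assumes "p \<in> carrier P" "t \<in> carrier R" "eval p t = \<zero>"
  shows "lin (\<ominus> t) dvd\<^sub>P p"
proof (cases "p = []")
  case True
  have "lin (\<ominus> t) dvd\<^sub>P 0\<^sub>P"
    using assms by (intro dividesI[of "0\<^sub>P"]) (simp_all add: UP.r_null)
  then show ?thesis using True by (simp add: P_zero)
next
  case False
  then have "is_root p t" using assms by (simp add: is_root_def)
  then show ?thesis using is_root_imp_pdivides[OF assms(1)] by (simp add: pdivides_def)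
qed

lemma roots_bound:
  assumes p: "p \<in> carrier P" "p \<noteq> []" and A: "A \<subseteq> carrier R"
    and root: "\<And>t. t \<in> A \<Longrightarrow> eval p t = \<zero>"
  shows "card A < length p"
proof -
  have "lin (\<ominus> t) ^\<^sub>P (1::nat) dvd\<^sub>P p" if "t \<in> A" for t
    using lin_divides[OF p(1) _ root[OF that]] subsetD[OF A that] by simp
  then show ?thesis using multiplicity_bound[OF p A, of 1] by simp
qed

text \<open>Both sides are monic of degree \<open>q\<close> and agree on the whole field.\<close>

lemma lin_pow_order:
  assumes c: "c \<in> carrier R"
  shows "lin c ^\<^sub>P order R = X ^\<^sub>P order R +\<^sub>P cst c"
proof -
  \<comment> \<open>Only monicity is recorded here. That the middle coefficients vanish for n = q
    comes out of the count of zeros below, without any divisibility of binomial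
    coefficients.\<close>
  have "\<exists>r\<in>carrier P. length r \<le> n \<and> lin c ^\<^sub>P n = X ^\<^sub>P n +\<^sub>P r" for n :: nat
  proof (induction n)
    case 0
    show ?case
    proof (rule bexI[of _ "0\<^sub>P"])
      show "length 0\<^sub>P \<le> 0 \<and> lin c ^\<^sub>P (0::nat) = X ^\<^sub>P (0::nat) +\<^sub>P 0\<^sub>P"
        by (simp, simp add: P_zero)
    qed simp
  next
    case (Suc n)
    then obtain r where r: "r \<in> carrier P" "length r \<le> n"
      "lin c ^\<^sub>P n = X ^\<^sub>P n +\<^sub>P r" by auto
    let ?r = "X ^\<^sub>P n *\<^sub>P cst c +\<^sub>P r *\<^sub>P lin c"
    have "lin c ^\<^sub>P Suc n = (X ^\<^sub>P n +\<^sub>P r) *\<^sub>P lin c" using r by simp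
    also have "\<dots> = X ^\<^sub>P n *\<^sub>P lin c +\<^sub>P r *\<^sub>P lin c"
      using r c by (intro UP.l_distr) auto
    also have "X ^\<^sub>P n *\<^sub>P lin c = X ^\<^sub>P Suc n +\<^sub>P X ^\<^sub>P n *\<^sub>P cst c"
      using c by (simp add: lin_eq UP.r_distr)
    finally have "lin c ^\<^sub>P Suc n = X ^\<^sub>P Suc n +\<^sub>P ?r"
      using r c by (simp add: UP.a_assoc)
    moreover have "length ?r \<le> Suc n"
    proof (rule length_add_le)
      have "length (X ^\<^sub>P n) \<le> Suc n" using length_pow_le[of X 1 n] by (simp add: X_list)
      then show "length (X ^\<^sub>P n *\<^sub>P cst c) \<le> Suc n"
        using length_mult_le[of "X ^\<^sub>P n" "cst c" "Suc n" 1] c length_cst by simp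
      show "length (r *\<^sub>P lin c) \<le> Suc n"
        using length_mult_le[OF r(1) lin_closed[OF c] r(2), of 2] by simp
    qed
    ultimately show ?case using r c by (intro bexI[of _ ?r]) auto
  qed
  then obtain r where r: "r \<in> carrier P" "length r \<le> order R"
      "lin c ^\<^sub>P order R = X ^\<^sub>P order R +\<^sub>P r" by blast
  have "length (cst c) \<le> order R" using length_cst[of c] order_ge_3 by simp
  then have len: "length (r -\<^sub>P cst c) \<le> order R" using r c by (intro length_minus_le) auto
  have "r -\<^sub>P cst c = []"
  proof (rule ccontr)
    assume nz: "r -\<^sub>P cst c \<noteq> []"
    have "eval (r -\<^sub>P cst c) t = \<zero>" if t: "t \<in> carrier R" for t
    proof -
      have "eval (lin c ^\<^sub>P order R) t = eval (X ^\<^sub>P order R +\<^sub>P r) t" using r by simp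
      then have "t \<oplus> c = t \<oplus> eval r t"
        using t c r(1) unfolding eval_pow[OF lin_closed[OF c] t]
        by (simp add: pow_order)
      then have "eval r t = c" using t c r(1) add.l_cancel[of t c "eval r t"] by simp
      then show ?thesis using t c r by simp
    qed
    then have "card (carrier R) < length (r -\<^sub>P cst c)"
      using r c nz by (intro roots_bound) auto
    then show False using len by (simp add: order_def)
  qed
  then have "r = cst c" using r c UP.r_right_minus_eq[of r "cst c"] by (simp add: P_zero)
  then show ?thesis using r by simp
qed

section \<open>Products of distinct linear factors and their powers\<close>

abbreviation Pd :: "nat \<Rightarrow> 'a list set" where
  "Pd n \<equiv> {p \<in> carrier P. length p \<le> n}"

text \<open>Indexed by a set, hence squarefree, so that for nonempty \<open>A\<close> it is not a
  constant times a square; for such a polynomial no bound on the character sum could hold.\<close>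

definition lprod :: "'a set \<Rightarrow> 'a list" where
  "lprod A = (\<Otimes>\<^bsub>P\<^esub>a\<in>A. lin a)"

lemma lprod_empty: "lprod {} = 1\<^sub>P"
  by (simp add: lprod_def)

lemma lprod_insert:
  assumes "finite A" "a \<notin> A" "insert a A \<subseteq> carrier R"
  shows "lprod (insert a A) = lin a *\<^sub>P lprod A"
  unfolding lprod_def using assms by (intro UP.finprod_insert) auto

lemma lprod_closed [simp]: "A \<subseteq> carrier R \<Longrightarrow> lprod A \<in> carrier P"
  unfolding lprod_def by (intro UP.finprod_closed) auto

lemma lprod_nonzero:
  assumes "A \<subseteq> carrier R"
  shows "lprod A \<noteq> [] \<and> length (lprod A) = Suc (card A)"
proof -
  have "finite A" using assms finite_carrier finite_subset by blast
  then show ?thesis using assms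
  proof (induction A)
    case empty
    then show ?case by (simp add: lprod_empty P_one)
  next
    case (insert a A)
    then have "lprod A \<noteq> []" "length (lprod A) = Suc (card A)" "lprod A \<in> carrier P" "lin a \<in> carrier P"
      by auto
    then show ?case
      using lprod_insert[OF insert(1,2,4)] length_mult[of "lin a" "lprod A"] mult_eq_Nil_iff[of "lin a" "lprod A"]
        insert(1,2) by auto
  qed
qed

lemma eval_lprod:
  assumes "A \<subseteq> carrier R" "x \<in> carrier R"
  shows "eval (lprod A) x = (\<Otimes>a\<in>A. x \<oplus> a)"
proof -
  have "finite A" using assms finite_carrier finite_subset by blast
  then show ?thesis using assms(1)
  proof (induction A)
    case empty
    then show ?case using assms(2) by (simp add: lprod_empty)
  next
    case (insert a A)
    then have "(\<Otimes>a\<in>insert a A. x \<oplus> a) = (x \<oplus> a) \<otimes> (\<Otimes>a\<in>A. x \<oplus> a)"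
      using assms(2) by (intro finprod_insert) auto
    then show ?case using insert assms(2) lprod_insert[OF insert(1,2,4)] by simp
  qed
qed

lemma finprod_eq_zero_iff:
  assumes "finite A" "\<And>a. a \<in> A \<Longrightarrow> h a \<in> carrier R"
  shows "(\<Otimes>a\<in>A. h a) = \<zero> \<longleftrightarrow> (\<exists>a\<in>A. h a = \<zero>)"
  using assms
proof (induction A)
  case (insert a A)
  then have "(\<Otimes>a\<in>insert a A. h a) = h a \<otimes> (\<Otimes>a\<in>A. h a)"
    by (intro finprod_insert) auto
  moreover have "(\<Otimes>a\<in>A. h a) \<in> carrier R" using insert by (intro finprod_closed) auto
  ultimately show ?case using insert integral_iff[of "h a" "(\<Otimes>a\<in>A. h a)"] by auto
qed simp

text \<open>The Frobenius map fixes the coefficients, so the q-th power is a polynomial in X^q, and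
  modulo X^q only its constant term survives.\<close>

lemma lprod_pow_order:
  assumes "A \<subseteq> carrier R"
  shows "\<exists>w\<in>carrier P. lprod A ^\<^sub>P order R = X ^\<^sub>P order R *\<^sub>P w +\<^sub>P cst (\<Otimes>a\<in>A. a)"
proof -
  have "finite A" using assms finite_carrier finite_subset by blast
  then show ?thesis using assms
  proof (induction A)
    case empty
    show ?case by (rule bexI[of _ "0\<^sub>P"]) (simp_all add: lprod_empty cst_one)
  next
    case (insert a A)
    then obtain w where w: "w \<in> carrier P"
      "lprod A ^\<^sub>P order R = X ^\<^sub>P order R *\<^sub>P w +\<^sub>P cst (\<Otimes>a\<in>A. a)" by auto
    let ?Z = "X ^\<^sub>P order R" and ?e = "\<Otimes>a\<in>A. a"
    have a: "a \<in> carrier R" and A: "A \<subseteq> carrier R" using insert by auto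
    have e: "?e \<in> carrier R" using A by (intro finprod_closed) auto
    have Z: "?Z \<in> carrier P" by simp
    have ring_id: "(z +\<^sub>P c) *\<^sub>P (z *\<^sub>P w +\<^sub>P d) =
        z *\<^sub>P (z *\<^sub>P w +\<^sub>P d +\<^sub>P c *\<^sub>P w) +\<^sub>P c *\<^sub>P d"
      if "z \<in> carrier P" "w \<in> carrier P" "c \<in> carrier P" "d \<in> carrier P" for z w c d
      using that by algebra
    have "(\<Otimes>b\<in>insert a A. b) = a \<otimes> ?e"
      using insert by (intro finprod_insert) auto
    then have ce: "cst (\<Otimes>b\<in>insert a A. b) = cst a *\<^sub>P cst ?e" using a e by (simp add: cst_mult)
    have "lprod (insert a A) ^\<^sub>P order R = lin a ^\<^sub>P order R *\<^sub>P lprod A ^\<^sub>P order R"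
      using lprod_insert[OF insert(1,2,4)] a A by (simp add: UP.nat_pow_distrib)
    also have "\<dots> = (?Z +\<^sub>P cst a) *\<^sub>P (?Z *\<^sub>P w +\<^sub>P cst ?e)"
      using w lin_pow_order[OF a] by simp
    also have "\<dots> = ?Z *\<^sub>P (?Z *\<^sub>P w +\<^sub>P cst ?e +\<^sub>P cst a *\<^sub>P w) +\<^sub>P cst a *\<^sub>P cst ?e"
      using ring_id[OF Z w(1) cst_closed[OF a] cst_closed[OF e]] .
    finally show ?case unfolding ce using w a e
      by (intro bexI[of _ "?Z *\<^sub>P w +\<^sub>P cst ?e +\<^sub>P cst a *\<^sub>P w"]) auto
  qed
qed

text \<open>A root \<open>-b\<close> of the squarefree \<open>lprod A\<close> would have odd order on the left and even order on the
  right; dividing \<open>u\<close> and \<open>v\<close> by \<open>X + b\<close> gives a descent.\<close>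

lemma lprod_times_square:
  assumes A: "A \<subseteq> carrier R" "A \<noteq> {}" and e: "e \<in> carrier R" "e \<noteq> \<zero>"
    and u: "u \<in> carrier P" and v: "v \<in> carrier P"
    and eq: "lprod A *\<^sub>P (u *\<^sub>P u) = cst e *\<^sub>P (v *\<^sub>P v)"
  shows "u = [] \<and> v = []"
proof -
  have finA: "finite A" using A finite_carrier finite_subset by blast
  obtain b where b: "b \<in> A" using A by auto
  have bR: "b \<in> carrier R" and mb: "\<ominus> b \<in> carrier R" using b A by auto
  define l where "l = lin b"
  have lP: "l \<in> carrier P" and lnz: "l \<noteq> []" and llen: "length l = 2" using bR by (auto simp: l_def)
  define f where "f = lprod (A - {b})"
  have fP: "f \<in> carrier P" unfolding f_def using A by (intro lprod_closed) auto
  have lf: "lprod A = l *\<^sub>P f"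
    unfolding l_def f_def using lprod_insert[of "A - {b}" b] finA A b by (simp add: insert_absorb)
  \<comment> \<open>\<open>A\<close> is a set, so \<open>\<ominus> b\<close> is a simple zero of
    \<open>lprod A\<close>.\<close>
  have fb: "eval f (\<ominus> b) \<noteq> \<zero>"
  proof -
    have "\<ominus> b \<oplus> a \<noteq> \<zero>" if "a \<in> A - {b}" for a
      using that A bR mb by (metis DiffE a_comm add.inv_closed minus_equality minus_minus singletonI subsetD)
    then show ?thesis
      unfolding f_def using A mb finA
      by (subst eval_lprod, simp, blast, simp) (subst finprod_eq_zero_iff, auto)
  qed
  have lev: "eval l (\<ominus> b) = \<zero>" unfolding l_def using bR mb by (simp add: l_neg)
  have divl: "\<exists>p'\<in>carrier P. p = l *\<^sub>P p'" if p: "p \<in> carrier P" "eval p (\<ominus> b) = \<zero>" for p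
    using lin_divides[OF p(1) mb p(2)] bR unfolding l_def factor_def by auto
  have "length u + length v \<le> n \<Longrightarrow> u \<in> carrier P \<Longrightarrow> v \<in> carrier P \<Longrightarrow>
    l *\<^sub>P f *\<^sub>P (u *\<^sub>P u) = cst e *\<^sub>P (v *\<^sub>P v) \<Longrightarrow> u = [] \<and> v = []" for n u v
  proof (induction n arbitrary: u v)
    case 0
    then show ?case by simp
  next
    case (Suc n)
    note u = Suc.prems(2) and v = Suc.prems(3) and eq = Suc.prems(4)
    have ce: "cst e \<in> carrier P" "cst e \<noteq> []" using e(2) by (simp_all add: cst_closed[OF e(1)], simp add: cst_list)
    have "eval (l *\<^sub>P f *\<^sub>P (u *\<^sub>P u)) (\<ominus> b) = \<zero>" using lP fP u mb lev by simp
    then have "e \<otimes> (eval v (\<ominus> b) \<otimes> eval v (\<ominus> b)) = \<zero>" unfolding eq using e v mb by simp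
    then have "eval v (\<ominus> b) = \<zero>" using e v mb integral_iff by auto
    then obtain v' where v': "v' \<in> carrier P" "v = l *\<^sub>P v'" using divl[OF v] by auto
    have "l *\<^sub>P (f *\<^sub>P (u *\<^sub>P u)) = l *\<^sub>P (cst e *\<^sub>P (l *\<^sub>P (v' *\<^sub>P v')))"
    proof -
      have "l *\<^sub>P (f *\<^sub>P (u *\<^sub>P u)) = l *\<^sub>P f *\<^sub>P (u *\<^sub>P u)"
        using lP fP u by (simp add: UP.m_assoc)
      also have "\<dots> = cst e *\<^sub>P (l *\<^sub>P v' *\<^sub>P (l *\<^sub>P v'))" using eq v' by simp
      also have "\<dots> = l *\<^sub>P (cst e *\<^sub>P (l *\<^sub>P (v' *\<^sub>P v')))"
        using ce(1) lP v'(1) by algebra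
      finally show ?thesis .
    qed
    then have eq2: "f *\<^sub>P (u *\<^sub>P u) = cst e *\<^sub>P (l *\<^sub>P (v' *\<^sub>P v'))"
      using lP lnz fP u ce v' by (subst (asm) UP.m_lcancel) (auto simp: P_zero)
    then have "eval (f *\<^sub>P (u *\<^sub>P u)) (\<ominus> b) = \<zero>" using lP ce e v' mb lev by simp
    then have "eval u (\<ominus> b) = \<zero>" using fP u mb fb by (auto simp: integral_iff)
    then obtain u' where u': "u' \<in> carrier P" "u = l *\<^sub>P u'" using divl[OF u] by auto
    have "l *\<^sub>P (l *\<^sub>P f *\<^sub>P (u' *\<^sub>P u')) = l *\<^sub>P (cst e *\<^sub>P (v' *\<^sub>P v'))"
    proof -
      have "l *\<^sub>P (l *\<^sub>P f *\<^sub>P (u' *\<^sub>P u')) = f *\<^sub>P (l *\<^sub>P u' *\<^sub>P (l *\<^sub>P u'))"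
        using lP fP u'(1) by algebra
      also have "\<dots> = cst e *\<^sub>P (l *\<^sub>P (v' *\<^sub>P v'))" using eq2 u' by simp
      also have "\<dots> = l *\<^sub>P (cst e *\<^sub>P (v' *\<^sub>P v'))" using ce(1) lP v'(1) by algebra
      finally show ?thesis .
    qed
    then have eq3: "l *\<^sub>P f *\<^sub>P (u' *\<^sub>P u') = cst e *\<^sub>P (v' *\<^sub>P v')"
      using lP lnz fP u' ce v' by (subst (asm) UP.m_lcancel) (auto simp: P_zero)
    have shrink: "p' = [] \<or> length (l *\<^sub>P p') = Suc (length p')" if "p' \<in> carrier P" for p'
      using length_mult[OF lP that lnz] llen by (cases "p' = []") auto
    have l0: "l *\<^sub>P [] = []" using UP.r_null[OF lP] by (simp add: P_zero)
    show ?case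
    proof (cases "u' = [] \<and> v' = []")
      case True
      then show ?thesis using u' v' l0 by simp
    next
      case False
      have "length u' + length v' < length u + length v"
        using False shrink[OF u'(1)] shrink[OF v'(1)] u' v' l0 by auto
      then have "u' = [] \<and> v' = []" using Suc.IH[OF _ u'(1) v'(1) eq3] Suc.prems(1) by simp
      then show ?thesis using False by simp
    qed
  qed
  from this[OF order_refl u v] show ?thesis using eq lf by simp
qed

text \<open>Let f = \<open>lprod A\<close> and g = f^((q-1)/2). Multiplying u + v g by u - v g and
  by f gives f u^2 - f g^2 v^2, and f g^2 = f^q is congruent to its constant term e modulo X^q. The
  bound on \<open>B\<close> turns the congruence f u^2 = e v^2 into an equality, to which
  \<open>lprod_times_square\<close> applies; \<open>\<zero> \<notin> A\<close> ensures that e is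
  nonzero.\<close>

lemma lprod_half_power_independent:
  assumes A: "A \<subseteq> carrier R" "A \<noteq> {}" "\<zero> \<notin> A"
    and u: "u \<in> Pd B" and v: "v \<in> Pd B" and B: "2 * B + card A \<le> order R + 1"
    and dvd: "X ^\<^sub>P order R dvd\<^sub>P (u +\<^sub>P v *\<^sub>P lprod A ^\<^sub>P (order R div 2))"
  shows "u = [] \<and> v = []"
proof (cases "B = 0")
  case True
  then show ?thesis using u v by simp
next
  case False
  have finA: "finite A" using A finite_carrier finite_subset by blast
  define Z where "Z = X ^\<^sub>P order R"
  define f where "f = lprod A"
  define g where "g = f ^\<^sub>P (order R div 2)"
  define e where "e = (\<Otimes>a\<in>A. a)"
  have e: "e \<in> carrier R" "e \<noteq> \<zero>"
    unfolding e_def using A finA finprod_eq_zero_iff[of A "\<lambda>a. a"] by (auto intro!: finprod_closed)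
  have c: "Z \<in> carrier P" "f \<in> carrier P" "g \<in> carrier P" "u \<in> carrier P" "v \<in> carrier P" "cst e \<in> carrier P"
    using A u v e by (auto simp: Z_def f_def g_def)
  have lZ: "length Z = order R + 1" unfolding Z_def using length_pow[of X "order R"] by (simp add: X_list)
  obtain k where k: "k \<in> carrier P" "u +\<^sub>P v *\<^sub>P g = Z *\<^sub>P k"
    using dvd unfolding Z_def f_def g_def factor_def by auto
  obtain w where w: "w \<in> carrier P" "f ^\<^sub>P order R = Z *\<^sub>P w +\<^sub>P cst e"
    using lprod_pow_order[OF A(1)] unfolding Z_def f_def e_def by auto
  have "f *\<^sub>P (g *\<^sub>P g) = f ^\<^sub>P (1 + (order R div 2 + order R div 2))"
    unfolding g_def using c by (simp add: UP.nat_pow_mult UP.m_comm)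
  also have "1 + (order R div 2 + order R div 2) = order R" using half_order order_ge_3 by linarith
  finally have fgg: "f *\<^sub>P (g *\<^sub>P g) = Z *\<^sub>P w +\<^sub>P cst e" using w by simp
  let ?D = "f *\<^sub>P (u *\<^sub>P u) -\<^sub>P cst e *\<^sub>P (v *\<^sub>P v)"
  have "?D = f *\<^sub>P ((u +\<^sub>P v *\<^sub>P g) *\<^sub>P (u -\<^sub>P v *\<^sub>P g)) +\<^sub>P
      (f *\<^sub>P (g *\<^sub>P g) -\<^sub>P cst e) *\<^sub>P (v *\<^sub>P v)"
    using c by algebra
  also have "\<dots> = f *\<^sub>P (Z *\<^sub>P k *\<^sub>P (u -\<^sub>P v *\<^sub>P g)) +\<^sub>P
      (Z *\<^sub>P w +\<^sub>P cst e -\<^sub>P cst e) *\<^sub>P (v *\<^sub>P v)"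
    using k(2) fgg by simp
  also have "\<dots> = Z *\<^sub>P (f *\<^sub>P k *\<^sub>P (u -\<^sub>P v *\<^sub>P g) +\<^sub>P w *\<^sub>P (v *\<^sub>P v))"
    using c k(1) w(1) by algebra
  finally have DZ: "?D = Z *\<^sub>P (f *\<^sub>P k *\<^sub>P (u -\<^sub>P v *\<^sub>P g) +\<^sub>P w *\<^sub>P (v *\<^sub>P v))"
    (is "_ = _ *\<^sub>P ?k") .
  have kP: "?k \<in> carrier P" using c k(1) w(1) by simp
  have lf: "length f = Suc (card A)" unfolding f_def using lprod_nonzero[OF A(1)] by simp
  have uu: "length (u *\<^sub>P u) \<le> 2 * B - 1" using length_mult_le[of u u B B] u by (simp add: mult_2)
  have vv: "length (v *\<^sub>P v) \<le> 2 * B - 1" using length_mult_le[of v v B B] v by (simp add: mult_2)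
  \<comment> \<open>A nonzero multiple of \<open>Z\<close> has length at least q + 1, so this forces
    the cofactor \<open>?k\<close>, and with it \<open>?D\<close>, to vanish.\<close>
  have "length ?D \<le> order R"
  proof (rule length_minus_le)
    show "length (f *\<^sub>P (u *\<^sub>P u)) \<le> order R"
      using length_mult_le[of f "u *\<^sub>P u" "Suc (card A)" "2 * B - 1"] uu lf c B False by simp
    have "card A > 0" using A finA by (simp add: card_gt_0_iff)
    then show "length (cst e *\<^sub>P (v *\<^sub>P v)) \<le> order R"
      using length_mult_le[of "cst e" "v *\<^sub>P v" 1 "2 * B - 1"] vv c B False length_cst[of e] by simp
  qed (use c in auto)
  then have "?k = []"
    using length_mult[of Z ?k] kP c(1) lZ DZ by (cases "?k = []"; cases "Z = []") auto
  then have "?D = 0\<^sub>P" using DZ c(1) by (simp add: P_zero[symmetric] UP.r_null del: P_zero)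
  then have "f *\<^sub>P (u *\<^sub>P u) = cst e *\<^sub>P (v *\<^sub>P v)" using c by simp
  then show ?thesis using lprod_times_square[OF A(1,2) e c(4,5)] unfolding f_def by blast
qed

section \<open>Stepanov's method\<close>

text \<open>The value of \<open>taylor t ps\<close> is the polynomial whose expansion at \<open>t\<close> has the values of the
  polynomials \<open>ps\<close> at \<open>t\<close> as coefficients.\<close>

fun taylor :: "'a \<Rightarrow> 'a list list \<Rightarrow> 'a list" where
  "taylor t [] = 0\<^sub>P"
| "taylor t (p # ps) = cst (eval p t) +\<^sub>P lin (\<ominus> t) *\<^sub>P taylor t ps"

lemma taylor_closed [simp]:
  "t \<in> carrier R \<Longrightarrow> set ps \<subseteq> carrier P \<Longrightarrow> taylor t ps \<in> carrier P"
  by (induction ps) auto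

text \<open>The essential point is that \<open>ps\<close> is chosen before t: the coefficients of
  the expansion at t are given by fixed polynomials in t of length at most D. Cut off after M terms,
  the whole family is described by M such polynomials, and these can be counted.\<close>

definition expandable :: "nat \<Rightarrow> ('a \<Rightarrow> 'a list) \<Rightarrow> bool" where
  "expandable D h \<longleftrightarrow> (\<exists>ps. set ps \<subseteq> Pd D \<and> (\<forall>t\<in>carrier R. h t = taylor t ps))"

lemma expandableI: "set ps \<subseteq> Pd D \<Longrightarrow> (\<And>t. t \<in> carrier R \<Longrightarrow> h t = taylor t ps) \<Longrightarrow> expandable D h"
  unfolding expandable_def by blast

lemma expandableE:
  assumes "expandable D h"
  obtains ps where "set ps \<subseteq> Pd D" "set ps \<subseteq> carrier P" "\<forall>t\<in>carrier R. h t = taylor t ps"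
  using assms unfolding expandable_def by (metis (no_types, lifting) mem_Collect_eq subset_iff)

lemma expandable_closed: "expandable D h \<Longrightarrow> t \<in> carrier R \<Longrightarrow> h t \<in> carrier P"
  by (elim expandableE) simp

lemma expandable_cong:
  assumes "expandable D h" "\<And>t. t \<in> carrier R \<Longrightarrow> h' t = h t"
  shows "expandable D h'"
  using assms unfolding expandable_def by auto

lemma expandable_mono: "expandable D h \<Longrightarrow> D \<le> E \<Longrightarrow> expandable E h"
  unfolding expandable_def by force

lemma expandable_zero: "expandable D (\<lambda>t. 0\<^sub>P)"
  by (rule expandableI[of "[]"]) auto

lemma expandable_one: "expandable 1 (\<lambda>t. 1\<^sub>P)"
proof (rule expandableI[of "[1\<^sub>P]"])
  show "set [1\<^sub>P] \<subseteq> Pd 1" using UP.one_closed by (simp, simp add: P_one)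
qed (simp add: cst_one)

fun add_lists :: "'a list list \<Rightarrow> 'a list list \<Rightarrow> 'a list list" where
  "add_lists [] qs = qs"
| "add_lists (p # ps) [] = p # ps"
| "add_lists (p # ps) (q # qs) = (p +\<^sub>P q) # add_lists ps qs"

lemma expandable_add:
  assumes "expandable D h" "expandable D k"
  shows "expandable D (\<lambda>t. h t +\<^sub>P k t)"
proof -
  obtain ps where ps: "set ps \<subseteq> Pd D" "set ps \<subseteq> carrier P" "\<forall>t\<in>carrier R. h t = taylor t ps"
    using assms(1) by (rule expandableE)
  obtain qs where qs: "set qs \<subseteq> Pd D" "set qs \<subseteq> carrier P" "\<forall>t\<in>carrier R. k t = taylor t qs"
    using assms(2) by (rule expandableE)
  have "set (add_lists ps qs) \<subseteq> Pd D"
    using ps(1) qs(1) by (induction ps qs rule: add_lists.induct) (auto intro: length_add_le)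
  moreover have "taylor t ps +\<^sub>P taylor t qs = taylor t (add_lists ps qs)" if t: "t \<in> carrier R" for t
    using ps(1) qs(1)
  proof (induction ps qs rule: add_lists.induct)
    case (1 qs)
    then have "set qs \<subseteq> carrier P" by auto
    then show ?case using t by simp
  next
    case (2 p ps)
    then have "set (p # ps) \<subseteq> carrier P" by auto
    then have "taylor t (p # ps) \<in> carrier P" using t taylor_closed by blast
    then show ?case by simp
  next
    case (3 p ps q qs)
    then have c: "p \<in> carrier P" "q \<in> carrier P" "set ps \<subseteq> carrier P" "set qs \<subseteq> carrier P" by auto
    have IH: "taylor t ps +\<^sub>P taylor t qs = taylor t (add_lists ps qs)" using 3 by auto
    have cs: "cst (eval p t) \<in> carrier P" "cst (eval q t) \<in> carrier P" "lin (\<ominus> t) \<in> carrier P"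
      "taylor t ps \<in> carrier P" "taylor t qs \<in> carrier P" using c t by auto
    have ring_id: "x +\<^sub>P l *\<^sub>P y +\<^sub>P (x' +\<^sub>P l *\<^sub>P y') = x +\<^sub>P x' +\<^sub>P l *\<^sub>P (y +\<^sub>P y')"
      if "x \<in> carrier P" "x' \<in> carrier P" "l \<in> carrier P" "y \<in> carrier P" "y' \<in> carrier P" for x x' l y y'
      using that by algebra
    show ?case using ring_id[OF cs] c t by (simp add: IH[symmetric] cst_add)
  qed
  ultimately show ?thesis using ps qs by (intro expandableI[of "add_lists ps qs"]) auto
qed

text \<open>A factor that is constant in X but polynomial in t can be absorbed into each
  coefficient.\<close>

lemma expandable_map:
  assumes h: "expandable D h" and z: "z \<in> carrier P" "length z \<le> Suc d"
  shows "expandable (D + d) (\<lambda>t. cst (eval z t) *\<^sub>P h t)"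
proof -
  obtain ps where ps: "set ps \<subseteq> Pd D" "set ps \<subseteq> carrier P" "\<forall>t\<in>carrier R. h t = taylor t ps"
    using h by (rule expandableE)
  show ?thesis
  proof (rule expandableI[of "map (\<lambda>p. z *\<^sub>P p) ps"])
    show "set (map (\<lambda>p. z *\<^sub>P p) ps) \<subseteq> Pd (D + d)"
    proof -
      have "length (z *\<^sub>P p) \<le> D + d" if "p \<in> Pd D" for p
        using length_mult_le[OF z(1) _ z(2), of p D] that by simp
      then show ?thesis using ps(1) z(1) by auto
    qed
    fix t assume t: "t \<in> carrier R"
    have "cst (eval z t) *\<^sub>P taylor t ps = taylor t (map (\<lambda>p. z *\<^sub>P p) ps)"
      using ps(2)
    proof (induction ps)
      case Nil
      then show ?case using z t by simp
    next
      case (Cons p ps)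
      have cs: "cst (eval z t) \<in> carrier P" "cst (eval p t) \<in> carrier P" "lin (\<ominus> t) \<in> carrier P"
        "taylor t ps \<in> carrier P" using Cons t z by auto
      have ring_id: "z *\<^sub>P (x +\<^sub>P l *\<^sub>P y) = z *\<^sub>P x +\<^sub>P l *\<^sub>P (z *\<^sub>P y)"
        if "z \<in> carrier P" "x \<in> carrier P" "l \<in> carrier P" "y \<in> carrier P" for z x l y
        using that by algebra
      have IH: "cst (eval z t) *\<^sub>P taylor t ps = taylor t (map (\<lambda>p. z *\<^sub>P p) ps)"
        using Cons by auto
      show ?case using ring_id[OF cs] Cons.prems t z by (simp add: IH[symmetric] cst_mult)
    qed
    then show "cst (eval z t) *\<^sub>P h t = taylor t (map (\<lambda>p. z *\<^sub>P p) ps)" using ps(3) t by simp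
  qed
qed

lemma expandable_const:
  assumes "expandable D h" "c \<in> carrier R"
  shows "expandable D (\<lambda>t. cst c *\<^sub>P h t)"
  using expandable_map[OF assms(1) cst_closed[OF assms(2)], of 0] assms(2) length_cst[of c]
  by (auto elim!: expandable_cong)

lemma expandable_y:
  assumes "expandable D h"
  shows "expandable D (\<lambda>t. lin (\<ominus> t) *\<^sub>P h t)"
proof -
  obtain ps where ps: "set ps \<subseteq> Pd D" "set ps \<subseteq> carrier P" "\<forall>t\<in>carrier R. h t = taylor t ps"
    using assms by (rule expandableE)
  then show ?thesis
    by (intro expandableI[of "0\<^sub>P # ps"]) (auto simp: cst_zero, simp add: P_zero)
qed

text \<open>Write X = t + (X - t). The first summand raises the degrees of the coefficients in t by
  one, the second shifts the list of coefficients.\<close>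

lemma expandable_X:
  assumes "expandable D h"
  shows "expandable (Suc D) (\<lambda>t. X *\<^sub>P h t)"
proof -
  have "expandable (Suc D) (\<lambda>t. cst (eval X t) *\<^sub>P h t)"
    using expandable_map[OF assms X_closed, of 1] by (simp add: X_list)
  moreover have "expandable (Suc D) (\<lambda>t. lin (\<ominus> t) *\<^sub>P h t)"
    by (rule expandable_mono[OF expandable_y[OF assms]]) simp
  ultimately have "expandable (Suc D) (\<lambda>t. cst (eval X t) *\<^sub>P h t +\<^sub>P lin (\<ominus> t) *\<^sub>P h t)"
    by (rule expandable_add)
  then show ?thesis
  proof (rule expandable_cong)
    fix t assume t: "t \<in> carrier R"
    have c: "X \<in> carrier P" "cst t \<in> carrier P" "h t \<in> carrier P"
      using t expandable_closed[OF assms t] by auto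
    have ring_id: "x *\<^sub>P z = c *\<^sub>P z +\<^sub>P (x +\<^sub>P -\<^sub>P c) *\<^sub>P z"
      if "x \<in> carrier P" "c \<in> carrier P" "z \<in> carrier P" for x c z
      using that by algebra
    show "X *\<^sub>P h t = cst (eval X t) *\<^sub>P h t +\<^sub>P lin (\<ominus> t) *\<^sub>P h t"
      using ring_id[OF c] t by (simp add: lin_eq cst_minus)
  qed
qed

lemma poly_decompose:
  assumes "p \<in> carrier P" "length p \<le> Suc n"
  shows "\<exists>p' c. p' \<in> Pd n \<and> c \<in> carrier R \<and> p = X *\<^sub>P p' +\<^sub>P cst c"
proof -
  define c where "c = eval p \<zero>"
  have c: "c \<in> carrier R" unfolding c_def using assms by simp
  have "eval (p -\<^sub>P cst c) \<zero> = \<zero>" using assms c by (simp add: c_def[symmetric])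
  then have "lin (\<ominus> \<zero>) dvd\<^sub>P (p -\<^sub>P cst c)" using assms c by (intro lin_divides) auto
  then obtain p' where p': "p' \<in> carrier P" "p -\<^sub>P cst c = X *\<^sub>P p'"
    unfolding factor_def by (auto simp: X_list)
  have "length (p -\<^sub>P cst c) \<le> Suc n"
    using assms c length_cst[of c] by (intro length_minus_le) auto
  then have "length p' \<le> n"
    using length_mult[OF X_closed p'(1)] p'(2) by (cases "p' = []") (auto simp: X_list)
  moreover have "p = (p -\<^sub>P cst c) +\<^sub>P cst c" using assms(1) cst_closed[OF c] by algebra
  ultimately show ?thesis using p' c by auto
qed

lemma expandable_poly:
  assumes "expandable D h" "r \<in> Pd B"
  shows "expandable (D + B) (\<lambda>t. r *\<^sub>P h t)"
  using assms(2)
proof (induction B arbitrary: r)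
  case 0
  then have "r = 0\<^sub>P" by (simp add: P_zero)
  then show ?case
    using expandable_cong[OF expandable_zero[of D], of "\<lambda>t. r *\<^sub>P h t"] expandable_closed[OF assms(1)] by simp
next
  case (Suc B)
  then obtain r' c where r: "r' \<in> Pd B" "c \<in> carrier R" "r = X *\<^sub>P r' +\<^sub>P cst c"
    using poly_decompose by blast
  have 1: "expandable (D + Suc B) (\<lambda>t. X *\<^sub>P (r' *\<^sub>P h t))" using expandable_X[OF Suc.IH[OF r(1)]] by simp
  have 2: "expandable (D + Suc B) (\<lambda>t. cst c *\<^sub>P h t)"
    by (rule expandable_mono[OF expandable_const[OF assms(1) r(2)]]) simp
  show ?case
  proof (rule expandable_cong[OF expandable_add[OF 1 2]])
    fix t assume "t \<in> carrier R"
    then have "h t \<in> carrier P" by (rule expandable_closed[OF assms(1)])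
    then show "r *\<^sub>P h t = X *\<^sub>P (r' *\<^sub>P h t) +\<^sub>P cst c *\<^sub>P h t"
      using r by (simp add: UP.l_distr UP.m_assoc)
  qed
qed

text \<open>Better by one than \<open>expandable_poly\<close>, which charges 1 even for a constant
  factor. The difference would add up over the M factors in
  \<open>expandable_trunc_binomial\<close>.\<close>

lemma expandable_lprod:
  assumes h: "expandable D h" and A: "A \<subseteq> carrier R"
  shows "expandable (D + card A) (\<lambda>t. lprod A *\<^sub>P h t)"
proof -
  have "finite A" using A finite_carrier finite_subset by blast
  then show ?thesis using A
  proof (induction A)
    case empty
    show ?case by (rule expandable_cong[OF h[THEN expandable_mono]])
        (auto simp: lprod_empty expandable_closed[OF h])
  next
    case (insert a A)
    then have a: "a \<in> carrier R" and A: "A \<subseteq> carrier R" by auto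
    have IH: "expandable (D + card A) (\<lambda>t. lprod A *\<^sub>P h t)" using insert by auto
    have 1: "expandable (D + card (insert a A)) (\<lambda>t. X *\<^sub>P (lprod A *\<^sub>P h t))"
      using expandable_X[OF IH] insert(1,2) by simp
    have 2: "expandable (D + card (insert a A)) (\<lambda>t. cst a *\<^sub>P (lprod A *\<^sub>P h t))"
      by (rule expandable_mono[OF expandable_const[OF IH a]]) (use insert in simp)
    show ?case
    proof (rule expandable_cong[OF expandable_add[OF 1 2]])
      fix t assume "t \<in> carrier R"
      then have "h t \<in> carrier P" by (rule expandable_closed[OF h])
      then show "lprod (insert a A) *\<^sub>P h t =
          X *\<^sub>P (lprod A *\<^sub>P h t) +\<^sub>P cst a *\<^sub>P (lprod A *\<^sub>P h t)"
        using a A lprod_insert[OF insert(1,2,4)] by (simp add: lin_eq UP.l_distr UP.m_assoc)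
    qed
  qed
qed

text \<open>With \<open>v = f(t)\<close> and \<open>e = f - f(t)\<close> this is the sum of \<open>C(n,i) e^i v^(M-i)\<close> over \<open>i < M\<close>, that is,
  \<open>v^M\<close> times the truncated binomial expansion of \<open>(1 + e/v)^n\<close>.\<close>

fun trunc_binomial :: "'a list \<Rightarrow> 'a list \<Rightarrow> nat \<Rightarrow> nat \<Rightarrow> 'a list" where
  "trunc_binomial v e n 0 = 0\<^sub>P"
| "trunc_binomial v e 0 (Suc M) = v ^\<^sub>P Suc M"
| "trunc_binomial v e (Suc n) (Suc M) =
    trunc_binomial v e n (Suc M) +\<^sub>P e *\<^sub>P trunc_binomial v e n M"

lemma trunc_binomial_closed [simp]:
  "v \<in> carrier P \<Longrightarrow> e \<in> carrier P \<Longrightarrow> trunc_binomial v e n M \<in> carrier P"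
  by (induction v e n M rule: trunc_binomial.induct) auto

text \<open>The binomial expansion of (v + e)^n modulo e^M, multiplied by v^M to clear the negative
  powers of v. The factor v^n is what is wanted: for v = f(t) and n = (q - 1) / 2 it is the
  prescribed value \<open>a\<close>, so a power of f of high degree is exchanged for an expression
  of low degree in t.\<close>

lemma trunc_binomial_congruence:
  assumes v: "v \<in> carrier P" and e: "e \<in> carrier P"
  shows "\<exists>w\<in>carrier P. v ^\<^sub>P M *\<^sub>P (v +\<^sub>P e) ^\<^sub>P n =
    v ^\<^sub>P n *\<^sub>P trunc_binomial v e n M +\<^sub>P e ^\<^sub>P M *\<^sub>P w"
proof (induction n arbitrary: M)
  case 0
  show ?case
  proof (cases M)
    case 0
    then show ?thesis by (intro bexI[of _ "1\<^sub>P"]) auto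
  next
    case (Suc k)
    then show ?thesis using v e by (intro bexI[of _ "0\<^sub>P"]) auto
  qed
next
  case (Suc n)
  show ?case
  proof (cases M)
    case 0
    then show ?thesis using v e by (intro bexI[of _ "(v +\<^sub>P e) ^\<^sub>P Suc n"]) auto
  next
    case (Suc k)
    let ?T = "trunc_binomial v e n"
    obtain w where w: "w \<in> carrier P" "v ^\<^sub>P Suc k *\<^sub>P (v +\<^sub>P e) ^\<^sub>P n =
      v ^\<^sub>P n *\<^sub>P ?T (Suc k) +\<^sub>P e ^\<^sub>P Suc k *\<^sub>P w" using Suc.IH by blast
    obtain w' where w': "w' \<in> carrier P" "v ^\<^sub>P k *\<^sub>P (v +\<^sub>P e) ^\<^sub>P n =
      v ^\<^sub>P n *\<^sub>P ?T k +\<^sub>P e ^\<^sub>P k *\<^sub>P w'" using Suc.IH by blast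
    have id1: "(vk *\<^sub>P v) *\<^sub>P (g *\<^sub>P (v +\<^sub>P e)) =
        v *\<^sub>P ((vk *\<^sub>P v) *\<^sub>P g) +\<^sub>P (v *\<^sub>P e) *\<^sub>P (vk *\<^sub>P g)"
      if "vk \<in> carrier P" "g \<in> carrier P" for vk g using that v e by algebra
    have id2: "v *\<^sub>P (vn *\<^sub>P a +\<^sub>P (ek *\<^sub>P e) *\<^sub>P w) +\<^sub>P (v *\<^sub>P e) *\<^sub>P (vn *\<^sub>P b +\<^sub>P ek *\<^sub>P w') =
        (vn *\<^sub>P v) *\<^sub>P (a +\<^sub>P e *\<^sub>P b) +\<^sub>P (ek *\<^sub>P e) *\<^sub>P (v *\<^sub>P (w +\<^sub>P w'))"
      if "vn \<in> carrier P" "ek \<in> carrier P" "a \<in> carrier P" "b \<in> carrier P" "w \<in> carrier P" "w' \<in> carrier P"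
      for vn ek a b w w' using that v e by algebra
    have "v ^\<^sub>P Suc k *\<^sub>P (v +\<^sub>P e) ^\<^sub>P Suc n =
      v *\<^sub>P (v ^\<^sub>P Suc k *\<^sub>P (v +\<^sub>P e) ^\<^sub>P n) +\<^sub>P (v *\<^sub>P e) *\<^sub>P (v ^\<^sub>P k *\<^sub>P (v +\<^sub>P e) ^\<^sub>P n)"
      using id1[of "v ^\<^sub>P k" "(v +\<^sub>P e) ^\<^sub>P n"] v e by simp
    also have "\<dots> = v ^\<^sub>P Suc n *\<^sub>P trunc_binomial v e (Suc n) (Suc k) +\<^sub>P
        e ^\<^sub>P Suc k *\<^sub>P (v *\<^sub>P (w +\<^sub>P w'))"
      unfolding w(2) w'(2)
      using id2[of "v ^\<^sub>P n" "e ^\<^sub>P k" "?T (Suc k)" "?T k" w w'] v e w(1) w'(1) by simp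
    finally show ?thesis using Suc v w(1) w'(1) by (intro bexI[of _ "v *\<^sub>P (w +\<^sub>P w')"]) auto
  qed
qed

text \<open>Each term is a product of M factors \<open>v\<close> or \<open>e\<close>, up to an
  integer, and each factor costs \<open>card A\<close> in the degree of the coefficients. The
  exponent \<open>n\<close> does not enter.\<close>

lemma expandable_trunc_binomial:
  assumes A: "A \<subseteq> carrier R"
  defines "v \<equiv> \<lambda>t. cst (eval (lprod A) t)" and "e \<equiv> \<lambda>t. lprod A -\<^sub>P cst (eval (lprod A) t)"
  shows "expandable (M * card A + 1) (\<lambda>t. trunc_binomial (v t) (e t) n M)"
proof -
  have fP: "lprod A \<in> carrier P" "length (lprod A) \<le> Suc (card A)" using A lprod_nonzero[OF A] by auto
  have exp_v: "expandable (D + card A) (\<lambda>t. v t *\<^sub>P h t)" if "expandable D h" for D h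
    unfolding v_def by (rule expandable_map[OF that fP])
  have v: "v t \<in> carrier P" and e: "e t \<in> carrier P" if "t \<in> carrier R" for t
    using that fP by (auto simp: v_def e_def)
  have exp_e: "expandable (D + card A) (\<lambda>t. e t *\<^sub>P h t)" if h: "expandable D h" for D h
  proof (rule expandable_cong[OF expandable_add])
    show "expandable (D + card A) (\<lambda>t. lprod A *\<^sub>P h t)" by (rule expandable_lprod[OF h A])
    show "expandable (D + card A) (\<lambda>t. cst (\<ominus> \<one>) *\<^sub>P (v t *\<^sub>P h t))"
      by (rule expandable_const[OF exp_v[OF h]]) simp
    fix t assume t: "t \<in> carrier R"
    have ring_id: "(f -\<^sub>P v) *\<^sub>P h = f *\<^sub>P h +\<^sub>P (-\<^sub>P 1\<^sub>P) *\<^sub>P (v *\<^sub>P h)"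
      if "f \<in> carrier P" "v \<in> carrier P" "h \<in> carrier P" for f v h using that by algebra
    show "e t *\<^sub>P h t = lprod A *\<^sub>P h t +\<^sub>P cst (\<ominus> \<one>) *\<^sub>P (v t *\<^sub>P h t)"
      using ring_id[OF fP(1) v[OF t] expandable_closed[OF h t]]
      by (simp add: e_def v_def cst_minus cst_one)
  qed
  have exp_vpow: "expandable (M * card A + 1) (\<lambda>t. v t ^\<^sub>P M)" for M :: nat
  proof (induction M)
    case 0
    then show ?case using expandable_one by simp
  next
    case (Suc M)
    show ?case
      using expandable_cong[OF exp_v[OF Suc.IH], of "\<lambda>t. v t ^\<^sub>P Suc M"] v
      by (simp add: UP.m_comm algebra_simps)
  qed
  show ?thesis
  proof (induction n arbitrary: M)
    case 0
    show ?case
    proof (cases M)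
      case 0
      then show ?thesis using expandable_zero by simp
    next
      case (Suc k)
      show ?thesis using exp_vpow[of M] by (simp only: Suc trunc_binomial.simps)
    qed
  next
    case (Suc n)
    show ?case
    proof (cases M)
      case 0
      then show ?thesis using expandable_zero by simp
    next
      case (Suc k)
      have "expandable (Suc k * card A + 1) (\<lambda>t. e t *\<^sub>P trunc_binomial (v t) (e t) n k)"
        by (rule expandable_mono[OF exp_e[OF Suc.IH[of k]]]) simp
      then show ?thesis using expandable_add[OF Suc.IH[of "Suc k"]] Suc by simp
    qed
  qed
qed

text \<open>Stepanov's auxiliary polynomial in Horner form, the sum of (r_j + s_j g) X^(q j). Since
  X^q is congruent to t modulo (X - t)^q, the powers of X^q give many free coefficients while
  costing only one degree each locally.\<close>

fun aux_poly :: "'a list \<Rightarrow> ('a list \<times> 'a list) list \<Rightarrow> 'a list" where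
  "aux_poly g [] = 0\<^sub>P"
| "aux_poly g ((r, s) # L) = (r +\<^sub>P s *\<^sub>P g) +\<^sub>P X ^\<^sub>P order R *\<^sub>P aux_poly g L"

lemma aux_poly_closed [simp]:
  "g \<in> carrier P \<Longrightarrow> set L \<subseteq> Pd B \<times> Pd B \<Longrightarrow> aux_poly g L \<in> carrier P"
  by (induction g L rule: aux_poly.induct) auto

lemma length_X_pow: "length (X ^\<^sub>P n) = Suc n"
  using length_pow[of X n] by (simp add: X_list)

lemma length_aux_poly:
  assumes g: "g \<in> carrier P" "length g \<le> Suc k"
  shows "set L \<subseteq> Pd B \<times> Pd B \<Longrightarrow> length (aux_poly g L) \<le> B + k + order R * length L"
proof (induction L)
  case Nil
  then show ?case by (simp add: P_zero)
next
  case (Cons rs L)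
  obtain r s where rs: "rs = (r, s)" by force
  have c: "r \<in> Pd B" "s \<in> Pd B" and L: "set L \<subseteq> Pd B \<times> Pd B" using Cons.prems rs by auto
  have "length (s *\<^sub>P g) \<le> B + k" using length_mult_le[of s g B "Suc k"] c g by simp
  then have 1: "length (r +\<^sub>P s *\<^sub>P g) \<le> B + k" using c by (intro length_add_le) auto
  have "length (X ^\<^sub>P order R *\<^sub>P aux_poly g L) \<le> Suc (order R) + (B + k + order R * length L) - 1"
    using Cons.IH[OF L] aux_poly_closed[OF g(1) L] by (intro length_mult_le) (auto simp: length_X_pow)
  then have 2: "length (X ^\<^sub>P order R *\<^sub>P aux_poly g L) \<le> B + k + order R * length (rs # L)"
    by simp
  show ?case unfolding rs aux_poly.simps
    by (rule length_add_le) (use 1 2 rs in auto)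
qed

text \<open>The nonvanishing part of Stepanov's method, stated as injectivity because the pigeonhole
  argument compares two lists. Modulo X^q only the first pair is visible;
  \<open>lprod_half_power_independent\<close> recovers it, and X^q can be cancelled from the
  rest.\<close>

lemma aux_poly_inj:
  assumes A: "A \<subseteq> carrier R" "A \<noteq> {}" "\<zero> \<notin> A" and B: "2 * B + card A \<le> order R + 1"
  defines "g \<equiv> lprod A ^\<^sub>P (order R div 2)"
  shows "set L \<subseteq> Pd B \<times> Pd B \<Longrightarrow> set L' \<subseteq> Pd B \<times> Pd B \<Longrightarrow> length L = length L' \<Longrightarrow>
    aux_poly g L = aux_poly g L' \<Longrightarrow> L = L'"
proof (induction L arbitrary: L')
  case Nil
  then show ?case by simp
next
  case (Cons rs L)
  obtain rs' M where L': "L' = rs' # M" using Cons.prems by (cases L') auto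
  obtain r s where rs: "rs = (r, s)" by force
  obtain r' s' where rs': "rs' = (r', s')" by force
  define Z where "Z = X ^\<^sub>P order R"
  have gP: "g \<in> carrier P" using A by (simp add: g_def)
  have L: "set L \<subseteq> Pd B \<times> Pd B" "set M \<subseteq> Pd B \<times> Pd B" using Cons.prems L' by auto
  have b: "r \<in> Pd B" "s \<in> Pd B" "r' \<in> Pd B" "s' \<in> Pd B" using Cons.prems rs rs' L' by auto
  have c: "r \<in> carrier P" "s \<in> carrier P" "r' \<in> carrier P" "s' \<in> carrier P" "Z \<in> carrier P"
    "aux_poly g L \<in> carrier P" "aux_poly g M \<in> carrier P"
    using b aux_poly_closed[OF gP L(1)] aux_poly_closed[OF gP L(2)] by (auto simp: Z_def)
  let ?F = "aux_poly g L" and ?G = "aux_poly g M"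
  have eq: "r +\<^sub>P s *\<^sub>P g +\<^sub>P Z *\<^sub>P ?F = r' +\<^sub>P s' *\<^sub>P g +\<^sub>P Z *\<^sub>P ?G"
    using Cons.prems(4) unfolding L' rs rs' Z_def by simp
  have "(r -\<^sub>P r') +\<^sub>P (s -\<^sub>P s') *\<^sub>P g =
      (r +\<^sub>P s *\<^sub>P g +\<^sub>P Z *\<^sub>P ?F) -\<^sub>P (r' +\<^sub>P s' *\<^sub>P g +\<^sub>P Z *\<^sub>P ?G) +\<^sub>P Z *\<^sub>P (?G -\<^sub>P ?F)"
    using c gP by algebra
  also have "\<dots> = Z *\<^sub>P (?G -\<^sub>P ?F)" unfolding eq using c gP by algebra
  finally have "Z dvd\<^sub>P ((r -\<^sub>P r') +\<^sub>P (s -\<^sub>P s') *\<^sub>P g)"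
    using c by (intro dividesI[of "?G -\<^sub>P ?F"]) auto
  moreover have "r -\<^sub>P r' \<in> Pd B" "s -\<^sub>P s' \<in> Pd B" using b by (auto intro: length_minus_le)
  ultimately have "r -\<^sub>P r' = [] \<and> s -\<^sub>P s' = []"
    using lprod_half_power_independent[OF A _ _ B] unfolding Z_def g_def by blast
  then have e: "r = r'" "s = s'" using c by (simp_all add: P_zero[symmetric])
  have "Z *\<^sub>P ?F = Z *\<^sub>P ?G"
    using eq c gP UP.add.l_cancel[of "r' +\<^sub>P s' *\<^sub>P g" "Z *\<^sub>P ?F" "Z *\<^sub>P ?G"] unfolding e by simp
  moreover have "Z \<noteq> 0\<^sub>P" using length_X_pow[of "order R"] unfolding Z_def P_zero by auto
  ultimately have "?F = ?G" using c UP.m_lcancel by blast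
  then show ?case using Cons.IH[OF L] Cons.prems(3) e L' rs rs' by simp
qed

text \<open>At a point \<open>t\<close> with \<open>f(t)^((q-1)/2) = a\<close> the polynomials \<open>X^q\<close> and \<open>g\<close> are replaced by \<open>t\<close> and
  by \<open>a / f(t)^M\<close> times the truncated binomial \<open>S\<close>; here \<open>V = f(t)^M\<close>.\<close>

fun local_poly :: "'a list \<Rightarrow> 'a list \<Rightarrow> 'a \<Rightarrow> 'a \<Rightarrow> ('a list \<times> 'a list) list \<Rightarrow> 'a list" where
  "local_poly V S a t [] = 0\<^sub>P"
| "local_poly V S a t ((r, s) # L) =
    (r *\<^sub>P V +\<^sub>P cst a *\<^sub>P (s *\<^sub>P S)) +\<^sub>P cst (eval X t) *\<^sub>P local_poly V S a t L"

lemma local_poly_closed [simp]: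
  "V \<in> carrier P \<Longrightarrow> S \<in> carrier P \<Longrightarrow> a \<in> carrier R \<Longrightarrow> t \<in> carrier R \<Longrightarrow> set L \<subseteq> Pd B \<times> Pd B \<Longrightarrow>
    local_poly V S a t L \<in> carrier P"
  by (induction V S a t L rule: local_poly.induct) auto

lemma expandable_local_poly:
  assumes V: "expandable D V" and S: "expandable D S" and a: "a \<in> carrier R"
  shows "set L \<subseteq> Pd B \<times> Pd B \<Longrightarrow> expandable (D + B + length L) (\<lambda>t. local_poly (V t) (S t) a t L)"
proof (induction L)
  case Nil
  then show ?case using expandable_zero by simp
next
  case (Cons rs L)
  obtain r s where rs: "rs = (r, s)" by force
  have c: "r \<in> Pd B" "s \<in> Pd B" and L: "set L \<subseteq> Pd B \<times> Pd B" using Cons.prems rs by auto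
  have 1: "expandable (D + B) (\<lambda>t. r *\<^sub>P V t)" by (rule expandable_poly[OF V c(1)])
  have 2: "expandable (D + B) (\<lambda>t. cst a *\<^sub>P (s *\<^sub>P S t))"
    by (rule expandable_const[OF expandable_poly[OF S c(2)] a])
  have 12: "expandable (D + B + length (rs # L)) (\<lambda>t. r *\<^sub>P V t +\<^sub>P cst a *\<^sub>P (s *\<^sub>P S t))"
    by (rule expandable_mono[OF expandable_add[OF 1 2]]) simp
  have 3: "expandable (D + B + length (rs # L)) (\<lambda>t. cst (eval X t) *\<^sub>P local_poly (V t) (S t) a t L)"
    using expandable_map[OF Cons.IH[OF L] X_closed, of 1] by (simp add: X_list)
  show ?case using expandable_add[OF 12 3] by (simp add: rs)
qed

text \<open>Pure substitution modulo \<open>m\<close>, which will be (X - t)^M; the congruences are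
  carried with explicit cofactors \<open>z\<close>, \<open>w\<close> and \<open>k\<close>.\<close>

lemma aux_poly_congruence:
  assumes m: "m \<in> carrier P" and V: "V \<in> carrier P" and S: "S \<in> carrier P" and g: "g \<in> carrier P"
    and a: "a \<in> carrier R" and t: "t \<in> carrier R"
    and z: "z \<in> carrier P" "X ^\<^sub>P order R = cst t +\<^sub>P m *\<^sub>P z"
    and w: "w \<in> carrier P" "V *\<^sub>P g = cst a *\<^sub>P S +\<^sub>P m *\<^sub>P w"
  shows "set L \<subseteq> Pd B \<times> Pd B \<Longrightarrow>
    \<exists>k\<in>carrier P. V *\<^sub>P aux_poly g L = local_poly V S a t L +\<^sub>P m *\<^sub>P k"
proof (induction L)
  case Nil
  show ?case using V m by (intro bexI[of _ "0\<^sub>P"]) auto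
next
  case (Cons rs L)
  obtain r s where rs: "rs = (r, s)" by force
  have c: "r \<in> carrier P" "s \<in> carrier P" and L: "set L \<subseteq> Pd B \<times> Pd B" using Cons.prems rs by auto
  obtain k where k: "k \<in> carrier P"
    "V *\<^sub>P aux_poly g L = local_poly V S a t L +\<^sub>P m *\<^sub>P k" using Cons.IH[OF L] by auto
  have F: "aux_poly g L \<in> carrier P" and G: "local_poly V S a t L \<in> carrier P"
    using aux_poly_closed[OF g L] local_poly_closed[OF V S a t L] by auto
  have ca: "cst a \<in> carrier P" and ct: "cst t \<in> carrier P" using a t by auto
  have id1: "V *\<^sub>P (r +\<^sub>P s *\<^sub>P g +\<^sub>P Z *\<^sub>P F) = r *\<^sub>P V +\<^sub>P s *\<^sub>P (V *\<^sub>P g) +\<^sub>P Z *\<^sub>P (V *\<^sub>P F)"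
    if "Z \<in> carrier P" "F \<in> carrier P" for Z F using that V c g by algebra
  have id2: "r *\<^sub>P V +\<^sub>P s *\<^sub>P (a *\<^sub>P S +\<^sub>P m *\<^sub>P w) +\<^sub>P (t +\<^sub>P m *\<^sub>P z) *\<^sub>P (G +\<^sub>P m *\<^sub>P k) =
      r *\<^sub>P V +\<^sub>P a *\<^sub>P (s *\<^sub>P S) +\<^sub>P t *\<^sub>P G +\<^sub>P
      m *\<^sub>P (s *\<^sub>P w +\<^sub>P t *\<^sub>P k +\<^sub>P z *\<^sub>P (G +\<^sub>P m *\<^sub>P k))"
    if "a \<in> carrier P" "t \<in> carrier P" "G \<in> carrier P" for a t G
    using that c V S m w(1) z(1) k(1) by algebra
  have "V *\<^sub>P aux_poly g (rs # L) =
      r *\<^sub>P V +\<^sub>P s *\<^sub>P (V *\<^sub>P g) +\<^sub>P X ^\<^sub>P order R *\<^sub>P (V *\<^sub>P aux_poly g L)"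
    unfolding rs aux_poly.simps using F by (intro id1) auto
  also have "\<dots> = local_poly V S a t (rs # L) +\<^sub>P
      m *\<^sub>P (s *\<^sub>P w +\<^sub>P cst t *\<^sub>P k +\<^sub>P z *\<^sub>P (local_poly V S a t L +\<^sub>P m *\<^sub>P k))"
    unfolding w(2) z(2) k(2) using id2[OF ca ct G] t by (simp add: rs)
  finally show ?case
    by (rule bexI) (use c ct G m w(1) z(1) k(1) in simp)
qed

text \<open>Padding with zeros before cutting off makes the length exactly M for every list, as the
  counting in \<open>stepanov\<close> requires.\<close>

lemma taylor_take:
  assumes t: "t \<in> carrier R" and ps: "set ps \<subseteq> carrier P"
  shows "\<exists>k\<in>carrier P. taylor t ps = taylor t (take M (ps @ replicate M 0\<^sub>P)) +\<^sub>P lin (\<ominus> t) ^\<^sub>P M *\<^sub>P k"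
  using ps
proof (induction M arbitrary: ps)
  case 0
  then show ?case using t by (intro bexI[of _ "taylor t ps"]) auto
next
  case (Suc M)
  show ?case
  proof (cases ps)
    case Nil
    have "taylor t (replicate n 0\<^sub>P) = 0\<^sub>P" for n
      using t by (induction n) (auto simp: cst_zero)
    then show ?thesis using t Nil by (intro bexI[of _ "0\<^sub>P"]) (auto simp del: replicate_Suc)
  next
    case (Cons p ps')
    have p: "p \<in> carrier P" "set ps' \<subseteq> carrier P" using Suc.prems Cons by auto
    obtain k where k: "k \<in> carrier P" "taylor t ps' =
      taylor t (take M (ps' @ replicate M 0\<^sub>P)) +\<^sub>P lin (\<ominus> t) ^\<^sub>P M *\<^sub>P k" using Suc.IH[OF p(2)] by auto
    have take_eq: "take M (ps' @ replicate (Suc M) 0\<^sub>P) = take M (ps' @ replicate M 0\<^sub>P)"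
      by (simp add: take_replicate min_def del: replicate_Suc)
    let ?T = "taylor t (take M (ps' @ replicate M 0\<^sub>P))"
    have "set (take M (ps' @ replicate M 0\<^sub>P)) \<subseteq> carrier P"
      using p(2) UP.zero_closed by (auto dest!: in_set_takeD split: if_splits)
    then have T: "?T \<in> carrier P" using t by simp
    have ring_id: "c +\<^sub>P l *\<^sub>P (T +\<^sub>P lM *\<^sub>P k) = c +\<^sub>P l *\<^sub>P T +\<^sub>P (lM *\<^sub>P l) *\<^sub>P k"
      if "c \<in> carrier P" "l \<in> carrier P" "T \<in> carrier P" "lM \<in> carrier P" for c l T lM
      using that k(1) by algebra
    show ?thesis
    proof (rule bexI[OF _ k(1)])
      show "taylor t ps = taylor t (take (Suc M) (ps @ replicate (Suc M) 0\<^sub>P)) +\<^sub>P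
          lin (\<ominus> t) ^\<^sub>P Suc M *\<^sub>P k"
        unfolding Cons append_Cons take_Suc_Cons taylor.simps take_eq UP.nat_pow_Suc k(2)
        by (rule ring_id) (use p t T in auto)
    qed
  qed
qed

text \<open>There are q^(2BJ) coefficient lists, but their expansions up to order M are described by
  only q^(DM) lists of polynomials; \<open>dim\<close> makes the second number smaller. Two lists
  with the same expansions give a nonzero difference of auxiliary polynomials vanishing to order M
  on all of \<open>T\<close>, and its degree is bounded by the right-hand side.\<close>

theorem stepanov:
  assumes A: "A \<subseteq> carrier R" "A \<noteq> {}" "\<zero> \<notin> A" and a: "a \<in> carrier R"
    and T: "T \<subseteq> {t \<in> carrier R. eval (lprod A) t \<noteq> \<zero> \<and> eval (lprod A) t [^] (order R div 2) = a}"
    and M: "0 < M" "M \<le> order R" and B: "2 * B + card A \<le> order R + 1"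
    and dim: "(M * card A + 1 + B + J) * M < 2 * B * J"
  shows "M * card T < B + (order R div 2) * card A + order R * J"
proof -
  define f where "f = lprod A"
  define g where "g = f ^\<^sub>P (order R div 2)"
  define D where "D = M * card A + 1 + B + J"
  define v where "v t = cst (eval f t)" for t
  define e where "e t = f -\<^sub>P cst (eval f t)" for t
  define V where "V t = v t ^\<^sub>P M" for t
  define S where "S t = trunc_binomial (v t) (e t) (order R div 2) M" for t
  define y where "y t = lin (\<ominus> t) ^\<^sub>P M" for t
  have f: "f \<in> carrier P" and g: "g \<in> carrier P" using A by (auto simp: f_def g_def)
  have glen: "length g \<le> Suc ((order R div 2) * card A)"
    unfolding g_def using length_pow_le[OF f, of "card A"] lprod_nonzero[OF A(1)] by (simp add: f_def)
  have vP: "v t \<in> carrier P" and eP: "e t \<in> carrier P" if "t \<in> carrier R" for t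
    using that f by (auto simp: v_def e_def)
  have VP: "V t \<in> carrier P" and SP: "S t \<in> carrier P" and yP: "y t \<in> carrier P"
    if "t \<in> carrier R" for t
    using that vP eP by (auto simp: V_def S_def y_def)
  define Ls where "Ls = {L. set L \<subseteq> Pd B \<times> Pd B \<and> length L = J}"
  have fin: "finite (Pd B \<times> Pd B)" using finite_bounded_length by auto
  have Lmem: "set L \<subseteq> Pd B \<times> Pd B" "length L = J" if "L \<in> Ls" for L using that by (auto simp: Ls_def)
  have cardLs: "card Ls = order R ^ (2 * B * J)"
    unfolding Ls_def card_lists_length_eq[OF fin] card_cartesian_product card_bounded_length
    by (simp only: power_add[symmetric] power_mult[symmetric] mult_2)
  \<comment> \<open>For exponent 0 and M > 0 the truncated binomial is \<open>v ^ M\<close> itself,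
    so \<open>V\<close> is an instance of the same lemma.\<close>
  have expV: "expandable (M * card A + 1) V"
    using expandable_trunc_binomial[OF A(1), of M 0] M(1) unfolding V_def v_def e_def f_def by (cases M) auto
  have expS: "expandable (M * card A + 1) S"
    using expandable_trunc_binomial[OF A(1), of M "order R div 2"] unfolding S_def v_def e_def f_def .
  define Q where "Q L ps \<longleftrightarrow> set ps \<subseteq> Pd D \<and> length ps = M \<and>
      (\<forall>t\<in>carrier R. \<exists>k\<in>carrier P. local_poly (V t) (S t) a t L = taylor t ps +\<^sub>P y t *\<^sub>P k)" for L ps
  have "\<exists>ps. Q L ps" if L: "L \<in> Ls" for L
  proof -
    have "expandable D (\<lambda>t. local_poly (V t) (S t) a t L)"
      using expandable_local_poly[OF expV expS a Lmem(1)[OF L]] Lmem(2)[OF L] by (simp add: D_def add_ac)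
    then obtain ps where ps: "set ps \<subseteq> Pd D" "set ps \<subseteq> carrier P"
      "\<forall>t\<in>carrier R. local_poly (V t) (S t) a t L = taylor t ps" by (rule expandableE)
    have "set (take M (ps @ replicate M 0\<^sub>P)) \<subseteq> set ps \<union> {0\<^sub>P}"
      using set_take_subset[of M "ps @ replicate M 0\<^sub>P"] by (auto split: if_splits)
    moreover have "0\<^sub>P \<in> Pd D" using UP.zero_closed by (simp add: P_zero)
    ultimately have "set (take M (ps @ replicate M 0\<^sub>P)) \<subseteq> Pd D" using ps(1) by blast
    then show ?thesis using ps taylor_take[OF _ ps(2), of _ M] unfolding y_def Q_def
      by (intro exI[of _ "take M (ps @ replicate M 0\<^sub>P)"]) auto
  qed
  then have "\<forall>L\<in>Ls. \<exists>ps. Q L ps" by (intro ballI)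
  from bchoice[OF this] obtain \<Phi> where Q: "\<forall>L\<in>Ls. Q L (\<Phi> L)" by (rule exE)
  have \<Phi>: "set (\<Phi> L) \<subseteq> Pd D \<and> length (\<Phi> L) = M \<and>
      (\<forall>t\<in>carrier R. \<exists>k\<in>carrier P. local_poly (V t) (S t) a t L = taylor t (\<Phi> L) +\<^sub>P y t *\<^sub>P k)"
    if "L \<in> Ls" for L
    using bspec[OF Q that] unfolding Q_def .
  have finD: "finite {ps. set ps \<subseteq> Pd D \<and> length ps = M}"
    by (rule finite_lists_length_eq[OF finite_bounded_length])
  have "card (\<Phi> ` Ls) \<le> card {ps. set ps \<subseteq> Pd D \<and> length ps = M}"
    by (rule card_mono[OF finD]) (use \<Phi> in auto)
  also have "\<dots> = order R ^ (D * M)"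
    by (simp only: card_lists_length_eq[OF finite_bounded_length] card_bounded_length power_mult)
  also have "\<dots> < card Ls"
    unfolding cardLs using dim order_ge_3 by (intro power_strict_increasing) (auto simp: D_def)
  \<comment> \<open>The colliding pair replaces a kernel vector of the linear system that would say
    that all local coefficients vanish.\<close>
  finally have "\<not> inj_on \<Phi> Ls" by (rule pigeonhole)
  then obtain L L' where LL: "L \<in> Ls" "L' \<in> Ls" "L \<noteq> L'" "\<Phi> L = \<Phi> L'" unfolding inj_on_def by blast
  define F where "F = aux_poly g L"
  define F' where "F' = aux_poly g L'"
  have F: "F \<in> carrier P" "F' \<in> carrier P"
    unfolding F_def F'_def using aux_poly_closed[OF g Lmem(1)] LL by blast+
  have "F \<noteq> F'"
    using aux_poly_inj[OF A B, of L L'] LL Lmem unfolding F_def F'_def g_def f_def by auto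
  then have nz: "F -\<^sub>P F' \<noteq> []" using F by (simp add: P_zero[symmetric])
  have "length (F -\<^sub>P F') \<le> B + (order R div 2) * card A + order R * J"
    unfolding F_def F'_def using length_aux_poly[OF g glen Lmem(1)] Lmem(2) LL F[unfolded F_def F'_def]
    by (intro length_minus_le) auto
  moreover have "y t dvd\<^sub>P (F -\<^sub>P F')" if tT: "t \<in> T" for t
  proof -
    have t: "t \<in> carrier R" "eval f t \<noteq> \<zero>" "eval f t [^] (order R div 2) = a"
      using T tT by (auto simp: f_def)
    note tc = vP[OF t(1)] eP[OF t(1)] VP[OF t(1)] SP[OF t(1)] yP[OF t(1)]
    define z where "z = lin (\<ominus> t) ^\<^sub>P (order R - M)"
    have lt: "lin (\<ominus> t) \<in> carrier P" using t(1) by simp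
    have z1: "z \<in> carrier P" unfolding z_def using lt by (rule UP.nat_pow_closed)
    \<comment> \<open>X^q - t = (X - t)^q, and M \<le> q allows (X - t)^M to be split off.\<close>
    have z2: "X ^\<^sub>P order R = cst t +\<^sub>P y t *\<^sub>P z"
    proof -
      have id0: "x = c +\<^sub>P (x +\<^sub>P -\<^sub>P c)" if "x \<in> carrier P" "c \<in> carrier P" for x c
        using that by algebra
      have "y t *\<^sub>P z = lin (\<ominus> t) ^\<^sub>P (M + (order R - M))"
        unfolding y_def z_def by (rule UP.nat_pow_mult[OF lt])
      also have "M + (order R - M) = order R" using M(2) by simp
      also have "lin (\<ominus> t) ^\<^sub>P order R = X ^\<^sub>P order R +\<^sub>P -\<^sub>P cst t"
        using lin_pow_order[of "\<ominus> t"] cst_minus[OF t(1)] t(1) by simp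
      finally have "y t *\<^sub>P z = X ^\<^sub>P order R +\<^sub>P -\<^sub>P cst t" .
      then show ?thesis using id0[OF UP.nat_pow_closed[OF X_closed] cst_closed[OF t(1)]] by metis
    qed
    note z = z1 z2
    obtain e' where e': "e' \<in> carrier P" "e t = lin (\<ominus> t) *\<^sub>P e'"
      using lin_divides[OF tc(2) t(1)] f t by (auto simp: e_def factor_def)
    obtain w where w: "w \<in> carrier P" "V t *\<^sub>P (v t +\<^sub>P e t) ^\<^sub>P (order R div 2) =
        v t ^\<^sub>P (order R div 2) *\<^sub>P S t +\<^sub>P e t ^\<^sub>P M *\<^sub>P w"
      using trunc_binomial_congruence[OF tc(1,2)] unfolding V_def S_def by blast
    have "v t +\<^sub>P e t = f"
    proof -
      have "c +\<^sub>P (f -\<^sub>P c) = f" if "c \<in> carrier P" for c using that f by algebra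
      then show ?thesis using t f by (simp add: v_def e_def)
    qed
    moreover have "v t ^\<^sub>P (order R div 2) = cst a" using t f by (simp add: v_def cst_pow[symmetric])
    moreover have "e t ^\<^sub>P M *\<^sub>P w = y t *\<^sub>P (e' ^\<^sub>P M *\<^sub>P w)"
      using e' w(1) t(1) unfolding y_def by (simp add: UP.nat_pow_distrib UP.m_assoc)
    ultimately have w': "e' ^\<^sub>P M *\<^sub>P w \<in> carrier P"
      "V t *\<^sub>P g = cst a *\<^sub>P S t +\<^sub>P y t *\<^sub>P (e' ^\<^sub>P M *\<^sub>P w)"
      using w e' unfolding g_def by auto
    note cg = aux_poly_congruence[OF tc(5,3,4) g a t(1) z w']
    obtain k1 where k1: "k1 \<in> carrier P" "V t *\<^sub>P F = local_poly (V t) (S t) a t L +\<^sub>P y t *\<^sub>P k1"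
      using cg[OF Lmem(1)[OF LL(1)]] unfolding F_def by auto
    obtain k2 where k2: "k2 \<in> carrier P" "V t *\<^sub>P F' = local_poly (V t) (S t) a t L' +\<^sub>P y t *\<^sub>P k2"
      using cg[OF Lmem(1)[OF LL(2)]] unfolding F'_def by auto
    define p where "p = taylor t (\<Phi> L)"
    have "set (\<Phi> L) \<subseteq> carrier P" using \<Phi>[OF LL(1)] by auto
    then have pP: "p \<in> carrier P" unfolding p_def using t by simp
    obtain k3 where k3: "k3 \<in> carrier P" "local_poly (V t) (S t) a t L = p +\<^sub>P y t *\<^sub>P k3"
      using \<Phi>[OF LL(1)] t(1) unfolding p_def by blast
    obtain k4 where k4: "k4 \<in> carrier P" "local_poly (V t) (S t) a t L' = p +\<^sub>P y t *\<^sub>P k4"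
      using \<Phi>[OF LL(2)] t(1) LL(4) unfolding p_def by metis
    have id1: "Vt *\<^sub>P (F -\<^sub>P F') = Vt *\<^sub>P F -\<^sub>P Vt *\<^sub>P F'" if "Vt \<in> carrier P" for Vt
      using that F by algebra
    have id2: "p +\<^sub>P yt *\<^sub>P k3 +\<^sub>P yt *\<^sub>P k1 -\<^sub>P (p +\<^sub>P yt *\<^sub>P k4 +\<^sub>P yt *\<^sub>P k2) =
        yt *\<^sub>P (k3 +\<^sub>P k1 -\<^sub>P (k4 +\<^sub>P k2))" if "yt \<in> carrier P" for yt
      using that pP k1(1) k2(1) k3(1) k4(1) by algebra
    have eq: "V t *\<^sub>P (F -\<^sub>P F') = y t *\<^sub>P (k3 +\<^sub>P k1 -\<^sub>P (k4 +\<^sub>P k2))"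
      using id1[OF tc(3)] id2[OF tc(5)] k1(2) k2(2) k3(2) k4(2) by simp
    \<comment> \<open>\<open>V t\<close> is the constant f(t)^M, invertible because f(t) is nonzero;
      dividing by it transfers the order of vanishing to \<open>F\<close> and \<open>F'\<close>
      themselves.\<close>
    define u where "u = inv (eval f t [^] M)"
    have "eval f t [^] M \<in> Units R" using t f by (intro Units_pow_closed) (simp add: field_Units)
    then have u: "u \<in> carrier R" "u \<otimes> eval f t [^] M = \<one>" unfolding u_def by auto
    have "cst u *\<^sub>P V t = 1\<^sub>P"
      unfolding V_def v_def using u t f by (simp add: cst_pow[symmetric] cst_mult[symmetric] cst_one)
    then have "F -\<^sub>P F' = cst u *\<^sub>P (V t *\<^sub>P (F -\<^sub>P F'))"
      using u(1) F tc(3) by (simp add: UP.m_assoc[symmetric])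
    also have "\<dots> = y t *\<^sub>P (cst u *\<^sub>P (k3 +\<^sub>P k1 -\<^sub>P (k4 +\<^sub>P k2)))"
      unfolding eq using u(1) tc(5) k1(1) k2(1) k3(1) k4(1) by (simp add: UP.m_lcomm)
    finally show ?thesis
      using u(1) k1(1) k2(1) k3(1) k4(1) by (intro dividesI[of "cst u *\<^sub>P (k3 +\<^sub>P k1 -\<^sub>P (k4 +\<^sub>P k2))"]) auto
  qed
  ultimately show ?thesis
    using multiplicity_bound[of "F -\<^sub>P F'" T M] F nz T unfolding y_def by fastforce
qed

section \<open>Choice of parameters, and the bound for character sums\<close>

lemma power_value_bound_aux:
  assumes A: "A \<subseteq> carrier R" "A \<noteq> {}" "\<zero> \<notin> A" and a: "a \<in> carrier R"
    and T: "T \<subseteq> {t \<in> carrier R. (\<Otimes>b\<in>A. t \<oplus> b) \<noteq> \<zero> \<and> (\<Otimes>b\<in>A. t \<oplus> b) [^] (order R div 2) = a}"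
    and M: "M * M \<le> order R" "order R < Suc M * Suc M"
  shows "2 * card T \<le> order R + 30 * card A * M"
proof -
  define q where "q = order R"
  define d where "d = card A"
  have "finite A" using A finite_carrier finite_subset by blast
  then have d: "1 \<le> d" "d \<le> q"
    using A card_mono[OF finite_carrier A(1)] by (auto simp: d_def q_def order_def Suc_le_eq card_gt_0_iff)
  have q3: "q \<ge> 3" unfolding q_def by (rule order_ge_3)
  then have M1: "1 \<le> M" using M by (cases M) (auto simp: q_def)
  have "Suc M * Suc M = M * M + 2 * M + 1" by simp
  then have qM: "q \<le> M * M + 2 * M" using M by (simp add: q_def)
  have MM: "M \<le> M * M" using M1 by simp
  have q3M: "q \<le> 3 * (M * M)" using qM MM by linarith
  have Tq: "card T \<le> q" using T card_mono[OF finite_carrier, of T] by (auto simp: q_def order_def)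
  show ?thesis
  proof (cases "8 * d \<le> M")
    \<comment> \<open>Here q \<le> 3 M^2 \<le> 24 d M, and the trivial bound card T \<le> q is good
      enough.\<close>
    case False
    then have "M * M \<le> (8 * d) * M" by (intro mult_right_mono) auto
    then have "q \<le> 24 * d * M" using q3M by linarith
    then show ?thesis using Tq unfolding q_def[symmetric] d_def[symmetric] by linarith
  next
    case True
    \<comment> \<open>The largest value that nonvanishing permits.\<close>
    define B where "B = (q + 1 - d) div 2"
    \<comment> \<open>In \<open>dim\<close> the dominant terms are B M on the left and 2 B J on the
      right, so J has to exceed M / 2. The surplus 3 d contributes 6 B d, about 3 q d, which pays
      for the remaining terms M^2 d + M + J M.\<close>
    define J where "J = (M + 1) div 2 + 3 * d"
    have B: "2 * B + d \<le> q + 1" "q \<le> 2 * B + d" using d unfolding B_def by linarith+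
    have J: "M + 6 * d \<le> 2 * J" "2 * J \<le> M + 1 + 6 * d" unfolding J_def by presburger+
    have Mq: "M \<le> q" using MM M unfolding q_def by linarith
    have M8: "M \<ge> 8" using True d by linarith
    have dim: "(M * d + 1 + B + J) * M < 2 * B * J"
    proof -
      have MMq: "M * M \<le> q" using M by (simp add: q_def)
      have e1: "M * M * d \<le> q * d" using MMq by (rule mult_right_mono) simp
      have e2: "8 * M \<le> q" using M8 MMq mult_right_mono[OF M8, of M] by linarith
      have e3: "2 * (J * M) \<le> q + M + 6 * (d * M)"
        using mult_right_mono[OF J(2), of M] MMq by (simp add: algebra_simps)
      have "8 * d * M \<le> M * M" by (rule mult_right_mono[OF True]) simp
      then have e4: "8 * (d * M) \<le> q" using MMq by linarith
      have e5: "B * (M + 6 * d) \<le> 2 * B * J" using mult_left_mono[OF J(1), of B] by (simp add: mult_ac)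
      have e6: "q * d \<le> 2 * (B * d) + d * d" using mult_right_mono[OF B(2), of d] by (simp add: algebra_simps)
      have e7: "8 * (d * d) \<le> d * M" using mult_left_mono[OF True, of d] by (simp add: mult_ac)
      have e8: "q \<le> q * d" using d by simp
      have "M * M * d + M + J * M < 6 * (B * d)"
      proof -
        have "2 * (6 * (B * d)) + 6 * (d * d) \<ge> 6 * (q * d)" using e6 by linarith
        moreover have "64 * (d * d) \<le> q" using e7 e4 by linarith
        moreover have "2 * (M * M * d) + 2 * M + 2 * (J * M) \<le> 2 * (q * d) + 3 * M + q + 6 * (d * M)"
          using e1 e3 by linarith
        ultimately have "16 * (M * M * d) + 16 * M + 16 * (J * M) \<le> 16 * (q * d) + 17 * q"
            "384 * (q * d) \<le> 768 * (B * d) + 6 * q"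
          using e2 e4 by linarith+
        then show ?thesis using e8 q3 by linarith
      qed
      then have "M * M * d + M + J * M + B * M < B * (M + 6 * d)" by (simp add: algebra_simps)
      then show ?thesis using e5 by (simp add: algebra_simps)
    qed
    have "M * card T < B + (q div 2) * d + q * J"
    proof (unfold q_def d_def, rule stepanov[OF A a])
      show "T \<subseteq> {t \<in> carrier R. eval (lprod A) t \<noteq> \<zero> \<and> eval (lprod A) t [^] (order R div 2) = a}"
        using T A(1) by (auto simp: eval_lprod)
    qed (use M1 Mq B dim in \<open>auto simp: q_def d_def\<close>)
    then have "2 * (M * card T) < 2 * B + (2 * (q div 2)) * d + q * (2 * J)" by (simp add: algebra_simps)
    also have "\<dots> \<le> (q + 1) + q * d + q * (M + 1 + 6 * d)"
      using B J by (intro add_mono mult_right_mono mult_left_mono) auto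
    also have "\<dots> = q * M + 2 * q + 1 + 7 * (q * d)" by (simp add: algebra_simps)
    also have "\<dots> \<le> q * M + 10 * (q * d)"
    proof -
      have "q \<le> q * d" using d by simp
      then show ?thesis using q3 by linarith
    qed
    also have "\<dots> \<le> q * M + 10 * (3 * (M * M) * d)"
      using q3M by (intro add_mono mult_left_mono mult_right_mono) auto
    finally have "M * (2 * card T) < M * (q + 30 * d * M)" by (simp add: algebra_simps)
    then show ?thesis unfolding q_def d_def by simp
  qed
qed

definition root_order :: nat where
  "root_order = nat \<lfloor>sqrt (real (order R))\<rfloor>"

lemma root_order: "root_order * root_order \<le> order R" "order R < Suc root_order * Suc root_order"
proof -
  have r: "real root_order \<le> sqrt (real (order R))" "sqrt (real (order R)) < real root_order + 1"
    unfolding root_order_def by (auto simp: of_nat_nat) 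
  have "real root_order * real root_order \<le> sqrt (real (order R)) * sqrt (real (order R))"
    using r by (intro mult_mono) auto
  then have "real (root_order * root_order) \<le> real (order R)" by simp
  then show "root_order * root_order \<le> order R" by linarith
  have "sqrt (real (order R)) * sqrt (real (order R)) < (real root_order + 1) * (real root_order + 1)"
    using r by (intro mult_strict_mono) auto
  then have "real (order R) < real (Suc root_order * Suc root_order)" by (simp add: algebra_simps)
  then show "order R < Suc root_order * Suc root_order" by linarith
qed

text \<open>Translation by an element outside \<open>A\<close> achieves
  \<open>\<zero> \<notin> A\<close>. If there is no such element, \<open>card A\<close> is q and the
  bound is trivial.\<close>

lemma power_value_bound:
  assumes A: "A \<subseteq> carrier R" "A \<noteq> {}" and a: "a \<in> carrier R"
    and T: "T \<subseteq> {t \<in> carrier R. (\<Otimes>b\<in>A. t \<oplus> b) \<noteq> \<zero> \<and> (\<Otimes>b\<in>A. t \<oplus> b) [^] (order R div 2) = a}"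
  shows "2 * card T \<le> order R + 30 * card A * root_order"
proof (cases "A = carrier R")
  case True
  have "order R \<le> 30 * card A * root_order"
    using True root_order order_ge_3 by (cases root_order) (auto simp: order_def)
  moreover have "card T \<le> order R" using T card_mono[OF finite_carrier, of T] by (auto simp: order_def)
  ultimately show ?thesis by linarith
next
  case False
  then obtain b where b: "b \<in> carrier R" "b \<notin> A" using A by auto
  define A' where "A' = (\<lambda>x. x \<ominus> b) ` A"
  define T' where "T' = (\<lambda>t. t \<oplus> b) ` T"
  have TR: "T \<subseteq> carrier R" using T by auto
  have injA: "inj_on (\<lambda>x. x \<ominus> b) A"
    using inj_on_subset[OF bij_betw_imp_inj_on[OF bij_add[of "\<ominus> b"]] A(1)] b(1) by (simp add: minus_eq)
  have injT: "inj_on (\<lambda>t. t \<oplus> b) T"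
    using inj_on_subset[OF bij_betw_imp_inj_on[OF bij_add[OF b(1)]] TR] .
  have A': "A' \<subseteq> carrier R" "A' \<noteq> {}" "\<zero> \<notin> A'"
    using A b unfolding A'_def by (auto simp: subset_iff) (metis r_right_minus_eq)
  have shift: "(\<Otimes>c\<in>A'. t \<oplus> b \<oplus> c) = (\<Otimes>c\<in>A. t \<oplus> c)" if t: "t \<in> carrier R" for t
  proof -
    have "(\<Otimes>c\<in>A'. t \<oplus> b \<oplus> c) = (\<Otimes>c\<in>A. t \<oplus> b \<oplus> (c \<ominus> b))"
      unfolding A'_def using A b t by (intro finprod_reindex[OF _ injA]) auto
    also have "\<dots> = (\<Otimes>c\<in>A. t \<oplus> c)"
    proof (rule finprod_cong'[OF refl])
      show "(\<lambda>c. t \<oplus> c) \<in> A \<rightarrow> carrier R" using A t by auto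
      fix c assume "c \<in> A"
      then have "c \<in> carrier R" using A by auto
      then show "t \<oplus> b \<oplus> (c \<ominus> b) = t \<oplus> c" using t b(1) by algebra
    qed
    finally show ?thesis .
  qed
  have "2 * card T' \<le> order R + 30 * card A' * root_order"
  proof (rule power_value_bound_aux[OF A' a _ root_order])
    show "T' \<subseteq> {t \<in> carrier R. (\<Otimes>b\<in>A'. t \<oplus> b) \<noteq> \<zero> \<and> (\<Otimes>b\<in>A'. t \<oplus> b) [^] (order R div 2) = a}"
      using T b(1) unfolding T'_def by (auto simp: shift)
  qed
  then show ?thesis unfolding A'_def T'_def using card_image[OF injA] card_image[OF injT] by simp
qed

text \<open>Stepanov's bound is one-sided, but it applies to both values of the character.\<close>

lemma weil_bound:
  assumes A: "A \<subseteq> carrier R" "A \<noteq> {}" and s: "s = 1 \<or> s = (-1 :: int)"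
  shows "s * (\<Sum>t\<in>carrier R. \<Prod>b\<in>A. chi (t \<oplus> b)) \<le> 31 * int (card A) * int root_order"
proof -
  have finA: "finite A" using A finite_carrier finite_subset by blast
  define h where "h t = (\<Otimes>b\<in>A. t \<oplus> b)" for t
  have hR: "h t \<in> carrier R" if "t \<in> carrier R" for t
    unfolding h_def using that A by (intro finprod_closed) auto
  define N where "N e = {t \<in> carrier R. chi (h t) = e}" for e
  have fin: "finite (N e)" for e unfolding N_def using finite_carrier by simp
  have s2: "s * s = 1" "s \<noteq> 0" using s by auto
  have "(\<Sum>t\<in>carrier R. \<Prod>b\<in>A. chi (t \<oplus> b)) = (\<Sum>t\<in>carrier R. chi (h t))"
    unfolding h_def using A finA by (intro sum.cong refl chi_prod[symmetric]) auto
  also have "s * \<dots> = (\<Sum>t\<in>carrier R. s * chi (h t))" by (simp add: sum_distrib_left)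
  \<comment> \<open>For a sign s the value of s chi is 2 [chi = s] + [chi = 0] - 1, so an upper
    bound for the number of points with chi = s suffices.\<close>
  also have "\<dots> = (\<Sum>t\<in>carrier R. 2 * (if chi (h t) = s then 1 else 0) + (if chi (h t) = 0 then 1 else 0) - 1)"
  proof (intro sum.cong refl)
    fix t
    show "s * chi (h t) = 2 * (if chi (h t) = s then 1 else 0) + (if chi (h t) = 0 then 1 else 0) - 1"
      using s chi_cases[of "h t"] by auto
  qed
  also have "\<dots> = 2 * int (card (N s)) + int (card (N 0)) - int (order R)"
    using finite_carrier
    by (simp add: sum.distrib sum_subtractf sum_distrib_left[symmetric] N_def order_def sum.If_cases
        Int_def Collect_conj_eq[symmetric] conj_commute)
  finally have eq: "s * (\<Sum>t\<in>carrier R. \<Prod>b\<in>A. chi (t \<oplus> b)) = 2 * int (card (N s)) + int (card (N 0)) - int (order R)" .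
  \<comment> \<open>The zeros number at most \<open>card A\<close>, which raises the constant from
    30 to 31.\<close>
  have "N 0 \<subseteq> (\<lambda>b. \<ominus> b) ` A"
  proof
    fix t assume "t \<in> N 0"
    then have t: "t \<in> carrier R" "chi (h t) = 0" by (auto simp: N_def)
    then have "h t = \<zero>" by (auto simp: chi_def split: if_splits)
    then obtain b where b: "b \<in> A" "t \<oplus> b = \<zero>"
      unfolding h_def using finprod_eq_zero_iff[OF finA, of "\<lambda>b. t \<oplus> b"] A t by auto
    then have "t = \<ominus> b" using t A minus_equality by (metis subsetD)
    then show "t \<in> (\<lambda>b. \<ominus> b) ` A" using b by auto
  qed
  then have "card (N 0) \<le> card A" using finA surj_card_le by blast
  moreover have "2 * card (N s) \<le> order R + 30 * card A * root_order"
  proof (rule power_value_bound[OF A, of "if s = 1 then \<one> else \<ominus> \<one>"])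
    show "N s \<subseteq> {t \<in> carrier R. (\<Otimes>b\<in>A. t \<oplus> b) \<noteq> \<zero> \<and>
        (\<Otimes>b\<in>A. t \<oplus> b) [^] (order R div 2) = (if s = 1 then \<one> else \<ominus> \<one>)}"
    proof
      fix t assume "t \<in> N s"
      then have t: "t \<in> carrier R" "chi (h t) = s" by (auto simp: N_def)
      then have "h t \<noteq> \<zero>" using s2 by auto
      then show "t \<in> {t \<in> carrier R. (\<Otimes>b\<in>A. t \<oplus> b) \<noteq> \<zero> \<and>
        (\<Otimes>b\<in>A. t \<oplus> b) [^] (order R div 2) = (if s = 1 then \<one> else \<ominus> \<one>)}"
        using embed_chi[OF hR[OF t(1)]] t s unfolding h_def by auto
    qed
  qed auto
  moreover have "card A \<le> card A * root_order"
    using root_order order_ge_3 by (cases root_order) auto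
  ultimately have "2 * int (card (N s)) + int (card (N 0)) \<le> int (order R) + 31 * (int (card A) * int root_order)"
    by (simp flip: of_nat_mult, linarith)
  then show ?thesis unfolding eq by linarith
qed

text \<open>The product of the 1 - chi (t + s) over \<open>s \<in> S\<close> is 2^|S| at the t in
  question and nonnegative elsewhere. Expanded over the subsets of \<open>S\<close>, the empty
  subset gives q and every other one a character sum.\<close>

lemma all_nonsquare_bound:
  assumes S: "S \<subseteq> carrier R"
  shows "2 ^ card S * card {t \<in> carrier R. \<forall>s\<in>S. \<not> is_square (t \<oplus> s)} \<le>
    order R + 2 ^ card S * (31 * card S * root_order)"
proof -
  have finS: "finite S" using S finite_carrier finite_subset by blast
  let ?N = "{t \<in> carrier R. \<forall>s\<in>S. \<not> is_square (t \<oplus> s)}"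
  have "int (2 ^ card S * card ?N) = (\<Sum>t\<in>?N. \<Prod>s\<in>S. 1 + - chi (t \<oplus> s))"
  proof -
    have "(\<Prod>s\<in>S. 1 + - chi (t \<oplus> s)) = 2 ^ card S" if "t \<in> ?N" for t
    proof -
      have "(\<Prod>s\<in>S. 1 + - chi (t \<oplus> s)) = (\<Prod>s\<in>S. 2)"
        using that by (intro prod.cong refl) (simp add: chi_eq_minus_one[THEN iffD2])
      then show ?thesis by simp
    qed
    then show ?thesis by simp
  qed
  also have "\<dots> \<le> (\<Sum>t\<in>carrier R. \<Prod>s\<in>S. 1 + - chi (t \<oplus> s))"
  proof (rule sum_mono2[OF finite_carrier])
    show "0 \<le> (\<Prod>s\<in>S. 1 + - chi (b \<oplus> s))" for b
      by (rule prod_nonneg) (auto simp: chi_def)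
  qed auto
  also have "\<dots> = (\<Sum>t\<in>carrier R. \<Sum>A\<in>Pow S. \<Prod>s\<in>A. - chi (t \<oplus> s))"
  proof (intro sum.cong refl)
    fix t
    have "(\<Prod>s\<in>S. - chi (t \<oplus> s) + 1) = (\<Sum>A\<in>Pow S. (\<Prod>s\<in>A. - chi (t \<oplus> s)) * (\<Prod>s\<in>S - A. 1))"
      by (rule prod_add[OF finS])
    then show "(\<Prod>s\<in>S. 1 + - chi (t \<oplus> s)) = (\<Sum>A\<in>Pow S. \<Prod>s\<in>A. - chi (t \<oplus> s))"
      by (simp add: add.commute)
  qed
  also have "\<dots> = (\<Sum>A\<in>Pow S. \<Sum>t\<in>carrier R. \<Prod>s\<in>A. - chi (t \<oplus> s))"
    by (rule sum.swap)
  also have "\<dots> = (\<Sum>A\<in>Pow S. (-1) ^ card A * (\<Sum>t\<in>carrier R. \<Prod>s\<in>A. chi (t \<oplus> s)))"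
    by (simp add: prod_uminus sum_distrib_left)
  also have "\<dots> \<le> (\<Sum>A\<in>Pow S. (if A = {} then int (order R) else 0) + 31 * int (card S) * int root_order)"
  proof (rule sum_mono)
    fix A assume A: "A \<in> Pow S"
    show "(-1) ^ card A * (\<Sum>t\<in>carrier R. \<Prod>s\<in>A. chi (t \<oplus> s)) \<le>
        (if A = {} then int (order R) else 0) + 31 * int (card S) * int root_order"
    proof (cases "A = {}")
      case True
      then show ?thesis by (simp add: order_def)
    next
      case False
      \<comment> \<open>The sign varies with \<open>A\<close>; this is why \<open>weil_bound\<close>
        admits both signs.\<close>
      have "(-1) ^ card A * (\<Sum>t\<in>carrier R. \<Prod>s\<in>A. chi (t \<oplus> s)) \<le> 31 * int (card A) * int root_order"
        using A S False by (intro weil_bound) (auto simp: power_minus_mult neg_one_even_power neg_one_odd_power, metis minus_one_power_iff)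
      also have "\<dots> \<le> 31 * int (card S) * int root_order"
        using A finS by (intro mult_right_mono mult_left_mono) (auto intro: card_mono)
      finally show ?thesis using False by simp
    qed
  qed
  also have "\<dots> = int (order R) + 2 ^ card S * (31 * int (card S) * int root_order)"
    using finS by (simp add: sum.distrib card_Pow)
  also have "\<dots> = int (order R + 2 ^ card S * (31 * card S * root_order))" by simp
  finally show ?thesis by linarith
qed

section \<open>Critical orbits\<close>

fun orb :: "'a \<Rightarrow> nat \<Rightarrow> 'a" where
  "orb d 0 = d"
| "orb d (Suc n) = orb d n \<otimes> orb d n \<oplus> d"

lemma orb_closed [simp]: "d \<in> carrier R \<Longrightarrow> orb d n \<in> carrier R"
  by (induction n) auto

lemma orb_shift: "orb d i = orb d j \<Longrightarrow> orb d (i + n) = orb d (j + n)"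
  by (induction n) auto

lemma orb_period:
  assumes "orb d a = orb d (a + p)" "a \<le> m"
  shows "orb d (m + k * p) = orb d m"
proof (induction k)
  case (Suc k)
  have "orb d (a + (m - a + k * p)) = orb d (a + p + (m - a + k * p))"
    by (rule orb_shift[OF assms(1)])
  moreover have "a + (m - a + k * p) = m + k * p" "a + p + (m - a + k * p) = m + Suc k * p"
    using assms(2) by auto
  ultimately show ?case using Suc by (simp only:)
qed simp

text \<open>Why Floyd's method cannot miss a collision: if positions a < b coincide and p = b - a,
  then there is a multiple of p from a to b - 1. Being in the periodic part, it has the same value
  as its double.\<close>

lemma inj_on_orb:
  assumes "\<And>j. 1 \<le> j \<Longrightarrow> j \<le> i \<Longrightarrow> orb d j \<noteq> orb d (2 * j)"
  shows "inj_on (orb d) {1..i}"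
proof (rule linorder_inj_onI)
  fix a b assume ab: "a < b" "a \<in> {1..i}" "b \<in> {1..i}"
  show "orb d a \<noteq> orb d b"
  proof
    assume eq: "orb d a = orb d b"
    define p where "p = b - a"
    have p: "p > 0" "b = a + p" using ab by (auto simp: p_def)
    \<comment> \<open>The quotient a / p, rounded up.\<close>
    define k where "k = (a + p - 1) div p"
    have "a + p - 1 = k * p + (a + p - 1) mod p" unfolding k_def by simp
    moreover have "(a + p - 1) mod p < p" using p by simp
    ultimately have k: "a \<le> k * p" "k * p \<le> a + p - 1" using p by linarith+
    have "orb d (k * p + k * p) = orb d (k * p)"
      using eq p k by (intro orb_period[of d a p]) auto
    moreover have "1 \<le> a" "a + p \<le> i" using ab p by auto
    then have "1 \<le> k * p" "k * p \<le> i" using k by linarith+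
    ultimately show False using assms[of "k * p"] by (simp add: mult_2)
  qed
qed auto

text \<open>The condition at index 0 carries a sign because the irreducibility criterion contains
  (-1) to the power of the degree, and the degrees 2^n are odd only for n = 0.\<close>

definition good :: "'a \<Rightarrow> 'a \<Rightarrow> bool" where
  "good d t \<longleftrightarrow> \<not> is_square (\<ominus> (t \<oplus> d)) \<and> (\<forall>n\<ge>1. \<not> is_square (t \<oplus> orb d n))"

text \<open>Floyd's cycle detection, with all elements passed by the faster pointer tested, has not stopped
  after \<open>i\<close> rounds.\<close>

definition alive :: "'a \<Rightarrow> 'a \<Rightarrow> nat \<Rightarrow> bool" where
  "alive d t i \<longleftrightarrow> \<not> is_square (\<ominus> (t \<oplus> d)) \<and> (\<forall>n\<in>{1..2 * i}. \<not> is_square (t \<oplus> orb d n)) \<and>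
    (\<forall>j\<in>{1..i}. orb d j \<noteq> orb d (2 * j))"

lemma alive_antimono: "alive d t i \<Longrightarrow> j \<le> i \<Longrightarrow> alive d t j"
  unfolding alive_def by auto

text \<open>As no collision has been found, the first i orbit points are distinct, and
  \<open>card_mult_card_le_order\<close> applies to them. A collision does not depend on t, so after
  one no t is left.\<close>

lemma card_alive:
  assumes d: "d \<in> carrier R"
  shows "card {t \<in> carrier R. alive d t i} * i \<le> order R"
proof (cases "\<forall>j\<in>{1..i}. orb d j \<noteq> orb d (2 * j)")
  case True
  then have inj: "inj_on (orb d) {1..i}" by (intro inj_on_orb) auto
  have "card {t \<in> carrier R. alive d t i} * card (orb d ` {1..i}) \<le> order R"
    by (rule card_mult_card_le_order) (use d in \<open>auto simp: alive_def\<close>)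
  then show ?thesis using card_image[OF inj] by simp
next
  case False
  then have "{t \<in> carrier R. alive d t i} = {}" by (auto simp: alive_def)
  then have "card {t \<in> carrier R. alive d t i} = 0" by (simp only: card.empty)
  then show ?thesis by simp
qed

lemma not_alive:
  assumes d: "d \<in> carrier R" and i: "order R < i"
  shows "\<not> alive d t i"
proof
  assume "alive d t i"
  then have "inj_on (orb d) {1..i}" by (intro inj_on_orb) (auto simp: alive_def)
  then have "card (orb d ` {1..i}) = i" using card_image by fastforce
  moreover have "card (orb d ` {1..i}) \<le> order R"
    unfolding order_def using d by (intro card_mono[OF finite_carrier]) auto
  ultimately show False using i by simp
qed

section \<open>Total length of the walks for a fixed \<open>d\<close>\<close>

definition rounds :: "'a \<Rightarrow> 'a \<Rightarrow> nat" where
  "rounds d t = (LEAST i. \<not> alive d t i)"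

lemma alive_iff:
  assumes "d \<in> carrier R"
  shows "alive d t i \<longleftrightarrow> i < rounds d t"
proof -
  have "\<not> alive d t (rounds d t)"
    unfolding rounds_def
    by (rule LeastI[of "\<lambda>i. \<not> alive d t i" "Suc (order R)"]) (simp add: not_alive[OF assms])
  then have "\<not> alive d t i" if "rounds d t \<le> i" using alive_antimono that by blast
  moreover have "alive d t i" if "i < rounds d t"
    using not_less_Least[of i "\<lambda>i. \<not> alive d t i"] that unfolding rounds_def by blast
  ultimately show ?thesis using not_le by blast
qed

text \<open>Double counting of the pairs (t, i) with \<open>alive d t i\<close>;
  \<open>not_alive\<close> limits i to at most q.\<close>

lemma sum_rounds:
  assumes d: "d \<in> carrier R"
  shows "(\<Sum>t\<in>carrier R. rounds d t) = (\<Sum>i\<le>order R. card {t \<in> carrier R. alive d t i})"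
proof -
  have "rounds d t = (\<Sum>i\<le>order R. if alive d t i then 1 else 0)" for t
  proof -
    have "rounds d t \<le> Suc (order R)"
      using alive_iff[OF d, of t "Suc (order R)"] not_alive[OF d, of "Suc (order R)" t] by simp
    then have "{i \<in> {..order R}. alive d t i} = {..<rounds d t}" using alive_iff[OF d] by auto
    then show ?thesis by (simp add: sum.If_cases Int_def)
  qed
  then have "(\<Sum>t\<in>carrier R. rounds d t) = (\<Sum>t\<in>carrier R. \<Sum>i\<le>order R. if alive d t i then 1 else 0)"
    by simp
  also have "\<dots> = (\<Sum>i\<le>order R. \<Sum>t\<in>carrier R. if alive d t i then 1 else 0)" by (rule sum.swap)
  also have "\<dots> = (\<Sum>i\<le>order R. card {t \<in> carrier R. alive d t i})"
    using finite_carrier by (intro sum.cong refl) (simp add: sum.If_cases Int_def)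
  finally show ?thesis .
qed

lemma harmonic_sum_le: "1 \<le> n \<Longrightarrow> (\<Sum>i=1..n. 1 / real i) \<le> 1 + ln (real n)"
proof (induction n rule: nat_induct_at_least)
  case (Suc n)
  have "ln (real n / real (Suc n)) \<le> real n / real (Suc n) - 1"
    using Suc by (intro ln_le_minus_one) auto
  then have "1 / real (Suc n) \<le> ln (real (Suc n)) - ln (real n)"
    using Suc by (simp add: ln_div field_simps)
  then show ?case using Suc by simp
qed simp

text \<open>Index 0 contributes at most q and index i at most q / i. A single walk can be long, but
  on average over t there are only about log q rounds.\<close>

lemma sum_rounds_le:
  assumes d: "d \<in> carrier R"
  shows "real (\<Sum>t\<in>carrier R. rounds d t) \<le> real (order R) * (2 + ln (real (order R)))"
proof -
  let ?c = "\<lambda>i. card {t \<in> carrier R. alive d t i}"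
  have "{..order R} = insert 0 {1..order R}" by auto
  then have "(\<Sum>i\<le>order R. real (?c i)) = real (?c 0) + (\<Sum>i=1..order R. real (?c i))" by simp
  also have "\<dots> \<le> real (order R) + (\<Sum>i=1..order R. real (order R) * (1 / real i))"
  proof (intro add_mono sum_mono)
    show "real (?c 0) \<le> real (order R)" unfolding order_def using finite_carrier by (simp add: card_mono)
    fix i assume i: "i \<in> {1..order R}"
    have "real (?c i) * real i \<le> real (order R)" using card_alive[OF d, of i] by (metis of_nat_le_iff of_nat_mult)
    then show "real (?c i) \<le> real (order R) * (1 / real i)" using i by (simp add: field_simps)
  qed
  also have "\<dots> = real (order R) * (1 + (\<Sum>i=1..order R. 1 / real i))" by (simp add: sum_distrib_left distrib_left)
  also have "\<dots> \<le> real (order R) * (2 + ln (real (order R)))"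
    using harmonic_sum_le[of "order R"] order_ge_3 by (intro mult_left_mono) auto
  finally show ?thesis using sum_rounds[OF d] by simp
qed

text \<open>If the walk ends with all tests passed, it has met orb j = orb (2j). From index j on the
  orbit then has period j, so the tested indices up to 2j already exhibit all its values.\<close>

lemma good_iff:
  assumes d: "d \<in> carrier R"
  shows "good d t \<longleftrightarrow> \<not> is_square (\<ominus> (t \<oplus> d)) \<and> (\<forall>n\<in>{1..2 * rounds d t}. \<not> is_square (t \<oplus> orb d n))"
proof
  assume r: "\<not> is_square (\<ominus> (t \<oplus> d)) \<and> (\<forall>n\<in>{1..2 * rounds d t}. \<not> is_square (t \<oplus> orb d n))"
  have "\<not> alive d t (rounds d t)" using alive_iff[OF d] by simp
  then obtain j where j: "1 \<le> j" "j \<le> rounds d t" "orb d j = orb d (j + j)"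
    unfolding alive_def using r by (auto simp: mult_2)
  have "\<not> is_square (t \<oplus> orb d n)" if "n \<ge> 1" for n
    using that
  proof (induction n rule: less_induct)
    case (less n)
    show ?case
    proof (cases "n \<le> 2 * j")
      case True
      then show ?thesis using r less j by auto
    next
      case False
      have "orb d (n - j + 1 * j) = orb d (n - j)" by (rule orb_period[OF j(3)]) (use False in auto)
      moreover have "n - j + 1 * j = n" using False by simp
      ultimately have "orb d n = orb d (n - j)" by simp
      then show ?thesis using less.IH[of "n - j"] False j by auto
    qed
  qed
  then show "good d t" using r by (auto simp: good_def)
qed (auto simp: good_def)

section \<open>Orbit points as polynomials in \<open>d\<close>, and the number of good pairs\<close>

fun orb_poly :: "nat \<Rightarrow> 'a list" where
  "orb_poly 0 = X"
| "orb_poly (Suc n) = orb_poly n *\<^sub>P orb_poly n +\<^sub>P X"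

lemma orb_poly_closed [simp]: "orb_poly n \<in> carrier P"
  by (induction n) auto

lemma eval_orb_poly: "d \<in> carrier R \<Longrightarrow> eval (orb_poly n) d = orb d n"
  by (induction n) auto

lemma length_add_eq:
  assumes "p \<in> carrier P" "q \<in> carrier P" "length p \<noteq> length q"
  shows "length (p +\<^sub>P q) = max (length p) (length q)"
  using poly_add_length_eq[OF sr, of p q] assms by (simp add: univ_poly_add univ_poly_carrier)

lemma length_orb_poly: "length (orb_poly n) = 2 ^ n + 1"
proof (induction n)
  case 0
  then show ?case by (simp add: X_list)
next
  case (Suc n)
  have "orb_poly n \<noteq> []" using Suc by auto
  then have "length (orb_poly n *\<^sub>P orb_poly n) = 2 ^ Suc n + 1"
    using length_mult[of "orb_poly n" "orb_poly n"] Suc by simp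
  moreover have "(2::nat) ^ n \<ge> 1" by simp
  ultimately show ?case using length_add_eq[of "orb_poly n *\<^sub>P orb_poly n" X] by (simp add: X_list)
qed

text \<open>The orbit points have the different degrees 2^i and 2^j in \<open>d\<close>, so a
  collision is a nontrivial equation of degree 2^j.\<close>

lemma card_orb_collision:
  assumes "i < j"
  shows "card {d \<in> carrier R. orb d i = orb d j} \<le> 2 ^ j"
proof -
  let ?D = "orb_poly j -\<^sub>P orb_poly i"
  have lt: "(2::nat) ^ i < 2 ^ j" using assms by simp
  have len: "length ?D = 2 ^ j + 1"
    unfolding UP.minus_eq using lt length_add_eq[of "orb_poly j" "-\<^sub>P orb_poly i"]
    by (simp add: length_uminus length_orb_poly)
  have "card {d \<in> carrier R. orb d i = orb d j} < length ?D"
  proof (rule roots_bound)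
    show "?D \<noteq> []" using len by auto
    fix d assume "d \<in> {d \<in> carrier R. orb d i = orb d j}"
    then show "eval ?D d = \<zero>" by (simp add: eval_orb_poly)
  qed auto
  then show ?thesis using len by simp
qed

lemma card_short_orbit:
  "card {d \<in> carrier R. \<not> inj_on (orb d) {1..K}} \<le> K * K * 2 ^ K"
proof -
  let ?I = "{(i, j). i \<in> {1..K} \<and> j \<in> {1..K} \<and> i < j}"
  have sub: "?I \<subseteq> {1..K} \<times> {1..K}" by auto
  then have finI: "finite ?I" using finite_subset by blast
  have "card ?I \<le> K * K" using card_mono[OF _ sub] by simp
  have "{d \<in> carrier R. \<not> inj_on (orb d) {1..K}} \<subseteq> (\<Union>(i, j)\<in>?I. {d \<in> carrier R. orb d i = orb d j})"
  proof
    fix d assume d: "d \<in> {d \<in> carrier R. \<not> inj_on (orb d) {1..K}}"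
    then obtain i j where "i \<in> {1..K}" "j \<in> {1..K}" "i \<noteq> j" "orb d i = orb d j" unfolding inj_on_def by auto
    then have "(i, j) \<in> ?I \<and> orb d i = orb d j \<or> (j, i) \<in> ?I \<and> orb d j = orb d i" by auto
    then show "d \<in> (\<Union>(i, j)\<in>?I. {d \<in> carrier R. orb d i = orb d j})"
      using d by blast
  qed
  then have "card {d \<in> carrier R. \<not> inj_on (orb d) {1..K}} \<le>
      card (\<Union>(i, j)\<in>?I. {d \<in> carrier R. orb d i = orb d j})"
    using finite_carrier finI by (intro card_mono) auto
  also have "\<dots> \<le> (\<Sum>(i, j)\<in>?I. card {d \<in> carrier R. orb d i = orb d j})"
    using card_UN_le[OF finI, of "\<lambda>(i, j). {d \<in> carrier R. orb d i = orb d j}"] by (simp add: case_prod_beta)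
  also have "\<dots> \<le> (\<Sum>(i, j)\<in>?I. 2 ^ K)"
  proof (intro sum_mono, clarify)
    fix i j assume "i \<in> {1..K}" "j \<in> {1..K}" "i < j"
    then have "card {d \<in> carrier R. orb d i = orb d j} \<le> 2 ^ j" by (intro card_orb_collision)
    also have "\<dots> \<le> 2 ^ K" using \<open>j \<in> {1..K}\<close> by (intro power_increasing) auto
    finally show "card {d \<in> carrier R. orb d i = orb d j} \<le> 2 ^ K" .
  qed
  also have "\<dots> = card ?I * 2 ^ K" by (simp add: case_prod_beta)
  also have "\<dots> \<le> K * K * 2 ^ K" using \<open>card ?I \<le> K * K\<close> by simp
  finally show ?thesis .
qed

definition good_pairs :: "('a \<times> 'a) set" where
  "good_pairs = {(d, t). d \<in> carrier R \<and> t \<in> carrier R \<and> good d t}"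

text \<open>For \<open>d\<close> with K distinct orbit points, \<open>all_nonsquare_bound\<close>
  leaves about q / 2^K + 31 K sqrt q values of t. The other \<open>d\<close>, at most K^2 2^K many,
  are given the trivial bound q.\<close>

lemma card_good_pairs: "card good_pairs \<le> order R * root_order * (36 * (bits (order R))\<^sup>2)"
proof -
  define M where "M = root_order"
  define b where "b = bits (order R)"
  have M1: "M \<ge> 1" using root_order order_ge_3 by (cases "root_order") (auto simp: M_def)
  \<comment> \<open>This choice balances the two losses: q / 2^K is at most 4 M, and 2^K is at most
    M.\<close>
  obtain K where K: "2 ^ K \<le> M" "M < 2 ^ (K + 1)" using ex_power_ivl1[of 2 M] M1 by auto
  have Kb: "K \<le> b" "b \<ge> 1"
  proof -
    have "M \<le> M * M" using M1 by simp
    then have "2 ^ K \<le> order R" using K(1) root_order(1) unfolding M_def by linarith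
    then have "bits (2 ^ K) \<le> b" unfolding b_def by (rule floorlog_mono)
    then show "K \<le> b" "b \<ge> 1" using floorlog_power[of "1::nat" 2 K] by (simp_all add: floorlog_def)
  qed
  have sub: "good_pairs = (SIGMA d:carrier R. {t \<in> carrier R. good d t})" by (auto simp: good_pairs_def)
  have "card good_pairs = (\<Sum>d\<in>carrier R. card {t \<in> carrier R. good d t})"
    unfolding sub using finite_carrier by (intro card_SigmaI) auto
  also have "\<dots> \<le> (\<Sum>d\<in>carrier R. (if \<not> inj_on (orb d) {1..K} then order R else 0) + (4 * M + 31 * K * M))"
  proof (rule sum_mono)
    fix d assume d: "d \<in> carrier R"
    show "card {t \<in> carrier R. good d t} \<le>
        (if \<not> inj_on (orb d) {1..K} then order R else 0) + (4 * M + 31 * K * M)"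
    proof (cases "inj_on (orb d) {1..K}")
      case False
      then show ?thesis unfolding order_def using finite_carrier by (simp add: card_mono trans_le_add1)
    next
      case True
      let ?S = "orb d ` {1..K}" and ?N = "{t \<in> carrier R. \<forall>s\<in>orb d ` {1..K}. \<not> is_square (t \<oplus> s)}"
      have cS: "card ?S = K" using card_image[OF True] by simp
      have "2 ^ K * card ?N \<le> order R + 2 ^ K * (31 * K * M)"
        using all_nonsquare_bound[of ?S] image_subsetI[of "{1..K}" "orb d" "carrier R"] orb_closed[OF d]
        unfolding M_def cS by blast
      also have "order R \<le> 2 ^ K * (4 * M)"
      proof -
        have "order R \<le> (M + 1) * (M + 1)" using root_order(2) unfolding M_def by simp
        also have "\<dots> \<le> (2 * 2 ^ K) * (2 * M)" using K M1 by (intro mult_mono) auto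
        finally show ?thesis by simp
      qed
      finally have "2 ^ K * card ?N \<le> 2 ^ K * (4 * M + 31 * K * M)" by (simp add: algebra_simps)
      then have "card ?N \<le> 4 * M + 31 * K * M" by simp
      moreover have "card {t \<in> carrier R. good d t} \<le> card ?N"
        using finite_carrier by (intro card_mono) (auto simp: good_def)
      ultimately show ?thesis using True by simp
    qed
  qed
  also have "\<dots> = card {d \<in> carrier R. \<not> inj_on (orb d) {1..K}} * order R + order R * (4 * M + 31 * K * M)"
    using finite_carrier by (simp add: sum.distrib sum.If_cases Int_def order_def)
  also have "\<dots> \<le> K * K * M * order R + order R * (4 * M + 31 * K * M)"
  proof -
    have "card {d \<in> carrier R. \<not> inj_on (orb d) {1..K}} \<le> K * K * 2 ^ K" by (rule card_short_orbit)
    also have "\<dots> \<le> K * K * M" using K by (intro mult_left_mono) auto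
    finally show ?thesis by (intro add_mono mult_right_mono) auto
  qed
  also have "\<dots> = order R * M * (K * K + 31 * K + 4)" by (simp add: algebra_simps)
  \<comment> \<open>36 = 1 + 31 + 4, since K and 1 are at most \<open>b\<close>.\<close>
  also have "\<dots> \<le> order R * M * (36 * b\<^sup>2)"
  proof (intro mult_left_mono)
    have "K * K \<le> b * b" using Kb by (intro mult_mono) auto
    moreover have "b \<le> b * b" using Kb by simp
    moreover have "K \<le> b * b" "1 \<le> b * b" using Kb \<open>b \<le> b * b\<close> by linarith+
    ultimately show "K * K + 31 * K + 4 \<le> 36 * b\<^sup>2" unfolding power2_eq_square by linarith
  qed auto
  finally show ?thesis unfolding M_def b_def .
qed

lemma poly_induct [consumes 1, case_names cst step]:
  assumes "p \<in> carrier P"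
    and "\<And>c. c \<in> carrier R \<Longrightarrow> Q (cst c)"
    and "\<And>p c. p \<in> carrier P \<Longrightarrow> Q p \<Longrightarrow> c \<in> carrier R \<Longrightarrow> Q (X *\<^sub>P p +\<^sub>P cst c)"
  shows "Q p"
proof -
  have "p \<in> carrier P \<Longrightarrow> length p \<le> n \<Longrightarrow> Q p" for n
  proof (induction n arbitrary: p)
    case 0
    then show ?case using assms(2)[of \<zero>] by (simp add: cst_list)
  next
    case (Suc n)
    then obtain p' c where "p' \<in> Pd n" "c \<in> carrier R" "p = X *\<^sub>P p' +\<^sub>P cst c"
      using poly_decompose by blast
    then show ?case using assms(3)[of p' c] Suc.IH[of p'] by simp
  qed
  then show ?thesis using assms(1) by blast
qed

section \<open>Irreducibility of compositions\<close>

text \<open>One notion for two uses: with the polynomial ring as \<open>S\<close> it is composition,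
  with an extension field as \<open>S\<close> it is evaluation at an element of that field.\<close>

definition ext_eval :: "('d, 'e) ring_scheme \<Rightarrow> ('a \<Rightarrow> 'd) \<Rightarrow> 'd \<Rightarrow> 'a list \<Rightarrow> 'd" where
  "ext_eval S h x p = ring.eval S (map h p) x"

lemma ext_eval_hom:
  assumes h: "ring_hom_ring R S h" and S: "cring S" and x: "x \<in> carrier S"
  shows "ext_eval S h x \<in> ring_hom P S"
proof -
  interpret S: cring S by (rule S)
  interpret h: ring_hom_ring R S h by (rule h)
  have s: "set p \<subseteq> carrier R" if "p \<in> carrier P" for p
    using that polynomial_incl univ_poly_carrier by blast
  have m: "set (map h p) \<subseteq> carrier S" if "set p \<subseteq> carrier R" for p using that by auto
  show ?thesis
  proof (rule ring_hom_memI)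
    fix p assume p: "p \<in> carrier P"
    show "ext_eval S h x p \<in> carrier S"
      unfolding ext_eval_def by (rule S.eval_in_carrier[OF m[OF s[OF p]] x])
    fix q assume q: "q \<in> carrier P"
    note mp = m[OF s[OF p]] and mq = m[OF s[OF q]]
    have pq: "set (p *\<^sub>P q) \<subseteq> carrier R" "set (p +\<^sub>P q) \<subseteq> carrier R"
      using p q by (auto dest: s[OF UP.m_closed] s[OF UP.a_closed])
    show "ext_eval S h x (p *\<^sub>P q) = ext_eval S h x p \<otimes>\<^bsub>S\<^esub> ext_eval S h x q"
      using S.eval_normalize[OF m[OF pq(1)] x] h.poly_mult_hom'[OF s[OF p] s[OF q]]
        S.eval_poly_mult[OF mp mq x]
      by (simp add: ext_eval_def univ_poly_mult)
    show "ext_eval S h x (p +\<^sub>P q) = ext_eval S h x p \<oplus>\<^bsub>S\<^esub> ext_eval S h x q"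
      using S.eval_normalize[OF m[OF pq(2)] x] h.poly_add_hom'[OF s[OF p] s[OF q]]
        S.eval_poly_add[OF mp mq x]
      by (simp add: ext_eval_def univ_poly_add)
  next
    show "ext_eval S h x 1\<^sub>P = \<one>\<^bsub>S\<^esub>"
      using x by (simp add: ext_eval_def P_one)
  qed
qed

lemma ext_eval_cst:
  assumes h: "ring_hom_ring R S h" and S: "cring S" and x: "x \<in> carrier S" and c: "c \<in> carrier R"
  shows "ext_eval S h x (cst c) = h c"
proof -
  interpret S: cring S by (rule S)
  interpret h: ring_hom_ring R S h by (rule h)
  show ?thesis using x c by (auto simp: ext_eval_def cst_list)
qed

lemma ext_eval_X:
  assumes h: "ring_hom_ring R S h" and S: "cring S" and x: "x \<in> carrier S"
  shows "ext_eval S h x X = x"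
proof -
  interpret S: cring S by (rule S)
  interpret h: ring_hom_ring R S h by (rule h)
  show ?thesis using x by (simp add: ext_eval_def X_list)
qed

section \<open>Composition of polynomials and linear substitutions\<close>

abbreviation comp :: "'a list \<Rightarrow> 'a list \<Rightarrow> 'a list" where "comp f g \<equiv> poly_comp R f g"

lemma comp_eq: "comp f g = ext_eval P cst g f"
  by (simp add: poly_comp_def ext_eval_def)

lemma comp_hom: "g \<in> carrier P \<Longrightarrow> (\<lambda>f. comp f g) \<in> ring_hom P P"
  unfolding comp_eq using ext_eval_hom[OF cst_hom UP.is_cring] by (simp add: eta_contract_eq)

lemma comp_closed [simp]: "f \<in> carrier P \<Longrightarrow> g \<in> carrier P \<Longrightarrow> comp f g \<in> carrier P"
  using ring_hom_closed[OF comp_hom] by blast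

lemma comp_add [simp]: "p \<in> carrier P \<Longrightarrow> q \<in> carrier P \<Longrightarrow> g \<in> carrier P \<Longrightarrow>
    comp (p +\<^sub>P q) g = comp p g +\<^sub>P comp q g"
  by (rule ring_hom_add[OF comp_hom])

lemma comp_mult [simp]: "p \<in> carrier P \<Longrightarrow> q \<in> carrier P \<Longrightarrow> g \<in> carrier P \<Longrightarrow>
    comp (p *\<^sub>P q) g = comp p g *\<^sub>P comp q g"
  by (rule ring_hom_mult[OF comp_hom])

lemma comp_uminus [simp]: "p \<in> carrier P \<Longrightarrow> g \<in> carrier P \<Longrightarrow> comp (-\<^sub>P p) g = -\<^sub>P comp p g"
proof -
  assume a: "p \<in> carrier P" "g \<in> carrier P"
  interpret h: ring_hom_ring P P "\<lambda>f. comp f g"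
    by (intro ring_hom_ringI2 UP.ring_axioms comp_hom a)
  show ?thesis using a by simp
qed

lemma comp_cst [simp]: "c \<in> carrier R \<Longrightarrow> g \<in> carrier P \<Longrightarrow> comp (cst c) g = cst c"
  unfolding comp_eq by (rule ext_eval_cst[OF cst_hom UP.is_cring])

lemma comp_zero [simp]: "comp 0\<^sub>P g = 0\<^sub>P"
  by (simp add: poly_comp_def P_zero)

lemma comp_X [simp]: "g \<in> carrier P \<Longrightarrow> comp X g = g"
  unfolding comp_eq by (rule ext_eval_X[OF cst_hom UP.is_cring])

lemma comp_assoc:
  assumes "f \<in> carrier P" "g \<in> carrier P" "k \<in> carrier P"
  shows "comp (comp f g) k = comp f (comp g k)"
  using assms(1) by (induction rule: poly_induct) (use assms in simp_all)

lemma comp_X_right: "f \<in> carrier P \<Longrightarrow> comp f X = f"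
  by (induction rule: poly_induct) simp_all

lemma Units_P: "Units P = {[k] | k. k \<in> carrier R - {\<zero>}}"
  by (rule univ_poly_carrier_units)

lemma Units_P_iff: "p \<in> carrier P \<Longrightarrow> p \<in> Units P \<longleftrightarrow> length p = 1"
  using univ_poly_units'[OF sf, of p] by (cases p) auto

text \<open>Substituting \<open>l\<close> is a ring automorphism with inverse the substitution of
  \<open>l'\<close>, and it fixes the units, which are constants.\<close>

lemma comp_inverse_irreducible:
  assumes l: "l \<in> carrier P" "l' \<in> carrier P" "comp l l' = X" "comp l' l = X"
    and p: "p \<in> carrier P"
  shows "pirreducible (carrier R) (comp p l) \<longleftrightarrow> pirreducible (carrier R) p"
proof -
  have inv: "comp (comp p l) l' = p" "comp (comp p l') l = p" if "p \<in> carrier P" for p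
    using that l by (simp_all add: comp_assoc comp_X_right)
  have U: "comp u k \<in> Units P" if u: "u \<in> Units P" and k: "k \<in> carrier P" for u k
  proof -
    obtain c where c: "u = [c]" "c \<in> carrier R" "c \<noteq> \<zero>" using u unfolding Units_P by blast
    then have "comp u k = u" using comp_cst[OF c(2) k] by (simp add: cst_list)
    then show ?thesis using u by simp
  qed
  have imp: "pirreducible (carrier R) (comp p l)"
    if p: "p \<in> carrier P" "pirreducible (carrier R) p" and l: "l \<in> carrier P" "l' \<in> carrier P"
      and inv: "\<And>p. p \<in> carrier P \<Longrightarrow> comp (comp p l) l' = p" "\<And>p. p \<in> carrier P \<Longrightarrow> comp (comp p l') l = p"
    for p l l'
  proof (rule pirreducibleI[OF sr])
    show "comp p l \<in> carrier P" using p l by simp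
    have z: "comp [] k = []" for k by (simp add: poly_comp_def P_zero)
    show "comp p l \<noteq> []" using inv(1)[OF p(1)] z pirreducibleE(1)[OF sr p] by auto
    show "comp p l \<notin> Units P" using U[of "comp p l" l'] inv(1)[OF p(1)] l pirreducibleE(2)[OF sr p] by auto
    fix q r assume qr: "q \<in> carrier P" "r \<in> carrier P" "comp p l = q *\<^sub>P r"
    then have "p = comp q l' *\<^sub>P comp r l'" using inv(1)[OF p(1)] l by (metis comp_mult)
    then have "comp q l' \<in> Units P \<or> comp r l' \<in> Units P"
      using pirreducibleE(3)[OF sr p] qr l by simp
    then show "q \<in> Units P \<or> r \<in> Units P"
      using U[of "comp q l'" l] U[of "comp r l'" l] inv(2) qr l by auto
  qed
  show ?thesis
    using imp[OF p _ l(1,2) inv] imp[OF _ _ l(2,1) inv(2,1), of "comp p l"] l p inv(1)[OF p] by auto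
qed

lemma comp_linear:
  assumes "u \<in> carrier R" "u \<noteq> \<zero>" "v \<in> carrier R" "p \<in> carrier P"
  shows "pirreducible (carrier R) (comp p (cst u *\<^sub>P X +\<^sub>P cst v)) \<longleftrightarrow> pirreducible (carrier R) p"
proof (rule comp_inverse_irreducible)
  let ?w = "inv u"
  have w: "?w \<in> carrier R" "u \<otimes> ?w = \<one>" "?w \<otimes> u = \<one>" using assms by (auto simp: field_Units)
  let ?l = "cst u *\<^sub>P X +\<^sub>P cst v" and ?l' = "cst ?w *\<^sub>P (X +\<^sub>P -\<^sub>P cst v)"
  show "?l \<in> carrier P" "?l' \<in> carrier P" using assms w by auto
  have c: "cst u \<in> carrier P" "cst ?w \<in> carrier P" "cst v \<in> carrier P" using assms w by auto
  have cw: "cst u *\<^sub>P cst ?w = 1\<^sub>P" using assms(1) w by (simp add: cst_mult[symmetric] cst_one)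
  have "comp ?l ?l' = (cst u *\<^sub>P cst ?w) *\<^sub>P (X +\<^sub>P -\<^sub>P cst v) +\<^sub>P cst v"
    using assms w by (simp add: UP.m_assoc)
  also have "\<dots> = X"
  proof -
    have "x +\<^sub>P -\<^sub>P y +\<^sub>P y = x" if "x \<in> carrier P" "y \<in> carrier P" for x y using that by algebra
    then show ?thesis unfolding cw using c by simp
  qed
  finally show "comp ?l ?l' = X" .
  have "comp ?l' ?l = (cst u *\<^sub>P cst ?w) *\<^sub>P X"
  proof -
    have "a *\<^sub>P (b *\<^sub>P x +\<^sub>P y +\<^sub>P -\<^sub>P y) = (b *\<^sub>P a) *\<^sub>P x"
      if "x \<in> carrier P" "y \<in> carrier P" "a \<in> carrier P" "b \<in> carrier P" for x y a b using that by algebra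
    then show ?thesis using c assms w by simp
  qed
  also have "\<dots> = X" unfolding cw by simp
  finally show "comp ?l' ?l = X" .
qed (use assms in auto)

section \<open>Substitution of X^2\<close>

abbreviation X2 :: "'a list" where "X2 \<equiv> X *\<^sub>P X"

lemma even_odd_decompose:
  assumes "p \<in> carrier P"
  shows "\<exists>A B. A \<in> carrier P \<and> B \<in> carrier P \<and> p = comp A X2 +\<^sub>P X *\<^sub>P comp B X2"
  using assms
proof (induction rule: poly_induct)
  case (cst c)
  then show ?case
    by (intro exI[of _ "cst c"] exI[of _ "0\<^sub>P"]) simp
next
  case (step p c)
  then obtain A B where AB: "A \<in> carrier P" "B \<in> carrier P" "p = comp A X2 +\<^sub>P X *\<^sub>P comp B X2" by blast
  have id: "x *\<^sub>P (a +\<^sub>P x *\<^sub>P b) +\<^sub>P c = (x *\<^sub>P x) *\<^sub>P b +\<^sub>P c +\<^sub>P x *\<^sub>P a"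
    if "x \<in> carrier P" "a \<in> carrier P" "b \<in> carrier P" "c \<in> carrier P" for x a b c
    using that by algebra
  show ?case
    using AB step(2) id[of X "comp A X2" "comp B X2" "cst c"]
    by - (rule exI[of _ "X *\<^sub>P B +\<^sub>P cst c"], rule exI[of _ A], simp)
qed

lemma length_comp_X2:
  assumes "p \<in> carrier P"
  shows "length (comp p X2) = 2 * length p - 1 \<and> (p \<noteq> [] \<longrightarrow> comp p X2 \<noteq> [])"
  using assms
proof (induction rule: poly_induct)
  case (cst c)
  then show ?case using comp_cst[OF cst UP.m_closed[OF X_closed X_closed]] by (simp add: cst_list[of c])
next
  case (step p c)
  have lX2: "length X2 = 3" "X2 \<noteq> []" using length_mult[of X X] by (auto simp: X_list)
  show ?case
  proof (cases "p = []")
    case True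
    then have "X *\<^sub>P p = 0\<^sub>P" using UP.r_null[OF X_closed] by (simp add: P_zero)
    then have "X *\<^sub>P p +\<^sub>P cst c = cst c" using step(2) by simp
    moreover have "comp (cst c) X2 = cst c" using step(2) by (intro comp_cst) auto
    ultimately show ?thesis by (simp only:) (simp add: cst_list[of c])
  next
    case False
    have 1: "length (X *\<^sub>P p) = length p + 1" using length_mult[OF X_closed step(1) _ False] by (simp add: X_list)
    have 2: "length (X2 *\<^sub>P comp p X2) = 2 * length p + 1"
      using length_mult[of X2 "comp p X2"] step lX2 False by (cases p) auto
    have pl: "length p > 0" using False by simp
    have "length (X *\<^sub>P p +\<^sub>P cst c) = length p + 1"
      using length_add_eq[of "X *\<^sub>P p" "cst c"] 1 length_cst[of c] step pl by auto
    moreover have "length (X2 *\<^sub>P comp p X2 +\<^sub>P cst c) = 2 * length p + 1"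
      using length_add_eq[of "X2 *\<^sub>P comp p X2" "cst c"] 2 length_cst[of c] step pl by auto
    ultimately show ?thesis using step by auto
  qed
qed

lemma comp_X2_inj:
  assumes "p \<in> carrier P" "q \<in> carrier P" "comp p X2 = comp q X2"
  shows "p = q"
proof -
  have "comp (p +\<^sub>P -\<^sub>P q) X2 = []" using assms by (simp add: UP.r_neg P_zero)
  then have "p +\<^sub>P -\<^sub>P q = 0\<^sub>P" using length_comp_X2[of "p +\<^sub>P -\<^sub>P q"] assms by (auto simp: P_zero)
  then show ?thesis using assms UP.r_right_minus_eq by (simp add: UP.minus_eq)
qed

lemma coeff_eq_lead:
  assumes "length p = Suc n"
  shows "coeff p n = lead_coeff p"
  using assms lead_coeff_simp[of p] by (cases p) auto

lemma coeff_add: "p \<in> carrier P \<Longrightarrow> q \<in> carrier P \<Longrightarrow> coeff (p +\<^sub>P q) n = coeff p n \<oplus> coeff q n"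
  using poly_add_coeff[of p q] polynomial_incl[of "carrier R"] by (simp add: univ_poly_add univ_poly_carrier)

lemma lead_coeff_closed: "p \<in> carrier P \<Longrightarrow> p \<noteq> [] \<Longrightarrow> lead_coeff p \<in> carrier R \<and> lead_coeff p \<noteq> \<zero>"
  by (cases p) (auto simp: univ_poly_carrier[symmetric] polynomial_def)

lemma lead_coeff_add:
  assumes "p \<in> carrier P" "q \<in> carrier P" "length q < length p"
  shows "lead_coeff (p +\<^sub>P q) = lead_coeff p"
proof -
  obtain n where n: "length p = Suc n" using assms by (cases "length p") auto
  have "length (p +\<^sub>P q) = Suc n" using length_add_eq[OF assms(1,2)] assms(3) n by simp
  then have "lead_coeff (p +\<^sub>P q) = coeff p n \<oplus> coeff q n"
    using coeff_eq_lead coeff_add[OF assms(1,2)] by metis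
  also have "\<dots> = lead_coeff p"
    using coeff_eq_lead[OF n] coeff_length[of q n] assms n lead_coeff_closed[OF assms(1)]
    by (cases "p = []") auto
  finally show ?thesis .
qed

lemma lead_coeff_mult:
  assumes "p \<in> carrier P" "q \<in> carrier P" "p \<noteq> []" "q \<noteq> []"
  shows "lead_coeff (p *\<^sub>P q) = lead_coeff p \<otimes> lead_coeff q"
  using poly_mult_lead_coeff[OF sr, of p q] assms by (simp add: univ_poly_mult univ_poly_carrier)

lemma lead_coeff_uminus:
  assumes "p \<in> carrier P" "p \<noteq> []"
  shows "lead_coeff (-\<^sub>P p) = \<ominus> lead_coeff p"
  using univ_poly_a_inv_def'[OF sr assms(1)] assms(2) by (cases p) auto

text \<open>If \<open>g(X^2) = p q\<close>, then multiplying by the same identity at \<open>-X\<close> gives \<open>g^2 = N(p) N(q)\<close>, where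
  \<open>N(p) = A^2 - X B^2\<close> for \<open>p = A(X^2) + X B(X^2)\<close>. So \<open>N(p)\<close> is \<open>g\<close> up to a constant, and comparing
  its constant and leading coefficients shows that \<open>(-1)^deg(g) lc(g) g(0)\<close> is a square.\<close>

lemma irreducible_comp_X2:
  assumes g: "g \<in> carrier P" "pirreducible (carrier R) g"
    and ns: "\<not> is_square ((\<ominus> \<one>) [^] (length g - 1) \<otimes> (lead_coeff g \<otimes> eval g \<zero>))"
  shows "pirreducible (carrier R) (comp g X2)"
proof (rule pirreducibleI[OF sr])
  have X2: "X2 \<in> carrier P" by simp
  have gnz: "g \<noteq> []" "g \<notin> Units P" using pirreducibleE[OF sr g] by auto
  then have glen: "length g > 1" using Units_P_iff[OF g(1)] by (cases g) auto
  have gprime: "pprime (carrier R) g" using g pprime_iff_pirreducible[OF sf] by blast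
  show "comp g X2 \<in> carrier P" using g by simp
  show "comp g X2 \<noteq> []" using length_comp_X2[OF g(1)] gnz by blast
  show "comp g X2 \<notin> Units P" using Units_P_iff[of "comp g X2"] length_comp_X2[OF g(1)] glen g X2 by simp
  fix p q assume pq: "p \<in> carrier P" "q \<in> carrier P" "comp g X2 = p *\<^sub>P q"
  obtain A B where AB: "A \<in> carrier P" "B \<in> carrier P" "p = comp A X2 +\<^sub>P X *\<^sub>P comp B X2"
    using even_odd_decompose[OF pq(1)] by blast
  obtain C D where CD: "C \<in> carrier P" "D \<in> carrier P" "q = comp C X2 +\<^sub>P X *\<^sub>P comp D X2"
    using even_odd_decompose[OF pq(2)] by blast
  let ?m = "-\<^sub>P X"
  have m: "?m \<in> carrier P" by simp
  have XX: "?m *\<^sub>P ?m = X2" by (simp add: UP.l_minus UP.r_minus)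
  have fix_neg: "comp (comp r X2) ?m = comp r X2" if "r \<in> carrier P" for r
    using that by (simp add: comp_assoc XX)
  have norm_id: "(a +\<^sub>P x *\<^sub>P b) *\<^sub>P (a +\<^sub>P -\<^sub>P x *\<^sub>P b) = a *\<^sub>P a +\<^sub>P -\<^sub>P ((x *\<^sub>P x) *\<^sub>P (b *\<^sub>P b))"
    if "a \<in> carrier P" "b \<in> carrier P" "x \<in> carrier P" for a b x using that by algebra
  define N where "N A B = A *\<^sub>P A +\<^sub>P -\<^sub>P (X *\<^sub>P (B *\<^sub>P B))" for A B
  have NP: "N A B \<in> carrier P" if "A \<in> carrier P" "B \<in> carrier P" for A B using that by (simp add: N_def)
  have norm: "(comp A X2 +\<^sub>P X *\<^sub>P comp B X2) *\<^sub>P comp (comp A X2 +\<^sub>P X *\<^sub>P comp B X2) ?m = comp (N A B) X2"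
    if "A \<in> carrier P" "B \<in> carrier P" for A B
    using that norm_id[of "comp A X2" "comp B X2" X] by (simp add: fix_neg N_def)
  have "comp (g *\<^sub>P g) X2 = comp g X2 *\<^sub>P comp (comp g X2) ?m" using g by (simp add: fix_neg)
  also have "\<dots> = (p *\<^sub>P q) *\<^sub>P (comp p ?m *\<^sub>P comp q ?m)" unfolding pq(3) using pq(1,2) by simp
  also have "\<dots> = (p *\<^sub>P comp p ?m) *\<^sub>P (q *\<^sub>P comp q ?m)"
  proof -
    have "(a *\<^sub>P b) *\<^sub>P (c *\<^sub>P d) = (a *\<^sub>P c) *\<^sub>P (b *\<^sub>P d)"
      if "a \<in> carrier P" "b \<in> carrier P" "c \<in> carrier P" "d \<in> carrier P" for a b c d using that by algebra
    then show ?thesis using pq(1,2) by simp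
  qed
  also have "\<dots> = comp (N A B *\<^sub>P N C D) X2"
    using norm[OF AB(1,2)] norm[OF CD(1,2)] AB(3) CD(3) NP[OF AB(1,2)] NP[OF CD(1,2)] by simp
  finally have gg: "g *\<^sub>P g = N A B *\<^sub>P N C D"
    using comp_X2_inj g NP[OF AB(1,2)] NP[OF CD(1,2)] by simp
  show "p \<in> Units P \<or> q \<in> Units P"
  proof (rule ccontr)
    assume nu: "\<not> (p \<in> Units P \<or> q \<in> Units P)"
    have notunit: "N A B \<notin> Units P"
      if "A \<in> carrier P" "B \<in> carrier P" "p = comp A X2 +\<^sub>P X *\<^sub>P comp B X2" "p \<notin> Units P" "p \<in> carrier P" for A B p
    proof
      assume "N A B \<in> Units P"
      then have "length (comp (N A B) X2) = 1"
        using Units_P_iff[OF NP[OF that(1,2)]] length_comp_X2[OF NP[OF that(1,2)]] by simp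
      then have "p *\<^sub>P comp p ?m \<in> Units P"
        using norm[OF that(1,2)] that(3,5) Units_P_iff[OF comp_closed[OF NP[OF that(1,2)] X2]] by simp
      then show False using UP.prod_unit_l[of p "comp p ?m"] that(4,5) UP.unit_factor[of p "comp p ?m"] by auto
    qed
    have nN: "N A B \<notin> Units P" "N C D \<notin> Units P"
      using notunit[OF AB] notunit[OF CD] nu pq by auto
    \<comment> \<open>If g divides N1, cancelling g in g^2 = N1 N2 leaves g = r N2; since N2 is no
      unit and g is irreducible, r is one.\<close>
    have assoc: "\<exists>u\<in>Units P. N1 = u *\<^sub>P g \<and> N2 \<in> carrier P"
      if N12: "N1 \<in> carrier P" "N2 \<in> carrier P" "g *\<^sub>P g = N1 *\<^sub>P N2" "N2 \<notin> Units P" "g dvd\<^sub>P N1" for N1 N2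
    proof -
      obtain r where r: "r \<in> carrier P" "N1 = g *\<^sub>P r" using N12 by (auto simp: factor_def)
      then have "g *\<^sub>P g = g *\<^sub>P (r *\<^sub>P N2)" using N12 g by (simp add: UP.m_assoc)
      then have "g = r *\<^sub>P N2" using UP.m_lcancel[of g g "r *\<^sub>P N2"] gnz g r N12 by (simp add: P_zero)
      then have "r \<in> Units P" using pirreducibleE(3)[OF sr g r(1) N12(2)] N12(4) by blast
      then show ?thesis using r g N12 by (intro bexI[of _ r]) (auto simp: UP.m_comm)
    qed
    have "\<exists>u\<in>Units P. N A B = u *\<^sub>P g"
    proof -
      have "g dvd\<^sub>P (N A B *\<^sub>P N C D)" using g by (intro dividesI[of g]) (auto simp: gg)
      then consider "g dvd\<^sub>P N A B" | "g dvd\<^sub>P N C D"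
        using pprimeE(3)[OF sf g(1) gprime NP[OF AB(1,2)] NP[OF CD(1,2)]] by (auto simp: pdivides_def)
      then show ?thesis
      proof cases
        case 1
        then show ?thesis using assoc[OF NP[OF AB(1,2)] NP[OF CD(1,2)] gg nN(2)] by blast
      next
        case 2
        have gg': "g *\<^sub>P g = N C D *\<^sub>P N A B" using gg NP[OF AB(1,2)] NP[OF CD(1,2)] by (simp add: UP.m_comm)
        obtain u where u: "u \<in> Units P" "N C D = u *\<^sub>P g"
          using assoc[OF NP[OF CD(1,2)] NP[OF AB(1,2)] gg' nN(1) 2] by blast
        have "g *\<^sub>P g = g *\<^sub>P (u *\<^sub>P N A B)"
        proof -
          have "u *\<^sub>P g *\<^sub>P n = g *\<^sub>P (u *\<^sub>P n)" if "n \<in> carrier P" "u \<in> carrier P" for n u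
            using that g(1) by algebra
          from this[OF NP[OF AB(1,2)] UP.Units_closed[OF u(1)]] show ?thesis using gg' u(2) by simp
        qed
        then have "g = u *\<^sub>P N A B"
          using UP.m_lcancel[of g g "u *\<^sub>P N A B"] gnz g UP.Units_closed[OF u(1)] NP[OF AB(1,2)] by (simp add: P_zero)
        then have "inv\<^bsub>P\<^esub> u *\<^sub>P g = N A B"
          using UP.m_assoc[OF UP.Units_inv_closed[OF u(1)] UP.Units_closed[OF u(1)] NP[OF AB(1,2)]]
            UP.Units_l_inv[OF u(1)] UP.l_one[OF NP[OF AB(1,2)]] by simp
        then show ?thesis using u by (intro bexI[of _ "inv\<^bsub>P\<^esub> u"]) auto
      qed
    qed
    then obtain e where e: "e \<in> carrier R" "e \<noteq> \<zero>" "N A B = [e] *\<^sub>P g" unfolding Units_P by auto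
    have ce: "[e] = cst e" using e by (simp add: cst_list)
    have N0: "eval (N A B) \<zero> = eval A \<zero> \<otimes> eval A \<zero>" unfolding N_def using AB by simp
    then have e0: "e \<otimes> eval g \<zero> = eval A \<zero> \<otimes> eval A \<zero>" unfolding e(3) ce using e g by simp
    have elc: "lead_coeff (N A B) = e \<otimes> lead_coeff g"
      unfolding e(3) using lead_coeff_mult[of "[e]" g] cst_closed[OF e(1), folded ce] g gnz by simp
    have Nlen: "length (N A B) = length g" unfolding e(3) using length_mult[of "[e]" g] cst_closed[OF e(1), folded ce] g gnz by simp
    have lA: "length (A *\<^sub>P A) = (if A = [] then 0 else 2 * length A - 1)"
      using length_mult[OF AB(1,1)] UP.l_null[OF AB(1)] by (auto simp: P_zero mult_2)
    have lB: "length (-\<^sub>P (X *\<^sub>P (B *\<^sub>P B))) = 2 * length B"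
    proof (cases "B = []")
      case True
      then show ?thesis using UP.l_null[OF AB(2)] UP.r_null[OF X_closed] UP.minus_zero by (simp add: P_zero)
    next
      case False
      then have "B *\<^sub>P B \<noteq> []" using mult_eq_Nil_iff[OF AB(2,2)] by simp
      then show ?thesis using length_mult[OF AB(2,2)] length_mult[OF X_closed, of "B *\<^sub>P B"] AB(2) False
        by (auto simp: X_list length_uminus)
    qed
    have sqI: "is_square z" if "z \<in> carrier R" "w \<in> carrier R" "(e \<otimes> e) \<otimes> z = w \<otimes> w" for z w
    proof -
      have i: "inv e \<in> carrier R" "inv e \<otimes> e = \<one>" using e by (auto simp: field_Units)
      have "z = (inv e \<otimes> e) \<otimes> (inv e \<otimes> e) \<otimes> z" using i that by simp
      also have "\<dots> = (inv e \<otimes> inv e) \<otimes> ((e \<otimes> e) \<otimes> z)" using i(1) e(1) that(1) by algebra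
      also have "\<dots> = (inv e \<otimes> w) \<otimes> (inv e \<otimes> w)" unfolding that(3) using i(1) that(2) by algebra
      finally show ?thesis unfolding is_square_def using i that by blast
    qed
    have lc: "lead_coeff g \<in> carrier R" using lead_coeff_closed[OF g(1) gnz(1)] by simp
    have g0: "eval g \<zero> \<in> carrier R" and A0: "eval A \<zero> \<in> carrier R" using g AB by auto
    \<comment> \<open>A^2 has even degree and X B^2 odd degree, so nothing cancels. The parity of
      the degree of g then decides which of the two supplies the leading coefficient, and X B^2
      brings the minus sign.\<close>
    have ne: "length (A *\<^sub>P A) \<noteq> length (-\<^sub>P (X *\<^sub>P (B *\<^sub>P B)))"
    proof
      assume eq: "length (A *\<^sub>P A) = length (-\<^sub>P (X *\<^sub>P (B *\<^sub>P B)))"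
      have "A = []"
      proof (rule ccontr)
        assume "A \<noteq> []"
        then have "2 * length A - 1 = 2 * length B" "length A > 0" using eq lA lB by auto
        then show False by presburger
      qed
      then have "length (A *\<^sub>P A) \<le> 0" using lA by simp
      then have "length (N A B) \<le> 0" unfolding N_def by (intro length_add_le) (use eq in auto)
      then show False using Nlen glen by linarith
    qed
    have c: "A *\<^sub>P A \<in> carrier P" "-\<^sub>P (X *\<^sub>P (B *\<^sub>P B)) \<in> carrier P" using AB by auto
    show False
    proof (cases "length (A *\<^sub>P A) > length (-\<^sub>P (X *\<^sub>P (B *\<^sub>P B)))")
      case True
      then have Anz: "A \<noteq> []" using lA by auto
      have lcA: "lead_coeff A \<in> carrier R" using lead_coeff_closed[OF AB(1) Anz] by simp
      have "lead_coeff (N A B) = lead_coeff A \<otimes> lead_coeff A"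
        unfolding N_def using lead_coeff_add[OF c True] lead_coeff_mult[OF AB(1,1) Anz Anz] by simp
      then have le: "e \<otimes> lead_coeff g = lead_coeff A \<otimes> lead_coeff A" using elc by simp
      have "length g = 2 * length A - 1"
        using length_add_eq[OF c ne] True lA Anz Nlen unfolding N_def by simp
      then have "length g - 1 = 2 * (length A - 1)" by simp
      then have "(\<ominus> \<one>) [^] (length g - 1) = ((\<ominus> \<one>) [^] (2::nat)) [^] (length A - 1)"
        by (simp add: nat_pow_pow)
      then have one: "(\<ominus> \<one>) [^] (length g - 1) = \<one>" by (simp add: numeral_2_eq_2 l_minus)
      have "is_square (lead_coeff g \<otimes> eval g \<zero>)"
      proof (rule sqI[of _ "lead_coeff A \<otimes> eval A \<zero>"])
        have "(e \<otimes> e) \<otimes> (lead_coeff g \<otimes> eval g \<zero>) = (e \<otimes> lead_coeff g) \<otimes> (e \<otimes> eval g \<zero>)"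
          using e(1) lc g0 by algebra
        also have "\<dots> = (lead_coeff A \<otimes> eval A \<zero>) \<otimes> (lead_coeff A \<otimes> eval A \<zero>)"
          unfolding le e0 using lcA A0 by algebra
        finally show "(e \<otimes> e) \<otimes> (lead_coeff g \<otimes> eval g \<zero>) = (lead_coeff A \<otimes> eval A \<zero>) \<otimes> (lead_coeff A \<otimes> eval A \<zero>)" .
      qed (use lc g0 lcA A0 in auto)
      then show False using ns lc g0 unfolding one by simp
    next
      case False
      then have lt: "length (A *\<^sub>P A) < length (-\<^sub>P (X *\<^sub>P (B *\<^sub>P B)))" using ne by simp
      then have Bnz: "B \<noteq> []" using lB by auto
      have lcB: "lead_coeff B \<in> carrier R" using lead_coeff_closed[OF AB(2) Bnz] by simp
      have BB: "B *\<^sub>P B \<noteq> []" "X *\<^sub>P (B *\<^sub>P B) \<noteq> []" using lB Bnz length_uminus[of "X *\<^sub>P (B *\<^sub>P B)"] AB(2) mult_eq_Nil_iff[OF AB(2,2)] by auto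
      have "lead_coeff (N A B) = lead_coeff (-\<^sub>P (X *\<^sub>P (B *\<^sub>P B)))"
        unfolding N_def using lead_coeff_add[OF c(2,1) lt] c by (simp add: UP.a_comm)
      also have "\<dots> = \<ominus> (lead_coeff B \<otimes> lead_coeff B)"
        using lead_coeff_uminus[OF _ BB(2)] lead_coeff_mult[OF X_closed _ _ BB(1)] lead_coeff_mult[OF AB(2,2) Bnz Bnz] AB(2) lcB
        by (simp add: X_list)
      finally have le: "e \<otimes> lead_coeff g = \<ominus> (lead_coeff B \<otimes> lead_coeff B)" using elc by simp
      have "length g = 2 * length B"
        using length_add_eq[OF c ne] lt lB Nlen unfolding N_def by simp
      then have "length g - 1 = Suc (2 * (length B - 1))" using Bnz by (cases B) auto
      then have "(\<ominus> \<one>) [^] (length g - 1) = ((\<ominus> \<one>) [^] (2::nat)) [^] (length B - 1) \<otimes> \<ominus> \<one>"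
        by (simp add: nat_pow_pow)
      then have one: "(\<ominus> \<one>) [^] (length g - 1) = \<ominus> \<one>" by (simp add: numeral_2_eq_2 l_minus)
      have "is_square (\<ominus> (lead_coeff g \<otimes> eval g \<zero>))"
      proof (rule sqI[of _ "lead_coeff B \<otimes> eval A \<zero>"])
        have "(e \<otimes> e) \<otimes> \<ominus> (lead_coeff g \<otimes> eval g \<zero>) = \<ominus> (e \<otimes> lead_coeff g) \<otimes> (e \<otimes> eval g \<zero>)"
          using e(1) lc g0 by algebra
        also have "\<dots> = (lead_coeff B \<otimes> eval A \<zero>) \<otimes> (lead_coeff B \<otimes> eval A \<zero>)"
          unfolding le e0 using lcB A0 by algebra
        finally show "(e \<otimes> e) \<otimes> \<ominus> (lead_coeff g \<otimes> eval g \<zero>) = (lead_coeff B \<otimes> eval A \<zero>) \<otimes> (lead_coeff B \<otimes> eval A \<zero>)" .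
      qed (use lc g0 lcB A0 in auto)
      then show False using ns lc g0 unfolding one by (simp add: l_minus)
    qed
  qed
qed

section \<open>The norm of a root in the field that it generates\<close>

lemma lead_coeff_lprod:
  assumes "A \<subseteq> carrier R"
  shows "lead_coeff (lprod A) = \<one>"
proof -
  have "finite A" using assms finite_carrier finite_subset by blast
  then show ?thesis using assms
  proof (induction A)
    case empty
    then show ?case by (simp add: lprod_empty P_one)
  next
    case (insert a A)
    have "lead_coeff (lin a *\<^sub>P lprod A) = lead_coeff (lin a) \<otimes> lead_coeff (lprod A)"
      using insert lprod_nonzero[of A] by (intro lead_coeff_mult) auto
    then show ?case using insert lprod_insert[OF insert(1,2,4)] by simp
  qed
qed

lemma length_minus_same_lead:
  assumes "p \<in> carrier P" "q \<in> carrier P" "length p = Suc n" "length q = Suc n" "lead_coeff p = lead_coeff q"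
  shows "length (p -\<^sub>P q) \<le> n"
proof (rule ccontr)
  assume "\<not> length (p -\<^sub>P q) \<le> n"
  moreover have "length (p -\<^sub>P q) \<le> Suc n" using assms by (intro length_minus_le) auto
  ultimately have l: "length (p -\<^sub>P q) = Suc n" by simp
  have nz: "p \<noteq> []" "q \<noteq> []" "p -\<^sub>P q \<noteq> []" using assms l by auto
  have "lead_coeff (p -\<^sub>P q) = coeff p n \<oplus> coeff (-\<^sub>P q) n"
    using coeff_eq_lead[OF l] coeff_add[of p "-\<^sub>P q" n] assms(1,2) by (simp add: UP.minus_eq)
  also have "\<dots> = lead_coeff p \<oplus> \<ominus> lead_coeff q"
    using coeff_eq_lead[OF assms(3)] coeff_eq_lead[of "-\<^sub>P q" n] lead_coeff_uminus[OF assms(2) nz(2)]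
      length_uminus[OF assms(2)] assms(4) by simp
  also have "\<dots> = \<zero>" using assms(5) lead_coeff_closed[OF assms(2) nz(2)] by (simp add: r_neg)
  finally show False using lead_coeff_closed[OF _ nz(3)] assms(1,2) by simp
qed

text \<open>The conjugates b^(q^i) with i < k are k distinct zeros of g in \<open>S\<close>, so g is
  its leading coefficient times the product of the X - b^(q^i). The claim compares constant
  terms.\<close>

lemma norm_of_root:
  assumes S: "finite_odd_field S" and h: "ring_hom_ring R S h" and card: "order S = order R ^ k" and k: "k \<ge> 1"
    and b: "b \<in> carrier S" and gen: "\<And>z. z \<in> carrier S \<Longrightarrow> \<exists>p\<in>carrier P. z = ext_eval S h b p"
    and g: "g \<in> carrier P" "length g = Suc k" and root: "ext_eval S h b g = \<zero>\<^bsub>S\<^esub>"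
  shows "h (eval g \<zero>) = h (lead_coeff g) \<otimes>\<^bsub>S\<^esub>
    ((\<ominus>\<^bsub>S\<^esub> \<one>\<^bsub>S\<^esub>) [^]\<^bsub>S\<^esub> k \<otimes>\<^bsub>S\<^esub> b [^]\<^bsub>S\<^esub> (\<Sum>i<k. order R ^ i))"
proof -
  interpret S: finite_odd_field S by (rule S)
  interpret h: ring_hom_ring R S h by (rule h)
  let ?q = "order R"
  have q: "?q \<ge> 3" by (rule order_ge_3)
  note ev_hom = ext_eval_hom[OF h S.is_cring]
  have ev_closed: "ext_eval S h u p \<in> carrier S" if "u \<in> carrier S" "p \<in> carrier P" for u p
    by (rule ring_hom_closed[OF ev_hom[OF that(1)] that(2)])
  have hc: "h c \<in> carrier S" if "c \<in> carrier R" for c using that by simp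
  have step: "ext_eval S h u (X *\<^sub>P p +\<^sub>P cst c) = u \<otimes>\<^bsub>S\<^esub> ext_eval S h u p \<oplus>\<^bsub>S\<^esub> h c"
    if "u \<in> carrier S" "p \<in> carrier P" "c \<in> carrier R" for u p c
    using ring_hom_add[OF ev_hom[OF that(1)], of "X *\<^sub>P p" "cst c"] ring_hom_mult[OF ev_hom[OF that(1)] X_closed that(2)]
      ext_eval_cst[OF h S.is_cring that(1,3)] ext_eval_X[OF h S.is_cring that(1)] that by simp
  \<comment> \<open>Obtained by evaluating the polynomial identity \<open>lin_pow_order\<close> at
    an element of the extension, without reference to the characteristic.\<close>
  have frob_add: "(u \<oplus>\<^bsub>S\<^esub> h c) [^]\<^bsub>S\<^esub> ?q = u [^]\<^bsub>S\<^esub> ?q \<oplus>\<^bsub>S\<^esub> h c" if u: "u \<in> carrier S" and c: "c \<in> carrier R" for u c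
  proof -
    note e = ev_hom[OF u]
    have pw: "ext_eval S h u (p ^\<^sub>P n) = ext_eval S h u p [^]\<^bsub>S\<^esub> n" if "p \<in> carrier P" for p and n :: nat
      by (rule ring_hom_ring.hom_nat_pow[OF ring_hom_ringI2[OF UP.ring_axioms S.ring_axioms e] that])
    have X: "ext_eval S h u X = u" by (rule ext_eval_X[OF h S.is_cring u])
    have C: "ext_eval S h u (cst c) = h c" by (rule ext_eval_cst[OF h S.is_cring u c])
    have "ext_eval S h u (lin c) = u \<oplus>\<^bsub>S\<^esub> h c"
      using ring_hom_add[OF e X_closed cst_closed[OF c]] X C lin_eq[OF c] by simp
    then have "(u \<oplus>\<^bsub>S\<^esub> h c) [^]\<^bsub>S\<^esub> ?q = ext_eval S h u (lin c ^\<^sub>P ?q)" using pw[OF lin_closed[OF c]] by simp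
    also have "\<dots> = u [^]\<^bsub>S\<^esub> ?q \<oplus>\<^bsub>S\<^esub> h c"
      using lin_pow_order[OF c] ring_hom_add[OF e UP.nat_pow_closed[OF X_closed] cst_closed[OF c]] pw[OF X_closed] X C by simp
    finally show ?thesis .
  qed
  have frob1: "ext_eval S h u p [^]\<^bsub>S\<^esub> ?q = ext_eval S h (u [^]\<^bsub>S\<^esub> ?q) p" if u: "u \<in> carrier S" and p: "p \<in> carrier P" for u p
    using p
  proof (induction rule: poly_induct)
    case (cst c)
    have "\<zero>\<^bsub>S\<^esub> [^]\<^bsub>S\<^esub> ?q = \<zero>\<^bsub>S\<^esub>" using q by (simp add: S.nat_pow_zero)
    then have "h c [^]\<^bsub>S\<^esub> ?q = h c" using frob_add[of "\<zero>\<^bsub>S\<^esub>" c] cst by simp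
    then show ?case using u cst by (simp add: ext_eval_cst[OF h S.is_cring])
  next
    case (step p c)
    have ep: "ext_eval S h u p \<in> carrier S" using ev_closed u step(1) by blast
    show ?case
      using \<open>ext_eval S h u p [^]\<^bsub>S\<^esub> ?q = ext_eval S h (u [^]\<^bsub>S\<^esub> ?q) p\<close> step(1) \<open>c \<in> carrier R\<close> u ep
      by (simp add: \<open>\<And>u p c. u \<in> carrier S \<Longrightarrow> p \<in> carrier P \<Longrightarrow> c \<in> carrier R \<Longrightarrow>
          ext_eval S h u (X *\<^sub>P p +\<^sub>P cst c) = u \<otimes>\<^bsub>S\<^esub> ext_eval S h u p \<oplus>\<^bsub>S\<^esub> h c\<close> frob_add S.nat_pow_distrib)
  qed
  define r where "r i = b [^]\<^bsub>S\<^esub> (?q ^ i)" for i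
  have rc: "r i \<in> carrier S" for i unfolding r_def using b by simp
  have r_Suc: "r (Suc i) = r i [^]\<^bsub>S\<^esub> ?q" for i
    unfolding r_def using b by (simp add: S.nat_pow_pow mult.commute)
  have frob: "ext_eval S h b p [^]\<^bsub>S\<^esub> (?q ^ i) = ext_eval S h (r i) p" if p: "p \<in> carrier P" for p i
  proof (induction i)
    case 0
    then show ?case using ev_closed[OF b p] b by (simp add: r_def)
  next
    case (Suc i)
    have "ext_eval S h b p [^]\<^bsub>S\<^esub> (?q ^ Suc i) = (ext_eval S h b p [^]\<^bsub>S\<^esub> (?q ^ i)) [^]\<^bsub>S\<^esub> ?q"
      using ev_closed[OF b p] by (simp add: S.nat_pow_pow mult.commute)
    then show ?case using Suc frob1[OF rc p] r_Suc by simp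
  qed
  have r_root: "ext_eval S h (r i) g = \<zero>\<^bsub>S\<^esub>" for i
  proof -
    have "?q ^ i \<noteq> 0" using q by simp
    then show ?thesis using frob[OF g(1), of i] root by (simp add: S.nat_pow_zero)
  qed
  \<comment> \<open>If two conjugates coincided, z^(q^i) = z^(q^j) would hold for all z, as every z
    is a polynomial in b. All nonzero z would then be zeros of a polynomial whose degree is below
    their number.\<close>
  have r_inj: "inj_on r {..<k}"
  proof (rule linorder_inj_onI)
    fix i j assume ij: "i < j" "i \<in> {..<k}" "j \<in> {..<k}"
    show "r i \<noteq> r j"
    proof
      assume eq: "r i = r j"
      define D where "D = ?q ^ j - ?q ^ i"
      have lt: "?q ^ i < ?q ^ j" using ij q by (intro power_strict_increasing) auto
      then have D: "D \<noteq> 0" "?q ^ j = ?q ^ i + D" by (auto simp: D_def)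
      have "carrier S - {\<zero>\<^bsub>S\<^esub>} \<subseteq> {z \<in> carrier S. z [^]\<^bsub>S\<^esub> D = \<one>\<^bsub>S\<^esub>}"
      proof
        fix z assume z: "z \<in> carrier S - {\<zero>\<^bsub>S\<^esub>}"
        then obtain p where p: "p \<in> carrier P" "z = ext_eval S h b p" using gen by blast
        have "z [^]\<^bsub>S\<^esub> (?q ^ i) = z [^]\<^bsub>S\<^esub> (?q ^ j)" using frob[OF p(1)] p(2) eq by simp
        moreover have "z [^]\<^bsub>S\<^esub> (?q ^ i) \<otimes>\<^bsub>S\<^esub> z [^]\<^bsub>S\<^esub> D = z [^]\<^bsub>S\<^esub> (?q ^ j)"
          unfolding D(2) using z by (intro S.nat_pow_mult) auto
        ultimately have "z [^]\<^bsub>S\<^esub> (?q ^ i) \<otimes>\<^bsub>S\<^esub> \<one>\<^bsub>S\<^esub> = z [^]\<^bsub>S\<^esub> (?q ^ i) \<otimes>\<^bsub>S\<^esub> z [^]\<^bsub>S\<^esub> D"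
          using z by (simp only: S.r_one[OF S.nat_pow_closed] Diff_iff)
        moreover have "z [^]\<^bsub>S\<^esub> (?q ^ i) \<in> Units S" using z by (intro S.Units_pow_closed) (simp add: S.field_Units)
        moreover have "z [^]\<^bsub>S\<^esub> D \<in> carrier S" using z by simp
        ultimately have "\<one>\<^bsub>S\<^esub> = z [^]\<^bsub>S\<^esub> D"
          by (simp only: S.Units_l_cancel[OF _ S.one_closed])
        then have "z [^]\<^bsub>S\<^esub> D = \<one>\<^bsub>S\<^esub>" by (rule sym)
        then show "z \<in> {z \<in> carrier S. z [^]\<^bsub>S\<^esub> D = \<one>\<^bsub>S\<^esub>}" using z by simp
      qed
      then have "order S - 1 \<le> card {z \<in> carrier S. z [^]\<^bsub>S\<^esub> D = \<one>\<^bsub>S\<^esub>}"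
        unfolding S.card_nonzero[symmetric] using S.finite_carrier by (intro card_mono) auto
      also have "\<dots> \<le> D" by (rule S.num_roots_le_deg[OF S.finite_carrier D(1)])
      finally have "?q ^ k - 1 \<le> ?q ^ j - ?q ^ i" using card by (simp add: D_def)
      moreover have "?q ^ j < ?q ^ k" using ij q by (intro power_strict_increasing) auto
      moreover have "?q ^ i \<ge> 1" using q by simp
      ultimately show False using lt by linarith
    qed
  qed auto
  have h_nz: "h c \<noteq> \<zero>\<^bsub>S\<^esub>" if "c \<in> carrier R" "c \<noteq> \<zero>" for c
  proof
    assume "h c = \<zero>\<^bsub>S\<^esub>"
    moreover have "inv c \<in> carrier R" "c \<otimes> inv c = \<one>" using that by (auto simp: field_Units)
    ultimately have "\<one>\<^bsub>S\<^esub> = \<zero>\<^bsub>S\<^esub>" using that h.hom_mult[of c "inv c"] h.hom_one by simp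
    then show False by simp
  qed
  have gnz: "g \<noteq> []" using g by auto
  have lc: "lead_coeff g \<in> carrier R" "lead_coeff g \<noteq> \<zero>" using lead_coeff_closed[OF g(1) gnz] by auto
  define G where "G = map h g"
  have "set g \<subseteq> carrier R" using g(1) polynomial_incl univ_poly_carrier by blast
  then have "polynomial\<^bsub>S\<^esub> (carrier S) G"
    unfolding polynomial_def G_def using h_nz[OF lc] gnz by (cases g) auto
  then have GP: "G \<in> carrier S.P" by (simp add: univ_poly_carrier)
  have Glen: "length G = Suc k" "lead_coeff G = h (lead_coeff g)" using g gnz by (auto simp: G_def hd_map)
  have evG: "S.eval G u = ext_eval S h u g" for u by (simp add: G_def ext_eval_def)
  define A where "A = (\<lambda>i. \<ominus>\<^bsub>S\<^esub> r i) ` {..<k}"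
  have A: "A \<subseteq> carrier S" using rc by (auto simp: A_def)
  have inj_m: "inj_on (\<lambda>i. \<ominus>\<^bsub>S\<^esub> r i) {..<k}"
    by (rule inj_onI) (metis rc S.minus_minus inj_onD[OF r_inj])
  then have cA: "card A = k" unfolding A_def using card_image by fastforce
  define H where "H = S.cst (h (lead_coeff g)) \<otimes>\<^bsub>S.P\<^esub> S.lprod A"
  have clP: "S.cst (h (lead_coeff g)) = [h (lead_coeff g)]" "[h (lead_coeff g)] \<in> carrier S.P"
    using h_nz[OF lc] S.cst_closed[OF hc[OF lc(1)]] by (auto simp: S.cst_list)
  have HP: "H \<in> carrier S.P" unfolding H_def using A hc[OF lc(1)]
    by (intro monoid.m_closed S.cst_closed S.lprod_closed ring.is_monoid S.univ_poly_is_ring[OF S.sr])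
  have Hlen: "length H = Suc k" "lead_coeff H = h (lead_coeff g)"
    unfolding H_def clP(1)
    using S.length_mult[OF clP(2) S.lprod_closed[OF A]] S.lead_coeff_mult[OF clP(2) S.lprod_closed[OF A]]
      S.lprod_nonzero[OF A] S.lead_coeff_lprod[OF A] cA hc[OF lc(1)] by auto
  have evH: "S.eval H u = h (lead_coeff g) \<otimes>\<^bsub>S\<^esub> (\<Otimes>\<^bsub>S\<^esub>a\<in>A. u \<oplus>\<^bsub>S\<^esub> a)" if "u \<in> carrier S" for u
    unfolding H_def using that A hc[OF lc(1)] by (simp add: S.eval_lprod)
  \<comment> \<open>Equal leading terms make the degree of the difference smaller than k, but it has
    the k conjugates as zeros.\<close>
  have "G \<ominus>\<^bsub>S.P\<^esub> H = []"
  proof (rule ccontr)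
    assume nz: "G \<ominus>\<^bsub>S.P\<^esub> H \<noteq> []"
    have "card (r ` {..<k}) < length (G \<ominus>\<^bsub>S.P\<^esub> H)"
    proof (rule S.roots_bound[OF _ nz])
      show "G \<ominus>\<^bsub>S.P\<^esub> H \<in> carrier S.P"
        by (rule ring.ring_simprules(4)[OF S.univ_poly_is_ring[OF S.sr] GP HP])
      show "r ` {..<k} \<subseteq> carrier S" using rc by auto
      fix t assume "t \<in> r ` {..<k}"
      then obtain i where i: "i < k" "t = r i" by auto
      have "\<ominus>\<^bsub>S\<^esub> r i \<in> A" using i by (auto simp: A_def)
      then have "\<exists>a\<in>A. t \<oplus>\<^bsub>S\<^esub> a = \<zero>\<^bsub>S\<^esub>" using rc i by (intro bexI[of _ "\<ominus>\<^bsub>S\<^esub> r i"]) (auto simp: S.r_neg)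
      moreover have "finite A" by (simp add: A_def)
      ultimately have "(\<Otimes>\<^bsub>S\<^esub>a\<in>A. t \<oplus>\<^bsub>S\<^esub> a) = \<zero>\<^bsub>S\<^esub>"
        using S.finprod_eq_zero_iff[of A "\<lambda>a. t \<oplus>\<^bsub>S\<^esub> a"] A i rc by auto
      then show "S.eval (G \<ominus>\<^bsub>S.P\<^esub> H) t = \<zero>\<^bsub>S\<^esub>"
        using S.eval_minus[OF GP HP, of t] evG evH r_root i rc hc[OF lc(1)] by simp
    qed
    moreover have "length (G \<ominus>\<^bsub>S.P\<^esub> H) \<le> k"
      using S.length_minus_same_lead[OF GP HP Glen(1) Hlen(1)] Glen(2) Hlen(2) by simp
    ultimately show False using card_image[OF r_inj] by simp
  qed
  then have "S.eval (G \<ominus>\<^bsub>S.P\<^esub> H) \<zero>\<^bsub>S\<^esub> = \<zero>\<^bsub>S\<^esub>" by simp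
  then have eq: "S.eval G \<zero>\<^bsub>S\<^esub> = S.eval H \<zero>\<^bsub>S\<^esub>" using GP HP by simp
  have "S.eval G \<zero>\<^bsub>S\<^esub> = h (eval g \<zero>)"
    using h.eval_hom[OF sr zero_closed g(1)] by (simp add: G_def)
  moreover have "(\<Otimes>\<^bsub>S\<^esub>a\<in>A. \<zero>\<^bsub>S\<^esub> \<oplus>\<^bsub>S\<^esub> a) = (\<Otimes>\<^bsub>S\<^esub>i\<in>{..<k}. \<ominus>\<^bsub>S\<^esub> r i)"
  proof -
    have "(\<Otimes>\<^bsub>S\<^esub>a\<in>A. \<zero>\<^bsub>S\<^esub> \<oplus>\<^bsub>S\<^esub> a) = (\<Otimes>\<^bsub>S\<^esub>i\<in>{..<k}. \<zero>\<^bsub>S\<^esub> \<oplus>\<^bsub>S\<^esub> (\<ominus>\<^bsub>S\<^esub> r i))"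
      unfolding A_def using rc by (intro S.finprod_reindex[OF _ inj_m]) auto
    then show ?thesis using rc by simp
  qed
  moreover have "(\<Otimes>\<^bsub>S\<^esub>i\<in>{..<n}. \<ominus>\<^bsub>S\<^esub> r i) = (\<ominus>\<^bsub>S\<^esub> \<one>\<^bsub>S\<^esub>) [^]\<^bsub>S\<^esub> n \<otimes>\<^bsub>S\<^esub> b [^]\<^bsub>S\<^esub> (\<Sum>i<n. ?q ^ i)" for n
  proof (induction n)
    case (Suc n)
    have id: "\<ominus>\<^bsub>S\<^esub> x \<otimes>\<^bsub>S\<^esub> (m \<otimes>\<^bsub>S\<^esub> y) = (m \<otimes>\<^bsub>S\<^esub> \<ominus>\<^bsub>S\<^esub> \<one>\<^bsub>S\<^esub>) \<otimes>\<^bsub>S\<^esub> (y \<otimes>\<^bsub>S\<^esub> x)"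
      if "x \<in> carrier S" "m \<in> carrier S" "y \<in> carrier S" for x m y
      using that by algebra
    have "(\<Otimes>\<^bsub>S\<^esub>i\<in>insert n {..<n}. \<ominus>\<^bsub>S\<^esub> r i) = \<ominus>\<^bsub>S\<^esub> r n \<otimes>\<^bsub>S\<^esub> (\<Otimes>\<^bsub>S\<^esub>i\<in>{..<n}. \<ominus>\<^bsub>S\<^esub> r i)"
      using rc by (intro S.finprod_insert) auto
    then have "(\<Otimes>\<^bsub>S\<^esub>i\<in>{..<Suc n}. \<ominus>\<^bsub>S\<^esub> r i) =
        \<ominus>\<^bsub>S\<^esub> r n \<otimes>\<^bsub>S\<^esub> ((\<ominus>\<^bsub>S\<^esub> \<one>\<^bsub>S\<^esub>) [^]\<^bsub>S\<^esub> n \<otimes>\<^bsub>S\<^esub> b [^]\<^bsub>S\<^esub> (\<Sum>i<n. ?q ^ i))"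
      by (simp add: lessThan_Suc Suc)
    also have "\<dots> = (\<ominus>\<^bsub>S\<^esub> \<one>\<^bsub>S\<^esub>) [^]\<^bsub>S\<^esub> Suc n \<otimes>\<^bsub>S\<^esub> b [^]\<^bsub>S\<^esub> (\<Sum>i<Suc n. ?q ^ i)"
      using id[OF rc[of n], of "(\<ominus>\<^bsub>S\<^esub> \<one>\<^bsub>S\<^esub>) [^]\<^bsub>S\<^esub> n" "b [^]\<^bsub>S\<^esub> (\<Sum>i<n. ?q ^ i)"] b
      by (simp add: r_def S.nat_pow_mult)
    finally show ?case .
  qed (use b in simp)
  ultimately show ?thesis using eq evH[OF S.zero_closed] by simp
qed

text \<open>In the field \<open>K\<close> obtained by adjoining a root \<open>b\<close> of \<open>g\<close>, the norm of \<open>b\<close> is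
  \<open>b^((|K|-1)/(q-1))\<close>. If it is a square in \<open>R\<close>, then \<open>b\<close> is a square in \<open>K\<close>, say the class of \<open>r^2\<close>;
  hence \<open>g(X^2)\<close> divides \<open>(r(X^2) - X) (r(X^2) + X)\<close>.\<close>

lemma reducible_comp_X2:
  assumes g: "g \<in> carrier P" "pirreducible (carrier R) g"
    and sq: "is_square ((\<ominus> \<one>) [^] (length g - 1) \<otimes> (lead_coeff g \<otimes> eval g \<zero>))"
  shows "\<not> pirreducible (carrier R) (comp g X2)"
proof
  assume irr: "pirreducible (carrier R) (comp g X2)"
  have gnz: "g \<noteq> []" "g \<notin> Units P" using pirreducibleE[OF sr g] by auto
  define k where "k = length g - 1"
  have "length g > 1" using gnz Units_P_iff[OF g(1)] by (cases g) auto
  then have k: "length g = Suc k" "k \<ge> 1" by (auto simp: k_def)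
  define S where "S = Rupt (carrier R) g"
  define \<pi> where "\<pi> = rupture_surj (carrier R) g"
  define h where "h = \<pi> \<circ> cst"
  interpret S: field S unfolding S_def using rupture_is_field_iff_pirreducible[OF sf g(1)] g(2) by simp
  have \<pi>: "\<pi> \<in> ring_hom P S" "ring_hom_ring P S \<pi>"
    unfolding \<pi>_def S_def using rupture_surj_hom[OF sr g(1)] by auto
  interpret \<pi>: ring_hom_ring P S \<pi> by (rule \<pi>(2))
  have "h \<in> ring_hom R S"
    unfolding h_def \<pi>_def S_def using rupture_surj_norm_is_hom[OF sr g(1)] by simp
  then have h: "ring_hom_ring R S h" by (intro ring_hom_ringI2 ring_axioms S.ring_axioms)
  interpret h: ring_hom_ring R S h by (rule h)
  have im: "(\<lambda>p. p pmod g) ` carrier P = Pd k"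
    using pmod_image_characterization[OF sf g(1) gnz(1)] by (simp add: k_def)
  have carS: "carrier S = \<pi> ` Pd k"
    using rupture_carrier_as_pmod_image[OF sf g(1)] unfolding im S_def \<pi>_def by simp
  have inj: "inj_on \<pi> (Pd k)"
    using rupture_surj_inj_on[OF sf g(1)] unfolding im \<pi>_def .
  have ordS: "order S = order R ^ k"
    unfolding order_def carS card_image[OF inj] using card_bounded_length by (simp add: order_def)
  \<comment> \<open>The field generated by the root satisfies the same assumptions, so Euler's
    criterion is available in it.\<close>
  have S: "finite_odd_field S"
  proof
    show "finite (carrier S)" unfolding carS by (intro finite_imageI finite_bounded_length)
    show "odd (order S)" unfolding ordS using odd_order by simp
  qed
  interpret S: finite_odd_field S by (rule S)
  define b where "b = \<pi> X"
  have b: "b \<in> carrier S" by (simp add: b_def)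
  have hp: "h c = \<pi> (cst c)" for c by (simp add: h_def)
  have ev: "ext_eval S h b p = \<pi> p" if "p \<in> carrier P" for p
    using that
  proof (induction rule: poly_induct)
    case (cst c)
    show ?case using ext_eval_cst[OF h S.is_cring b cst] unfolding hp .
  next
    case (step p c)
    have "ext_eval S h b (X *\<^sub>P p +\<^sub>P cst c) = ext_eval S h b X \<otimes>\<^bsub>S\<^esub> ext_eval S h b p \<oplus>\<^bsub>S\<^esub> ext_eval S h b (cst c)"
      using ring_hom_add[OF ext_eval_hom[OF h S.is_cring b], of "X *\<^sub>P p" "cst c"]
        ring_hom_mult[OF ext_eval_hom[OF h S.is_cring b], of X p] step by simp
    also have "\<dots> = \<pi> X \<otimes>\<^bsub>S\<^esub> \<pi> p \<oplus>\<^bsub>S\<^esub> \<pi> (cst c)"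
      by (simp only: step(3) ext_eval_cst[OF h S.is_cring b step(2)] ext_eval_X[OF h S.is_cring b] hp b_def[symmetric])
    also have "\<dots> = \<pi> (X *\<^sub>P p +\<^sub>P cst c)" using step by simp
    finally show ?case .
  qed
  have root: "ext_eval S h b g = \<zero>\<^bsub>S\<^esub>"
    unfolding ext_eval_def h_def b_def S_def \<pi>_def by (rule polynomial_rupture[OF sr g(1)])
  have gen: "\<exists>p\<in>carrier P. z = ext_eval S h b p" if "z \<in> carrier S" for z
    using that ev unfolding carS by force
  define E where "E = (\<Sum>i<k. order R ^ i)"
  have norm: "h (eval g \<zero>) = h (lead_coeff g) \<otimes>\<^bsub>S\<^esub> ((\<ominus>\<^bsub>S\<^esub> \<one>\<^bsub>S\<^esub>) [^]\<^bsub>S\<^esub> k \<otimes>\<^bsub>S\<^esub> b [^]\<^bsub>S\<^esub> E)"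
    unfolding E_def by (rule norm_of_root[OF S h ordS k(2) b gen g(1) k(1) root])
  have lc: "lead_coeff g \<in> carrier R" "lead_coeff g \<noteq> \<zero>" using lead_coeff_closed[OF g(1) gnz(1)] by auto
  obtain e where e: "e \<in> carrier R" "(\<ominus> \<one>) [^] k \<otimes> (lead_coeff g \<otimes> eval g \<zero>) = e \<otimes> e"
    using sq unfolding is_square_def k_def by auto
  define il where "il = inv (lead_coeff g)"
  have il: "il \<in> carrier R" "il \<otimes> lead_coeff g = \<one>" using lc unfolding il_def by (auto simp: field_Units)
  define y where "y = il \<otimes> e"
  have y: "y \<in> carrier R" using il e by (simp add: y_def)
  have m1: "(\<ominus> \<one>) [^] k \<otimes> (\<ominus> \<one>) [^] k = \<one>"
  proof -
    have "(\<ominus> \<one>) [^] k \<otimes> (\<ominus> \<one>) [^] k = (\<ominus> \<one> \<otimes> \<ominus> \<one>) [^] k" by (simp add: nat_pow_distrib)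
    also have "\<ominus> \<one> \<otimes> \<ominus> \<one> = \<one>" by algebra
    finally show ?thesis by simp
  qed
  \<comment> \<open>\<open>norm\<close> solved for b^E: with (-1)^k lc(g) g(0) = e^2 it becomes the
    square of y = e / lc(g).\<close>
  have bE: "b [^]\<^bsub>S\<^esub> E = h y \<otimes>\<^bsub>S\<^esub> h y"
  proof -
    have hm: "h ((\<ominus> \<one>) [^] k) = (\<ominus>\<^bsub>S\<^esub> \<one>\<^bsub>S\<^esub>) [^]\<^bsub>S\<^esub> k"
      using h.hom_nat_pow[of "\<ominus> \<one>" k] by simp
    have "y \<otimes> y = (il \<otimes> il) \<otimes> ((\<ominus> \<one>) [^] k \<otimes> (lead_coeff g \<otimes> eval g \<zero>))"
      unfolding e(2) y_def using il(1) e(1) by algebra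
    also have "\<dots> = (\<ominus> \<one>) [^] k \<otimes> (il \<otimes> eval g \<zero>) \<otimes> (il \<otimes> lead_coeff g)"
    proof -
      have "(i \<otimes> i) \<otimes> (m \<otimes> (l \<otimes> x)) = m \<otimes> (i \<otimes> x) \<otimes> (i \<otimes> l)"
        if "i \<in> carrier R" "m \<in> carrier R" "l \<in> carrier R" "x \<in> carrier R" for i m l x using that by algebra
      then show ?thesis using il(1) lc(1) g(1) by simp
    qed
    finally have yy: "y \<otimes> y = (\<ominus> \<one>) [^] k \<otimes> (il \<otimes> eval g \<zero>)" using il g(1) by simp
    have "h y \<otimes>\<^bsub>S\<^esub> h y = h (y \<otimes> y)" using y by simp
    also have "\<dots> = h ((\<ominus> \<one>) [^] k) \<otimes>\<^bsub>S\<^esub> (h il \<otimes>\<^bsub>S\<^esub> h (eval g \<zero>))"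
      unfolding yy using il g(1) by simp
    also have "\<dots> = h ((\<ominus> \<one>) [^] k) \<otimes>\<^bsub>S\<^esub> (h il \<otimes>\<^bsub>S\<^esub> (h (lead_coeff g) \<otimes>\<^bsub>S\<^esub> (h ((\<ominus> \<one>) [^] k) \<otimes>\<^bsub>S\<^esub> b [^]\<^bsub>S\<^esub> E)))"
      unfolding norm hm ..
    also have "\<dots> = (h ((\<ominus> \<one>) [^] k) \<otimes>\<^bsub>S\<^esub> h ((\<ominus> \<one>) [^] k)) \<otimes>\<^bsub>S\<^esub> (h il \<otimes>\<^bsub>S\<^esub> h (lead_coeff g)) \<otimes>\<^bsub>S\<^esub> b [^]\<^bsub>S\<^esub> E"
    proof -
      have "m \<otimes>\<^bsub>S\<^esub> (i \<otimes>\<^bsub>S\<^esub> (l \<otimes>\<^bsub>S\<^esub> (m \<otimes>\<^bsub>S\<^esub> x))) = (m \<otimes>\<^bsub>S\<^esub> m) \<otimes>\<^bsub>S\<^esub> (i \<otimes>\<^bsub>S\<^esub> l) \<otimes>\<^bsub>S\<^esub> x"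
        if "i \<in> carrier S" "m \<in> carrier S" "l \<in> carrier S" "x \<in> carrier S" for i m l x using that by algebra
      then show ?thesis using il(1) lc(1) b by simp
    qed
    also have "\<dots> = b [^]\<^bsub>S\<^esub> E"
    proof -
      have "h ((\<ominus> \<one>) [^] k) \<otimes>\<^bsub>S\<^esub> h ((\<ominus> \<one>) [^] k) = \<one>\<^bsub>S\<^esub>"
        using h.hom_mult[of "(\<ominus> \<one>) [^] k" "(\<ominus> \<one>) [^] k", symmetric] m1 by simp
      moreover have "h il \<otimes>\<^bsub>S\<^esub> h (lead_coeff g) = \<one>\<^bsub>S\<^esub>"
        using h.hom_mult[OF il(1) lc(1), symmetric] il(2) by simp
      ultimately show ?thesis using b by simp
    qed
    finally show ?thesis by simp
  qed
  have "S.is_square b"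
  proof (cases "b = \<zero>\<^bsub>S\<^esub>")
    case True
    then show ?thesis using S.is_square_zero by simp
  next
    case False
    \<comment> \<open>Geometric sum. Hence b^((|S|-1)/2) is the power (q - 1) / 2 of y^2, that is
      y^(q-1) = 1.\<close>
    have "(order R - 1) * E = order R ^ k - 1"
      unfolding E_def by (induction k) (use order_ge_3 in \<open>auto simp: algebra_simps diff_mult_distrib2\<close>)
    then have "2 * (order S div 2) = 2 * (order R div 2) * E"
      using S.half_order half_order unfolding ordS by metis
    then have half: "order S div 2 = E * (order R div 2)" by (simp only: mult.assoc mult.commute mult_left_cancel)
    have bu: "b [^]\<^bsub>S\<^esub> E \<in> Units S" using b False by (intro S.Units_pow_closed) (simp add: S.field_Units)
    have "y \<noteq> \<zero>"
    proof
      assume "y = \<zero>"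
      then have "b [^]\<^bsub>S\<^esub> E = \<zero>\<^bsub>S\<^esub>" unfolding bE by simp
      then show False using bu by (simp add: S.field_Units)
    qed
    have "b [^]\<^bsub>S\<^esub> (order S div 2) = (h y \<otimes>\<^bsub>S\<^esub> h y) [^]\<^bsub>S\<^esub> (order R div 2)"
      unfolding half bE[symmetric] using b by (simp add: S.nat_pow_pow)
    also have "\<dots> = h ((y \<otimes> y) [^] (order R div 2))"
      using h.hom_nat_pow[of "y \<otimes> y" "order R div 2"] y by simp
    also have "(y \<otimes> y) [^] (order R div 2) = y [^] (2 * (order R div 2))"
      using y by (simp add: nat_pow_distrib nat_pow_mult mult_2)
    also have "\<dots> = \<one>" unfolding half_order by (rule pow_order_minus_1[OF y \<open>y \<noteq> \<zero>\<close>])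
    finally show ?thesis using S.is_square_iff_pow_half[OF b False] by simp
  qed
  then obtain z where z: "z \<in> carrier S" "b = z \<otimes>\<^bsub>S\<^esub> z" unfolding S.is_square_def by auto
  then obtain r where r: "r \<in> Pd k" "z = \<pi> r" unfolding carS by auto
  have rr: "r *\<^sub>P r \<in> carrier P" using r by simp
  have "\<pi> (r *\<^sub>P r) = \<pi> X" using r z b_def by simp
  then have "\<pi> ((r *\<^sub>P r) pmod g) = \<pi> (X pmod g)"
    using rupture_surj_composed_with_pmod[OF sf g(1) rr] rupture_surj_composed_with_pmod[OF sf g(1) X_closed]
    unfolding \<pi>_def by simp
  then have "(r *\<^sub>P r) pmod g = X pmod g"
    using inj_onD[OF inj] im rr X_closed by blast
  then have "g dvd\<^sub>P (r *\<^sub>P r -\<^sub>P X)"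
    using same_pmod_iff_pdivides[OF sf rr X_closed g(1)] by (simp add: pdivides_def)
  then obtain w where w: "w \<in> carrier P" "r *\<^sub>P r -\<^sub>P X = g *\<^sub>P w" by (auto simp: factor_def)
  define s where "s = comp r X2"
  have sP: "s \<in> carrier P" using r by (simp add: s_def)
  have "(s +\<^sub>P -\<^sub>P X) *\<^sub>P (s +\<^sub>P X) = comp (r *\<^sub>P r -\<^sub>P X) X2"
  proof -
    have "(a +\<^sub>P -\<^sub>P x) *\<^sub>P (a +\<^sub>P x) = a *\<^sub>P a +\<^sub>P -\<^sub>P (x *\<^sub>P x)"
      if "a \<in> carrier P" "x \<in> carrier P" for a x using that by algebra
    then show ?thesis using sP r by (simp add: s_def UP.minus_eq)
  qed
  also have "\<dots> = comp g X2 *\<^sub>P comp w X2" unfolding w(2) using g w by simp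
  finally have "comp g X2 dvd\<^sub>P ((s +\<^sub>P -\<^sub>P X) *\<^sub>P (s +\<^sub>P X))"
    using w by (intro dividesI[of "comp w X2"]) auto
  moreover have "pprime (carrier R) (comp g X2)"
    using pprime_iff_pirreducible[OF sf, of "comp g X2"] irr g by simp
  ultimately have dvd: "comp g X2 dvd\<^sub>P (s +\<^sub>P -\<^sub>P X) \<or> comp g X2 dvd\<^sub>P (s +\<^sub>P X)"
    using pprimeE(3)[OF sf, of "comp g X2" "s +\<^sub>P -\<^sub>P X" "s +\<^sub>P X"] sP g by (simp add: pdivides_def)
  obtain x where x: "x \<in> carrier P" "length x = 2" "comp g X2 dvd\<^sub>P (s +\<^sub>P x)"
  proof -
    have "length X = 2" "length (-\<^sub>P X) = 2" using length_uminus[OF X_closed] by (simp_all add: X_list)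
    then show ?thesis using that X_closed UP.a_inv_closed[OF X_closed] dvd by blast
  qed
  have ls: "length s = 2 * length r - 1" unfolding s_def using length_comp_X2[of r] r by simp
  \<comment> \<open>\<open>s\<close> is a polynomial in X^2 and thus cannot cancel against X. So s +
    x is nonzero with length at most max (2k - 1) 2, too short for a multiple of g(X^2), whose
    length is 2k + 1.\<close>
  then have "length s \<noteq> length x" using x(2) by presburger
  then have l: "length (s +\<^sub>P x) = max (length s) 2" using length_add_eq[OF sP x(1)] x(2) by simp
  have "length (comp g X2) \<le> length (s +\<^sub>P x)"
  proof -
    obtain m where m: "m \<in> carrier P" "s +\<^sub>P x = comp g X2 *\<^sub>P m" using x(3) by (auto simp: factor_def)
    have "m \<noteq> []" "comp g X2 \<noteq> []" using l m mult_eq_Nil_iff[of "comp g X2" m] g by auto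
    then show ?thesis using m(2) length_mult[of "comp g X2" m] m(1) g by (cases m) auto
  qed
  moreover have "length (comp g X2) = 2 * k + 1" using length_comp_X2[OF g(1)] k(1) by simp
  ultimately show False using l ls r(1) k(2) by auto
qed

lemma is_square_times_square:
  assumes "x \<in> carrier R" "u \<in> carrier R" "u \<noteq> \<zero>"
  shows "is_square (x \<otimes> (u \<otimes> u)) \<longleftrightarrow> is_square x"
proof
  assume "is_square x"
  then obtain y where "y \<in> carrier R" "x = y \<otimes> y" unfolding is_square_def by auto
  moreover have "y \<otimes> y \<otimes> (u \<otimes> u) = (y \<otimes> u) \<otimes> (y \<otimes> u)" if "y \<in> carrier R" for y
    using that assms(2) by algebra
  ultimately show "is_square (x \<otimes> (u \<otimes> u))" unfolding is_square_def using assms by blast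
next
  assume "is_square (x \<otimes> (u \<otimes> u))"
  then obtain y where y: "y \<in> carrier R" "x \<otimes> (u \<otimes> u) = y \<otimes> y" unfolding is_square_def by auto
  have i: "inv u \<in> carrier R" "inv u \<otimes> u = \<one>" using assms by (auto simp: field_Units)
  have "x = x \<otimes> (inv u \<otimes> u) \<otimes> (inv u \<otimes> u)" using assms i by simp
  also have "\<dots> = (x \<otimes> (u \<otimes> u)) \<otimes> (inv u \<otimes> inv u)" using assms(1,2) i(1) by algebra
  also have "\<dots> = (y \<otimes> inv u) \<otimes> (y \<otimes> inv u)" unfolding y(2) using y(1) i(1) by algebra
  finally show "is_square x" unfolding is_square_def using y i by blast
qed

lemma quadratic_list:
  assumes "a \<in> carrier R" "b \<in> carrier R" "c \<in> carrier R" "a \<noteq> \<zero>"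
  shows "[a, b, c] \<in> carrier P"
    "[a, b, c] = cst a *\<^sub>P (X *\<^sub>P X) +\<^sub>P (cst b *\<^sub>P X +\<^sub>P cst c)"
proof -
  show P: "[a, b, c] \<in> carrier P"
    using assms by (simp add: univ_poly_carrier[symmetric] polynomial_def)
  have "[a, b, c] = ring.eval P (map cst [a, b, c]) X" by (rule eval_rewrite[OF sr P])
  also have "\<dots> = cst a *\<^sub>P (X *\<^sub>P X) +\<^sub>P (cst b *\<^sub>P X +\<^sub>P cst c)"
    using assms by (simp add: numeral_2_eq_2)
  finally show "[a, b, c] = cst a *\<^sub>P (X *\<^sub>P X) +\<^sub>P (cst b *\<^sub>P X +\<^sub>P cst c)" .
qed

section \<open>Dynamically irreducible quadratic polynomials\<close>

definition quad :: "'a \<Rightarrow> 'a \<Rightarrow> 'a \<Rightarrow> 'a list" where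
  "quad a d t = [a, \<ominus> (t \<oplus> t), (t \<otimes> t \<oplus> t \<oplus> d) \<otimes> inv a]"

text \<open>For \<open>f = quad a d t\<close> we have \<open>a f(x/a) = (x - t)^2 + t + d\<close>, so the critical orbit of \<open>f\<close>, scaled
  by \<open>a\<close>, is \<open>t + orb d n\<close>.\<close>

lemma dynamically_irreducible_quad:
  assumes a: "a \<in> carrier R" "a \<noteq> \<zero>" and d: "d \<in> carrier R" and t: "t \<in> carrier R"
  shows "dynamically_irreducible R (quad a d t) \<longleftrightarrow> good d t"
proof -
  define ia where "ia = inv a"
  have ia: "ia \<in> carrier R" "ia \<otimes> a = \<one>" "a \<otimes> ia = \<one>" using a by (auto simp: ia_def field_Units)
  define f where "f = quad a d t"
  define c where "c = t \<otimes> ia"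
  define m where "m = (t \<oplus> d) \<otimes> ia"
  have c: "c \<in> carrier R" and m: "m \<in> carrier R" using t d ia by (auto simp: c_def m_def)
  define b where "b = \<ominus> (t \<oplus> t)"
  define e where "e = (t \<otimes> t \<oplus> t \<oplus> d) \<otimes> ia"
  have b: "b \<in> carrier R" and e: "e \<in> carrier R" using t d ia by (auto simp: b_def e_def)
  have f: "f \<in> carrier P" "f = cst a *\<^sub>P (X *\<^sub>P X) +\<^sub>P (cst b *\<^sub>P X +\<^sub>P cst e)"
    unfolding f_def quad_def ia_def[symmetric] b_def[symmetric] e_def[symmetric]
    using quadratic_list[OF a(1) b e a(2)] by auto
  \<comment> \<open>Factorization of f as \<open>l1\<close> after X^2 after \<open>l2\<close>:
    \<open>c\<close> = t / a is the critical point of f and \<open>m\<close> = (t + d) / a the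
    critical value.\<close>
  define l1 where "l1 = cst a *\<^sub>P X +\<^sub>P cst m"
  define l2 where "l2 = cst \<one> *\<^sub>P X +\<^sub>P cst (\<ominus> c)"
  have l: "l1 \<in> carrier P" "l2 \<in> carrier P" using a m c by (auto simp: l1_def l2_def)
  have f_comp: "f = comp l1 (comp X2 l2)"
  proof -
    have "cst b = -\<^sub>P (cst a *\<^sub>P cst c) +\<^sub>P -\<^sub>P (cst a *\<^sub>P cst c)"
    proof -
      have "a \<otimes> c = t"
      proof -
        have "a \<otimes> c = t \<otimes> (a \<otimes> ia)" unfolding c_def using a(1) ia(1) t by algebra
        then show ?thesis using ia t by simp
      qed
      then have "cst a *\<^sub>P cst c = cst t" using a c by (simp add: cst_mult[symmetric])
      moreover have "b = \<ominus> t \<oplus> \<ominus> t" unfolding b_def using t by algebra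
      ultimately show ?thesis using t by (simp add: cst_add cst_minus)
    qed
    moreover have "cst e = cst a *\<^sub>P (cst c *\<^sub>P cst c) +\<^sub>P cst m"
    proof -
      have "a \<otimes> (c \<otimes> c) \<oplus> m = (t \<otimes> t \<otimes> ia) \<otimes> (a \<otimes> ia) \<oplus> (t \<oplus> d) \<otimes> ia"
        unfolding c_def m_def using a(1) ia(1) t d by algebra
      also have "\<dots> = (t \<otimes> t \<otimes> ia) \<oplus> (t \<oplus> d) \<otimes> ia" using ia t by simp
      also have "\<dots> = e" unfolding e_def using ia(1) t d by algebra
      finally have "e = a \<otimes> (c \<otimes> c) \<oplus> m" ..
      then show ?thesis using a c m by (simp add: cst_add cst_mult)
    qed
    moreover have "A *\<^sub>P (x *\<^sub>P x) +\<^sub>P ((-\<^sub>P (A *\<^sub>P C) +\<^sub>P -\<^sub>P (A *\<^sub>P C)) *\<^sub>P x +\<^sub>P (A *\<^sub>P (C *\<^sub>P C) +\<^sub>P M)) =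
        A *\<^sub>P ((x +\<^sub>P -\<^sub>P C) *\<^sub>P (x +\<^sub>P -\<^sub>P C)) +\<^sub>P M"
      if "A \<in> carrier P" "x \<in> carrier P" "C \<in> carrier P" "M \<in> carrier P" for A x C M
      using that by algebra
    note this[OF cst_closed[OF a(1)] X_closed cst_closed[OF c] cst_closed[OF m]]
    moreover have "comp l1 (comp X2 l2) = cst a *\<^sub>P ((X +\<^sub>P -\<^sub>P cst c) *\<^sub>P (X +\<^sub>P -\<^sub>P cst c)) +\<^sub>P cst m"
      unfolding l1_def l2_def using a m c by (simp add: cst_minus cst_one)
    ultimately show ?thesis using f(2) by simp
  qed
  let ?it = "poly_iterate R f"
  have it: "?it n \<in> carrier P" for n by (induction n) (use f in auto)
  \<comment> \<open>The definition adds f on the outside, whereas the criterion for g(X^2) needs the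
    innermost f to be split off.\<close>
  have it_Suc: "?it (Suc n) = comp (?it n) f" for n
  proof (induction n)
    case 0
    then show ?case using f by (simp add: comp_X_right)
  next
    case (Suc n)
    have "?it (Suc (Suc n)) = comp f (comp (?it n) f)" using Suc by simp
    also have "\<dots> = comp (?it (Suc n)) f" using comp_assoc[OF f(1) it f(1)] by simp
    finally show ?case .
  qed
  \<comment> \<open>Iterate n + 1 is \<open>G n\<close> after X^2 after \<open>l2\<close>, so its
    irreducibility is that of \<open>G n\<close> with X^2 substituted. The value of
    \<open>G n\<close> at 0 is the n-th image of the critical value.\<close>
  define G where "G n = comp (?it n) l1" for n
  have G: "G n \<in> carrier P" for n using it l by (simp add: G_def)
  have G_Suc: "G (Suc n) = cst a *\<^sub>P (G n *\<^sub>P G n) +\<^sub>P (cst b *\<^sub>P G n +\<^sub>P cst e)" for n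
  proof -
    have "G (Suc n) = comp f (G n)" unfolding G_def using comp_assoc[OF f(1) it l(1)] by simp
    then show ?thesis unfolding f(2) using a b e G by simp
  qed
  have ca: "cst a \<noteq> []" "length (cst a) = 1" "lead_coeff (cst a) = a" using a by (auto simp: cst_list)
  \<comment> \<open>Only the class of the leading coefficient modulo squares matters; it is that of
    \<open>a\<close> throughout.\<close>
  have G_lead: "length (G n) = 2 ^ n + 1 \<and> (\<exists>u\<in>carrier R. u \<noteq> \<zero> \<and> lead_coeff (G n) = a \<otimes> (u \<otimes> u))" for n
  proof (induction n)
    case 0
    have "G 0 = l1" using l by (simp add: G_def)
    moreover have lX: "length (cst a *\<^sub>P X) = 2"
      using length_mult[OF cst_closed[OF a(1)] X_closed ca(1)] ca(2) by (simp add: X_list)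
    moreover have "lead_coeff (cst a *\<^sub>P X) = a"
      using lead_coeff_mult[OF cst_closed[OF a(1)] X_closed ca(1)] ca(3) a by (simp add: X_list)
    ultimately have "length (G 0) = 2" "lead_coeff (G 0) = a"
      unfolding l1_def using length_add_eq[of "cst a *\<^sub>P X" "cst m"] lead_coeff_add[of "cst a *\<^sub>P X" "cst m"]
        length_cst[of m] a m by auto
    then show ?case using a by (intro conjI bexI[of _ \<one>]) auto
  next
    case (Suc n)
    then obtain u where u: "u \<in> carrier R" "u \<noteq> \<zero>" "lead_coeff (G n) = a \<otimes> (u \<otimes> u)" by auto
    have len: "length (G n) = 2 ^ n + 1" using Suc by simp
    have nz: "G n \<noteq> []" using len by auto
    let ?A = "cst a *\<^sub>P (G n *\<^sub>P G n)" and ?B = "cst b *\<^sub>P G n +\<^sub>P cst e"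
    have GG: "G n *\<^sub>P G n \<noteq> []" "G n *\<^sub>P G n \<in> carrier P" "length (G n *\<^sub>P G n) = 2 * 2 ^ n + 1"
      using mult_eq_Nil_iff[OF G G] nz length_mult[OF G G nz nz] len G by auto
    have A: "?A \<in> carrier P" "length ?A = 2 * 2 ^ n + 1"
      using length_mult[OF cst_closed[OF a(1)] GG(2) ca(1) GG(1)] ca(2) GG a by auto
    have B: "?B \<in> carrier P" using b e G by simp
    have "length (cst b *\<^sub>P G n) \<le> 1 + (2 ^ n + 1) - 1"
      using length_mult_le[OF cst_closed[OF b] G length_cst] len by simp
    then have "length ?B \<le> 2 ^ n + 1"
      using length_cst[of e] by (intro length_add_le) (auto intro: order_trans)
    moreover have "(2::nat) ^ n \<ge> 1" by simp
    ultimately have lt: "length ?B < length ?A" using A(2) by linarith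
    have "length (G (Suc n)) = 2 ^ Suc n + 1"
      unfolding G_Suc using length_add_eq[OF A(1) B] lt A(2) by simp
    moreover have "lead_coeff (G (Suc n)) = a \<otimes> (lead_coeff (G n) \<otimes> lead_coeff (G n))"
      unfolding G_Suc using lead_coeff_add[OF A(1) B lt] lead_coeff_mult[OF cst_closed[OF a(1)] GG(2) ca(1) GG(1)]
        lead_coeff_mult[OF G G nz nz] ca(3) by simp
    moreover have "a \<otimes> (u \<otimes> u) \<in> carrier R" "a \<otimes> (u \<otimes> u) \<noteq> \<zero>" using a u integral_iff by auto
    ultimately show ?case using u(3) by (intro conjI bexI[of _ "a \<otimes> (u \<otimes> u)"]) auto
  qed
  have G_0: "a \<otimes> eval (G n) \<zero> = t \<oplus> orb d n" for n
  proof (induction n)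
    case 0
    have "G 0 = l1" using l by (simp add: G_def)
    then have "a \<otimes> eval (G 0) \<zero> = a \<otimes> m" using a m by (simp add: l1_def)
    also have "\<dots> = (t \<oplus> d) \<otimes> (a \<otimes> ia)" unfolding m_def using t d a(1) ia(1) by algebra
    finally show ?case using t d ia by simp
  next
    case (Suc n)
    define w where "w = eval (G n) \<zero>"
    have w: "w \<in> carrier R" using G by (simp add: w_def)
    define k where "k = orb d n"
    have k: "k \<in> carrier R" "a \<otimes> w = t \<oplus> k" using Suc d by (auto simp: w_def k_def)
    have "a \<otimes> eval (G (Suc n)) \<zero> = a \<otimes> (a \<otimes> (w \<otimes> w) \<oplus> (b \<otimes> w \<oplus> e))"
      unfolding G_Suc using G a b e by (simp add: w_def)
    also have "\<dots> = (a \<otimes> w) \<otimes> (a \<otimes> w) \<oplus> b \<otimes> (a \<otimes> w) \<oplus> (t \<otimes> t \<oplus> t \<oplus> d) \<otimes> (a \<otimes> ia)"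
      unfolding e_def using a(1) w b t d ia(1) by algebra
    also have "\<dots> = t \<oplus> (k \<otimes> k \<oplus> d)"
      unfolding k(2) ia(3) b_def using k(1) t d by algebra
    finally show ?case by (simp add: k_def)
  qed
  have X_irr: "pirreducible (carrier R) (?it 0)"
    using degree_one_imp_pirreducible[OF sf, of X] X_closed by (simp add: X_list)
  have G_irr: "pirreducible (carrier R) (G n) \<longleftrightarrow> pirreducible (carrier R) (?it n)" for n
    unfolding G_def l1_def by (rule comp_linear[OF a m it])
  have it_irr: "pirreducible (carrier R) (?it (Suc n)) \<longleftrightarrow> pirreducible (carrier R) (comp (G n) X2)" for n
  proof -
    have X2: "X2 \<in> carrier P" by simp
    have "comp (comp (G n) X2) l2 = comp (G n) (comp X2 l2)" by (rule comp_assoc[OF G X2 l(2)])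
    also have "\<dots> = comp (?it n) (comp l1 (comp X2 l2))"
      unfolding G_def by (rule comp_assoc[OF it l(1) comp_closed[OF X2 l(2)]])
    finally have "comp (comp (G n) X2) l2 = comp (?it n) f" by (simp only: f_comp[symmetric])
    moreover have "pirreducible (carrier R) (comp (comp (G n) X2) l2) \<longleftrightarrow> pirreducible (carrier R) (comp (G n) X2)"
      unfolding l2_def using comp_linear[of \<one> "\<ominus> c" "comp (G n) X2"] c G by simp
    ultimately show ?thesis unfolding it_Suc by simp
  qed
  have crit: "is_square ((\<ominus> \<one>) [^] (length (G n) - 1) \<otimes> (lead_coeff (G n) \<otimes> eval (G n) \<zero>)) \<longleftrightarrow>
      is_square (if n = 0 then \<ominus> (t \<oplus> d) else t \<oplus> orb d n)" for n
  proof -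
    obtain u where u: "u \<in> carrier R" "u \<noteq> \<zero>" "lead_coeff (G n) = a \<otimes> (u \<otimes> u)" using G_lead by blast
    define s where "s = (\<ominus> \<one>) [^] (length (G n) - 1)"
    have s: "s \<in> carrier R" "s = (if n = 0 then \<ominus> \<one> else \<one>)"
    proof -
      show "s = (if n = 0 then \<ominus> \<one> else \<one>)"
      proof (cases n)
        case 0
        then show ?thesis using G_lead[of n] by (simp add: s_def)
      next
        case (Suc k)
        have "s = ((\<ominus> \<one>) [^] (2::nat)) [^] ((2::nat) ^ k)"
          using G_lead[of n] Suc by (simp add: s_def nat_pow_pow)
        moreover have "(\<ominus> \<one>) [^] (2::nat) = \<one>" by (simp add: numeral_2_eq_2 l_minus)
        ultimately show ?thesis using Suc by simp
      qed
    qed (simp add: s_def)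
    define w where "w = eval (G n) \<zero>"
    have w: "w \<in> carrier R" using G by (simp add: w_def)
    have "s \<otimes> (a \<otimes> (u \<otimes> u) \<otimes> w) = (s \<otimes> (a \<otimes> w)) \<otimes> (u \<otimes> u)" using s(1) a(1) u(1) w by algebra
    then have "is_square (s \<otimes> (lead_coeff (G n) \<otimes> w)) \<longleftrightarrow> is_square (s \<otimes> (a \<otimes> w))"
      using is_square_times_square[of "s \<otimes> (a \<otimes> w)" u] s(1) a(1) u w by simp
    also have "a \<otimes> w = t \<oplus> orb d n" unfolding w_def by (rule G_0)
    also have "s \<otimes> (t \<oplus> orb d n) = (if n = 0 then \<ominus> (t \<oplus> d) else t \<oplus> orb d n)"
      using s(2) t d by (simp add: l_minus)
    finally show ?thesis unfolding s_def w_def .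
  qed
  \<comment> \<open>The criterion presupposes that the previous iterate is irreducible; the
    condition for all n follows by induction from the zeroth iterate X.\<close>
  have step: "pirreducible (carrier R) (?it (Suc n)) \<longleftrightarrow>
      \<not> is_square (if n = 0 then \<ominus> (t \<oplus> d) else t \<oplus> orb d n)" if "pirreducible (carrier R) (?it n)" for n
    using irreducible_comp_X2[OF G, of n] reducible_comp_X2[OF G, of n] that
    unfolding it_irr crit G_irr by blast
  have "(\<forall>n\<ge>1. pirreducible (carrier R) (?it n)) \<longleftrightarrow>
      (\<forall>n. \<not> is_square (if n = 0 then \<ominus> (t \<oplus> d) else t \<oplus> orb d n))"
  proof
    assume irr: "\<forall>n\<ge>1. pirreducible (carrier R) (?it n)"
    then have "pirreducible (carrier R) (?it n)" for n using X_irr by (cases n) auto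
    then show "\<forall>n. \<not> is_square (if n = 0 then \<ominus> (t \<oplus> d) else t \<oplus> orb d n)" using step by blast
  next
    assume ns: "\<forall>n. \<not> is_square (if n = 0 then \<ominus> (t \<oplus> d) else t \<oplus> orb d n)"
    have "pirreducible (carrier R) (?it n)" for n
    proof (induction n)
      case (Suc n)
      then show ?case using step ns by blast
    qed (rule X_irr)
    then show "\<forall>n\<ge>1. pirreducible (carrier R) (?it n)" by blast
  qed
  also have "\<dots> \<longleftrightarrow> good d t"
    unfolding good_def by (auto simp: Suc_le_eq split: if_splits)
  finally show ?thesis using f(1) unfolding dynamically_irreducible_def f_def[symmetric] by blast
qed

text \<open>Every quadratic has this form: comparing coefficients gives t = -b / 2, possible since q
  is odd, and d = a c - t^2 - t.\<close>

lemma DI_set_eq: "DI_set R = (\<lambda>(a, d, t). quad a d t) ` ((carrier R - {\<zero>}) \<times> good_pairs)"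
proof (intro equalityI subsetI)
  fix p assume "p \<in> DI_set R"
  then obtain a b c where p: "p = [a, b, c]" "a \<in> carrier R" "b \<in> carrier R" "c \<in> carrier R" "a \<noteq> \<zero>"
    "dynamically_irreducible R [a, b, c]" unfolding DI_set_def by auto
  define i2 where "i2 = inv (\<one> \<oplus> \<one>)"
  have i2: "i2 \<in> carrier R" "i2 \<otimes> (\<one> \<oplus> \<one>) = \<one>" using two_nonzero by (auto simp: i2_def field_Units)
  have ia: "inv a \<in> carrier R" "a \<otimes> inv a = \<one>" using p by (auto simp: field_Units)
  define t where "t = \<ominus> (i2 \<otimes> b)"
  define d where "d = a \<otimes> c \<ominus> t \<otimes> t \<ominus> t"
  have t: "t \<in> carrier R" and d: "d \<in> carrier R" using i2 p by (auto simp: t_def d_def)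
  have "\<ominus> (t \<oplus> t) = b"
  proof -
    have "\<ominus> (t \<oplus> t) = (i2 \<otimes> (\<one> \<oplus> \<one>)) \<otimes> b" unfolding t_def using i2(1) p(3) by algebra
    then show ?thesis using i2 p by simp
  qed
  moreover have "(t \<otimes> t \<oplus> t \<oplus> d) \<otimes> inv a = c"
  proof -
    have "(t \<otimes> t \<oplus> t \<oplus> d) \<otimes> inv a = (a \<otimes> inv a) \<otimes> c" unfolding d_def using t p(2,4) ia(1) by algebra
    then show ?thesis using ia p by simp
  qed
  ultimately have q: "p = quad a d t" using p by (simp add: quad_def)
  then have "good d t" using dynamically_irreducible_quad[OF p(2,5) d t] p by simp
  then show "p \<in> (\<lambda>(a, d, t). quad a d t) ` ((carrier R - {\<zero>}) \<times> good_pairs)"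
    using q p d t by (intro image_eqI[of _ _ "(a, d, t)"]) (auto simp: good_pairs_def)
next
  fix p assume "p \<in> (\<lambda>(a, d, t). quad a d t) ` ((carrier R - {\<zero>}) \<times> good_pairs)"
  then obtain a d t where p: "p = quad a d t" "a \<in> carrier R" "a \<noteq> \<zero>" "d \<in> carrier R" "t \<in> carrier R" "good d t"
    by (auto simp: good_pairs_def)
  have "dynamically_irreducible R p" using dynamically_irreducible_quad[OF p(2-5)] p by simp
  moreover have "inv a \<in> carrier R" using p by (auto simp: field_Units)
  ultimately show "p \<in> DI_set R"
    unfolding DI_set_def using p by (auto simp: quad_def)
qed

lemma inj_on_quad: "inj_on (\<lambda>(a, d, t). quad a d t) ((carrier R - {\<zero>}) \<times> good_pairs)"
proof (rule inj_onI)
  fix x y assume xy: "x \<in> (carrier R - {\<zero>}) \<times> good_pairs" "y \<in> (carrier R - {\<zero>}) \<times> good_pairs"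
    "(case x of (a, d, t) \<Rightarrow> quad a d t) = (case y of (a, d, t) \<Rightarrow> quad a d t)"
  obtain a d t a' d' t' where e0: "x = (a, d, t)" "y = (a', d', t')" by (metis surj_pair)
  then have a: "a \<in> carrier R" "a \<noteq> \<zero>" "(d, t) \<in> good_pairs" "(d', t') \<in> good_pairs"
    and eq: "quad a d t = quad a' d' t'" using xy by auto
  have c: "d \<in> carrier R" "t \<in> carrier R" "d' \<in> carrier R" "t' \<in> carrier R" using a by (auto simp: good_pairs_def)
  have e: "a = a'" "\<ominus> (t \<oplus> t) = \<ominus> (t' \<oplus> t')" "(t \<otimes> t \<oplus> t \<oplus> d) \<otimes> inv a = (t' \<otimes> t' \<oplus> t' \<oplus> d') \<otimes> inv a"
    using eq by (auto simp: quad_def)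
  have ia: "inv a \<in> carrier R" "inv a \<otimes> a = \<one>" "inv a \<in> Units R"
    using a Units_inv_Units[of a] by (auto simp: field_Units)
  have "t \<oplus> t = t' \<oplus> t'" using e(2) c by (metis a_closed minus_minus)
  moreover have "(\<one> \<oplus> \<one>) \<otimes> (t \<ominus> t') = (t \<oplus> t) \<ominus> (t' \<oplus> t')" using c by algebra
  ultimately have "(\<one> \<oplus> \<one>) \<otimes> (t \<ominus> t') = \<zero>" using c by simp
  then have tt: "t = t'" using two_nonzero c integral_iff by simp
  have k: "t' \<otimes> t' \<oplus> t' \<oplus> d \<in> carrier R" "t' \<otimes> t' \<oplus> t' \<oplus> d' \<in> carrier R" using c by auto
  have "x = (x \<otimes> inv a) \<otimes> a" if "x \<in> carrier R" for x using that ia a by (simp add: m_assoc)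
  then have "t' \<otimes> t' \<oplus> t' \<oplus> d = t' \<otimes> t' \<oplus> t' \<oplus> d'" using e(3) k unfolding tt by metis
  then have "d = d'" using c by simp
  then show "x = y" using e(1) tt e0 by simp
qed

text \<open>\<open>good\<close> does not involve \<open>a\<close>, so the program can count pairs
  and multiply by q - 1.\<close>

lemma card_DI_set: "card (DI_set R) = card good_pairs * (order R - 1)"
  unfolding DI_set_eq card_image[OF inj_on_quad] card_cartesian_product card_nonzero by simp

end

section \<open>The running time of programs\<close>

text \<open>Clock and earlier output are quantified universally because the effect of a program does
  not depend on them; this makes the relation composable. The time stamps on the tape are
  forgotten.\<close>

definition runs :: "nat ring \<Rightarrow> com \<Rightarrow> (nat \<Rightarrow> nat) \<Rightarrow> (nat \<Rightarrow> nat) \<Rightarrow> nat \<Rightarrow> nat list \<Rightarrow> bool" where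
  "runs R c m m' n w \<longleftrightarrow> (\<forall>k tp. \<exists>k' w'.
     exec R c \<lparr>mem = m, clock = k, tape = tp\<rparr> \<lparr>mem = m', clock = k', tape = tp @ w'\<rparr> \<and>
     map fst w' = w \<and> k' \<le> k + n)"

lemma runsI:
  assumes "\<And>k tp. exec R c \<lparr>mem = m, clock = k, tape = tp\<rparr> \<lparr>mem = m', clock = k + f, tape = tp @ g k\<rparr>"
    and "\<And>k. map fst (g k) = w" and "f \<le> n"
  shows "runs R c m m' n w"
  unfolding runs_def using assms by (metis add_left_mono)

lemma runs_mono: "runs R c m m' n w \<Longrightarrow> n \<le> n' \<Longrightarrow> runs R c m m' n' w"
  unfolding runs_def by (meson add_left_mono order_trans)

lemma runs_Seq:
  assumes "runs R c m m1 n1 w1" "runs R d m1 m2 n2 w2"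
  shows "runs R (Seq c d) m m2 (n1 + n2) (w1 @ w2)"
  unfolding runs_def
proof (intro allI)
  fix k tp
  obtain k1 v1 where 1: "exec R c \<lparr>mem = m, clock = k, tape = tp\<rparr> \<lparr>mem = m1, clock = k1, tape = tp @ v1\<rparr>"
    "map fst v1 = w1" "k1 \<le> k + n1" using assms(1) unfolding runs_def by blast
  obtain k2 v2 where 2: "exec R d \<lparr>mem = m1, clock = k1, tape = tp @ v1\<rparr> \<lparr>mem = m2, clock = k2, tape = (tp @ v1) @ v2\<rparr>"
    "map fst v2 = w2" "k2 \<le> k1 + n2" using assms(2) unfolding runs_def by blast
  have "exec R (Seq c d) \<lparr>mem = m, clock = k, tape = tp\<rparr> \<lparr>mem = m2, clock = k2, tape = tp @ (v1 @ v2)\<rparr>"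
    using exec.Seq[OF 1(1) 2(1)] by simp
  then show "\<exists>k' w'. exec R (Seq c d) \<lparr>mem = m, clock = k, tape = tp\<rparr> \<lparr>mem = m2, clock = k', tape = tp @ w'\<rparr> \<and>
     map fst w' = w1 @ w2 \<and> k' \<le> k + (n1 + n2)"
    using 1 2 by (intro exI[of _ k2] exI[of _ "v1 @ v2"]) auto
qed

text \<open>One unit bounds the cost of an instruction all of whose operands and results are at most \<open>B\<close>.\<close>

definition unit_cost :: "nat \<Rightarrow> nat" where
  "unit_cost B = 2 + 3 * bits B"

lemma bits_le: "x \<le> B \<Longrightarrow> bits x \<le> bits B"
  by (rule floorlog_mono)

section \<open>Costs of single instructions and control structures\<close>

lemma runs_atomic:
  assumes "\<And>k tp. exec R c \<lparr>mem = m, clock = k, tape = tp\<rparr> \<lparr>mem = m', clock = k + f, tape = tp\<rparr>" "f \<le> n"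
  shows "runs R c m m' n []"
  using assms by (intro runsI[where g = "\<lambda>_. []" and f = f]) auto

lemma runs_Const: "v \<le> B \<Longrightarrow> runs R (Const r v) m (m(r := v)) (unit_cost B) []"
proof (rule runs_atomic)
  show "exec R (Const r v) \<lparr>mem = m, clock = k, tape = tp\<rparr>
      \<lparr>mem = m(r := v), clock = k + (1 + bits v), tape = tp\<rparr>" for k tp
    using exec.Const[of R r v "\<lparr>mem = m, clock = k, tape = tp\<rparr>"] by (simp add: assign_def tick_def)
  show "v \<le> B \<Longrightarrow> 1 + bits v \<le> unit_cost B" using bits_le[of v B] by (simp add: unit_cost_def)
qed

lemma runs_FZero: "\<zero>\<^bsub>R\<^esub> \<le> B \<Longrightarrow> runs R (FZero r) m (m(r := \<zero>\<^bsub>R\<^esub>)) (unit_cost B) []"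
proof (rule runs_atomic)
  show "exec R (FZero r) \<lparr>mem = m, clock = k, tape = tp\<rparr>
      \<lparr>mem = m(r := \<zero>\<^bsub>R\<^esub>), clock = k + (1 + bits \<zero>\<^bsub>R\<^esub>), tape = tp\<rparr>" for k tp
    using exec.FZero[of R r "\<lparr>mem = m, clock = k, tape = tp\<rparr>"] by (simp add: assign_def tick_def)
  show "\<zero>\<^bsub>R\<^esub> \<le> B \<Longrightarrow> 1 + bits \<zero>\<^bsub>R\<^esub> \<le> unit_cost B" using bits_le[of "\<zero>\<^bsub>R\<^esub>" B] by (simp add: unit_cost_def)
qed

lemma runs_Load:
  assumes "m p \<le> B" "m (m p) \<le> B"
  shows "runs R (Load r p) m (m(r := m (m p))) (unit_cost B) []"
proof (rule runs_atomic)
  show "exec R (Load r p) \<lparr>mem = m, clock = k, tape = tp\<rparr>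
      \<lparr>mem = m(r := m (m p)), clock = k + (2 + bits (m (m p)) + bits (m p)), tape = tp\<rparr>" for k tp
    using exec.Load[of R r p "\<lparr>mem = m, clock = k, tape = tp\<rparr>"] by (simp add: assign_def tick_def add.assoc)
  show "2 + bits (m (m p)) + bits (m p) \<le> unit_cost B"
    using bits_le[OF assms(1)] bits_le[OF assms(2)] by (simp add: unit_cost_def)
qed

lemma runs_Store:
  assumes "m p \<le> B" "m r \<le> B"
  shows "runs R (Store p r) m (m(m p := m r)) (unit_cost B) []"
proof (rule runs_atomic)
  show "exec R (Store p r) \<lparr>mem = m, clock = k, tape = tp\<rparr>
      \<lparr>mem = m(m p := m r), clock = k + (2 + bits (m r) + bits (m p)), tape = tp\<rparr>" for k tp
    using exec.Store[of R p r "\<lparr>mem = m, clock = k, tape = tp\<rparr>"] by (simp add: assign_def tick_def add.assoc)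
  show "2 + bits (m r) + bits (m p) \<le> unit_cost B"
    using bits_le[OF assms(1)] bits_le[OF assms(2)] by (simp add: unit_cost_def)
qed

lemma runs_NatOp:
  assumes "m x \<le> B" "m y \<le> B" "nat_op_val f (m x) (m y) \<le> B"
  shows "runs R (NatOp f r x y) m (m(r := nat_op_val f (m x) (m y))) (unit_cost B) []"
proof (rule runs_atomic)
  show "exec R (NatOp f r x y) \<lparr>mem = m, clock = k, tape = tp\<rparr>
      \<lparr>mem = m(r := nat_op_val f (m x) (m y)),
       clock = k + (2 + bits (nat_op_val f (m x) (m y)) + (bits (m x) + bits (m y))), tape = tp\<rparr>" for k tp
    using exec.NatOp[of R f r x y "\<lparr>mem = m, clock = k, tape = tp\<rparr>"] by (simp add: assign_def tick_def add.assoc)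
  show "2 + bits (nat_op_val f (m x) (m y)) + (bits (m x) + bits (m y)) \<le> unit_cost B"
    using bits_le[OF assms(1)] bits_le[OF assms(2)] bits_le[OF assms(3)] by (simp add: unit_cost_def)
qed

lemma runs_FieldOp:
  assumes "m x \<le> B" "m y \<le> B" "field_op_val R f (m x) (m y) \<le> B"
  shows "runs R (FieldOp f r x y) m (m(r := field_op_val R f (m x) (m y))) (unit_cost B) []"
proof (rule runs_atomic)
  show "exec R (FieldOp f r x y) \<lparr>mem = m, clock = k, tape = tp\<rparr>
      \<lparr>mem = m(r := field_op_val R f (m x) (m y)),
       clock = k + (2 + bits (field_op_val R f (m x) (m y)) + (bits (m x) + bits (m y))), tape = tp\<rparr>" for k tp
    using exec.FieldOp[of R f r x y "\<lparr>mem = m, clock = k, tape = tp\<rparr>"] by (simp add: assign_def tick_def add.assoc)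
  show "2 + bits (field_op_val R f (m x) (m y)) + (bits (m x) + bits (m y)) \<le> unit_cost B"
    using bits_le[OF assms(1)] bits_le[OF assms(2)] bits_le[OF assms(3)] by (simp add: unit_cost_def)
qed

lemma runs_Emit:
  assumes "m r \<le> B"
  shows "runs R (Emit r) m m (unit_cost B) [m r]"
proof (rule runsI)
  show "exec R (Emit r) \<lparr>mem = m, clock = k, tape = tp\<rparr>
      \<lparr>mem = m, clock = k + (1 + bits (m r)), tape = tp @ [(m r, k + (1 + bits (m r)))]\<rparr>" for k tp
    using exec.Emit[of R r "\<lparr>mem = m, clock = k, tape = tp\<rparr>"] by (simp add: append_tape_def tick_def)
  show "1 + bits (m r) \<le> unit_cost B" using bits_le[OF assms] by (simp add: unit_cost_def)
qed auto

lemma runs_If: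
  assumes "m r \<le> B" "m r \<noteq> 0 \<Longrightarrow> runs R c m m' n w" "m r = 0 \<Longrightarrow> runs R d m m' n w"
  shows "runs R (If r c d) m m' (unit_cost B + n) w"
  unfolding runs_def
proof (intro allI)
  fix k tp
  have b: "1 + bits (m r) \<le> unit_cost B" using bits_le[OF assms(1)] by (simp add: unit_cost_def)
  let ?c = "if m r = 0 then d else c"
  have "runs R ?c m m' n w" using assms(2,3) by simp
  then obtain k' w' where e: "exec R ?c \<lparr>mem = m, clock = k + 1 + bits (m r), tape = tp\<rparr> \<lparr>mem = m', clock = k', tape = tp @ w'\<rparr>"
    "map fst w' = w" "k' \<le> k + 1 + bits (m r) + n" unfolding runs_def by blast
  have "exec R (If r c d) \<lparr>mem = m, clock = k, tape = tp\<rparr> \<lparr>mem = m', clock = k', tape = tp @ w'\<rparr>"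
  proof (cases "m r = 0")
    case True
    then show ?thesis using e(1) by (intro exec.IfFalse) (simp_all add: tick_def)
  next
    case False
    then show ?thesis using e(1) by (intro exec.IfTrue) (simp_all add: tick_def)
  qed
  then show "\<exists>k' w'. exec R (If r c d) \<lparr>mem = m, clock = k, tape = tp\<rparr> \<lparr>mem = m', clock = k', tape = tp @ w'\<rparr> \<and>
      map fst w' = w \<and> k' \<le> k + (unit_cost B + n)"
    using e b by (intro exI[of _ k'] exI[of _ w']) auto
qed

lemma runs_WhileFalse:
  assumes "m r = 0"
  shows "runs R (While r c) m m (unit_cost B) []"
proof (rule runs_atomic)
  show "exec R (While r c) \<lparr>mem = m, clock = k, tape = tp\<rparr> \<lparr>mem = m, clock = k + (1 + bits 0), tape = tp\<rparr>" for k tp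
    using exec.WhileFalse[of "\<lparr>mem = m, clock = k, tape = tp\<rparr>" r R c] assms by (simp add: tick_def)
  show "1 + bits 0 \<le> unit_cost B" by (simp add: unit_cost_def floorlog_def)
qed

lemma runs_WhileTrue:
  assumes "m r \<noteq> 0" "m r \<le> B" "runs R c m m1 n1 w1" "runs R (While r c) m1 m2 n2 w2"
  shows "runs R (While r c) m m2 (n1 + unit_cost B + n2) (w1 @ w2)"
  unfolding runs_def
proof (intro allI)
  fix k tp
  have b: "1 + bits (m r) \<le> unit_cost B" using bits_le[OF assms(2)] by (simp add: unit_cost_def)
  obtain k1 v1 where 1: "exec R c \<lparr>mem = m, clock = k + 1 + bits (m r), tape = tp\<rparr> \<lparr>mem = m1, clock = k1, tape = tp @ v1\<rparr>"
    "map fst v1 = w1" "k1 \<le> k + 1 + bits (m r) + n1" using assms(3) unfolding runs_def by blast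
  obtain k2 v2 where 2: "exec R (While r c) \<lparr>mem = m1, clock = k1, tape = tp @ v1\<rparr> \<lparr>mem = m2, clock = k2, tape = (tp @ v1) @ v2\<rparr>"
    "map fst v2 = w2" "k2 \<le> k1 + n2" using assms(4) unfolding runs_def by blast
  have "exec R (While r c) \<lparr>mem = m, clock = k, tape = tp\<rparr> \<lparr>mem = m2, clock = k2, tape = tp @ (v1 @ v2)\<rparr>"
    using exec.WhileTrue[of "\<lparr>mem = m, clock = k, tape = tp\<rparr>" r R c] 1(1) 2(1) assms(1) by (simp add: tick_def)
  then show "\<exists>k' w'. exec R (While r c) \<lparr>mem = m, clock = k, tape = tp\<rparr> \<lparr>mem = m2, clock = k', tape = tp @ w'\<rparr> \<and>
     map fst w' = w1 @ w2 \<and> k' \<le> k + (n1 + unit_cost B + n2)"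
    using 1 2 b by (intro exI[of _ k2] exI[of _ "v1 @ v2"]) auto
qed

text \<open>The number N of iterations is known in advance, so the invariant, the cost and the
  output are indexed by the iteration and no termination measure is needed.\<close>

lemma runs_While:
  assumes step: "\<And>j m. j < N \<Longrightarrow> I j m \<Longrightarrow> m r \<noteq> 0 \<and> m r \<le> B \<and> (\<exists>m'. runs R c m m' (n j) (w j) \<and> I (Suc j) m')"
    and stop: "\<And>m. I N m \<Longrightarrow> m r = 0"
  shows "j \<le> N \<Longrightarrow> I j m \<Longrightarrow>
    \<exists>m'. runs R (While r c) m m' ((\<Sum>i=j..<N. n i + unit_cost B) + unit_cost B) (concat (map w [j..<N])) \<and> I N m'"
proof (induction "N - j" arbitrary: j m)
  case 0
  then have "j = N" by simp
  then show ?case using runs_WhileFalse[of m r R c B] stop 0 by auto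
next
  case (Suc k)
  then have j: "j < N" and "k = N - Suc j" by simp_all
  obtain m1 where m1: "m r \<noteq> 0" "m r \<le> B" "runs R c m m1 (n j) (w j)" "I (Suc j) m1"
    using step[OF j Suc.prems(2)] by blast
  obtain m2 where m2: "runs R (While r c) m1 m2 ((\<Sum>i=Suc j..<N. n i + unit_cost B) + unit_cost B)
      (concat (map w [Suc j..<N]))" "I N m2"
    using Suc.hyps(1)[of "Suc j" m1] j m1(4) \<open>k = N - Suc j\<close> by auto
  have "(\<Sum>i=j..<N. n i + unit_cost B) = n j + unit_cost B + (\<Sum>i=Suc j..<N. n i + unit_cost B)"
    using j by (rule sum.atLeast_Suc_lessThan)
  moreover have "concat (map w [j..<N]) = w j @ concat (map w [Suc j..<N])"
    using j by (simp add: upt_conv_Cons)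
  ultimately show ?case using runs_WhileTrue[OF m1(1-3) m2(1)] m2(2) by (auto simp: add.assoc)
qed

text \<open>Symbolic execution of loop-free code. Besides the postcondition it collects the
  requirement that all values handled are at most B, so that every instruction costs at most one
  unit. Loops are left to \<open>runs_While\<close>.\<close>

fun wp :: "nat ring \<Rightarrow> nat \<Rightarrow> com \<Rightarrow> ((nat \<Rightarrow> nat) \<Rightarrow> nat list \<Rightarrow> bool) \<Rightarrow> (nat \<Rightarrow> nat) \<Rightarrow> nat list \<Rightarrow> bool" where
  "wp R B (Const r v) Q m w \<longleftrightarrow> v \<le> B \<and> Q (m(r := v)) w"
| "wp R B (FZero r) Q m w \<longleftrightarrow> \<zero>\<^bsub>R\<^esub> \<le> B \<and> Q (m(r := \<zero>\<^bsub>R\<^esub>)) w"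
| "wp R B (FOne r) Q m w \<longleftrightarrow> False"
| "wp R B (Load r p) Q m w \<longleftrightarrow> m p \<le> B \<and> m (m p) \<le> B \<and> Q (m(r := m (m p))) w"
| "wp R B (Store p r) Q m w \<longleftrightarrow> m p \<le> B \<and> m r \<le> B \<and> Q (m(m p := m r)) w"
| "wp R B (NatOp f r x y) Q m w \<longleftrightarrow> m x \<le> B \<and> m y \<le> B \<and> nat_op_val f (m x) (m y) \<le> B \<and>
     Q (m(r := nat_op_val f (m x) (m y))) w"
| "wp R B (FieldOp f r x y) Q m w \<longleftrightarrow> m x \<le> B \<and> m y \<le> B \<and> field_op_val R f (m x) (m y) \<le> B \<and>
     Q (m(r := field_op_val R f (m x) (m y))) w"
| "wp R B (Emit r) Q m w \<longleftrightarrow> m r \<le> B \<and> Q m (w @ [m r])"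
| "wp R B (Seq c d) Q m w \<longleftrightarrow> wp R B c (wp R B d Q) m w"
| "wp R B (If r c d) Q m w \<longleftrightarrow> m r \<le> B \<and> (if m r \<noteq> 0 then wp R B c Q m w else wp R B d Q m w)"
| "wp R B (While r c) Q m w \<longleftrightarrow> False"

text \<open>Both branches of a conditional are counted, which keeps the bound independent of the
  memory.\<close>

fun steps :: "com \<Rightarrow> nat" where
  "steps (Seq c d) = steps c + steps d"
| "steps (If r c d) = 1 + steps c + steps d"
| "steps c = 1"

lemma runs_wp:
  "wp R B c Q m w \<Longrightarrow> \<exists>m' v. runs R c m m' (steps c * unit_cost B) v \<and> Q m' (w @ v)"
proof (induction c arbitrary: Q m w)
  case (Const r v)
  then have "runs R (Const r v) m (m(r := v)) (steps (Const r v) * unit_cost B) []"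
    using runs_Const[of v B R r m] by simp
  moreover have "Q (m(r := v)) (w @ [])" using Const by simp
  ultimately show ?case by blast
next
  case (FZero r)
  then have "runs R (FZero r) m (m(r := \<zero>\<^bsub>R\<^esub>)) (steps (FZero r) * unit_cost B) []"
    using runs_FZero[of R B r m] by simp
  moreover have "Q (m(r := \<zero>\<^bsub>R\<^esub>)) (w @ [])" using FZero by simp
  ultimately show ?case by blast
next
  case (Load r p)
  then have "runs R (Load r p) m (m(r := m (m p))) (steps (Load r p) * unit_cost B) []"
    using runs_Load[of m p B R r] by simp
  moreover have "Q (m(r := m (m p))) (w @ [])" using Load by simp
  ultimately show ?case by blast
next
  case (Store p r)
  then have "runs R (Store p r) m (m(m p := m r)) (steps (Store p r) * unit_cost B) []"
    using runs_Store[of m p B r R] by simp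
  moreover have "Q (m(m p := m r)) (w @ [])" using Store by simp
  ultimately show ?case by blast
next
  case (NatOp f r x y)
  then have "runs R (NatOp f r x y) m (m(r := nat_op_val f (m x) (m y))) (steps (NatOp f r x y) * unit_cost B) []"
    using runs_NatOp[of m x B y f R r] by simp
  moreover have "Q (m(r := nat_op_val f (m x) (m y))) (w @ [])" using NatOp by simp
  ultimately show ?case by blast
next
  case (FieldOp f r x y)
  then have "runs R (FieldOp f r x y) m (m(r := field_op_val R f (m x) (m y))) (steps (FieldOp f r x y) * unit_cost B) []"
    using runs_FieldOp[of m x B y R f r] by simp
  moreover have "Q (m(r := field_op_val R f (m x) (m y))) (w @ [])" using FieldOp by simp
  ultimately show ?case by blast
next
  case (Emit r)
  then have "runs R (Emit r) m (m) (steps (Emit r) * unit_cost B) [m r]"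
    using runs_Emit[of m r B R] by simp
  moreover have "Q (m) (w @ [m r])" using Emit by simp
  ultimately show ?case by blast
next
  case (Seq c d)
  from Seq.prems have "wp R B c (wp R B d Q) m w" by simp
  then obtain m1 v1 where 1: "runs R c m m1 (steps c * unit_cost B) v1" "wp R B d Q m1 (w @ v1)"
    using Seq.IH(1) by blast
  then obtain m2 v2 where 2: "runs R d m1 m2 (steps d * unit_cost B) v2" "Q m2 ((w @ v1) @ v2)"
    using Seq.IH(2) by blast
  then show ?case using runs_Seq[OF 1(1) 2(1)] by (auto simp: distrib_right)
next
  case (If r c d)
  show ?case
  proof (cases "m r = 0")
    case True
    then obtain m' v where "runs R d m m' (steps d * unit_cost B) v" "Q m' (w @ v)"
      using If.prems If.IH(2)[of Q m w] by auto
    then have r: "runs R (If r c d) m m' (unit_cost B + steps d * unit_cost B) v" and Q: "Q m' (w @ v)"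
      using True by (auto intro: runs_If)
    have "runs R (If r c d) m m' (steps (If r c d) * unit_cost B) v"
      by (rule runs_mono[OF r]) (simp add: algebra_simps)
    then show ?thesis using Q by blast
  next
    case False
    then obtain m' v where "runs R c m m' (steps c * unit_cost B) v" "Q m' (w @ v)"
      using If.prems If.IH(1)[of Q m w] by auto
    moreover have "m r \<le> B" using If.prems by simp
    ultimately have r: "runs R (If r c d) m m' (unit_cost B + steps c * unit_cost B) v" and Q: "Q m' (w @ v)"
      using False by (auto intro: runs_If)
    have "runs R (If r c d) m m' (steps (If r c d) * unit_cost B) v"
      by (rule runs_mono[OF r]) (simp add: algebra_simps)
    then show ?thesis using Q by blast
  qed
qed auto

section \<open>The algorithm\<close>

text \<open>Registers: 0 holds \<open>q\<close>, 1 to 3 and 5 constants (2 the address of the table of squares), 7 and 8 the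
  pair \<open>d\<close>, \<open>t\<close>, 9 and 10 the slow and the fast pointer, 12 whether all tests succeeded so far, 13
  whether the walk goes on, 16 the counter, 17 the leading coefficient; the others are scratch.\<close>

definition test_square :: "nat \<Rightarrow> com" where
  "test_square r = Seq (NatOp Add 14 r 2) (Load 11 14)"

definition advance :: "nat \<Rightarrow> com" where
  "advance r = Seq (FieldOp FMul r r r) (FieldOp FAdd r r 7)"

text \<open>Truncated subtraction lets register 12 drop to 0 at the first square and stay
  there.\<close>

definition check :: com where
  "check = Seq (FieldOp FAdd 11 8 10) (Seq (test_square 11) (NatOp Sub 12 12 11))"

text \<open>Register 5 holds the number 0 and register 3 the zero of the field: adding the former
  copies a register, subtracting from the latter negates.\<close>

definition walk_init :: com where
  "walk_init = Seq (FieldOp FAdd 10 8 7) (Seq (FieldOp FSub 10 3 10) (Seq (test_square 10)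
     (Seq (NatOp Sub 12 1 11) (Seq (NatOp Add 9 7 5) (Seq (NatOp Add 10 7 5) (NatOp Add 13 12 5))))))"

text \<open>With truncated subtraction (x - y) + (y - x) is zero exactly if x = y. So register 13
  receives the state of the tests while the pointers differ, and 0 once they meet.\<close>

definition walk_round :: com where
  "walk_round = Seq (advance 10) (Seq check (Seq (advance 10) (Seq check (Seq (advance 9)
     (Seq (NatOp Sub 14 9 10) (Seq (NatOp Sub 11 10 9) (Seq (NatOp Add 14 14 11)
       (If 14 (NatOp Add 13 12 5) (Const 13 0)))))))))"

definition walk :: com where
  "walk = Seq walk_init (While 13 walk_round)"

text \<open>Counting down with the decrement first runs through q - 1, ..., 0, that is, through all
  codes of field elements. \<open>Const 15 0\<close> writes to a scratch register in place of an
  empty branch.\<close>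

definition t_loop :: "com \<Rightarrow> com" where
  "t_loop c = Seq (NatOp Add 8 0 5) (While 8 (Seq (NatOp Sub 8 8 1) (Seq walk (If 12 c (Const 15 0)))))"

definition search :: "com \<Rightarrow> com" where
  "search c = Seq (NatOp Add 7 0 5) (While 7 (Seq (NatOp Sub 7 7 1) (t_loop c)))"

text \<open>The leading coefficient is compared with the code of the field's zero, which need not be
  the number 0.\<close>

definition emit_one :: com where
  "emit_one = Seq (NatOp Sub 14 17 3) (Seq (NatOp Sub 11 3 17) (Seq (NatOp Add 14 14 11)
     (If 14 (Seq (Emit 17) (Seq (FieldOp FAdd 10 8 8) (Seq (FieldOp FSub 10 3 10) (Seq (Emit 10)
        (Seq (FieldOp FMul 10 8 8) (Seq (FieldOp FAdd 10 10 8) (Seq (FieldOp FAdd 10 10 7)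
        (Seq (FieldOp FDiv 10 10 17) (Emit 10)))))))))
      (Const 15 0))))"

definition emit_all :: com where
  "emit_all = Seq (NatOp Add 17 0 5) (While 17 (Seq (NatOp Sub 17 17 1) emit_one))"

definition setup_regs :: com where
  "setup_regs = Seq (Const 1 1) (Seq (Const 2 20) (Seq (FZero 3) (Seq (Const 5 0) (NatOp Add 4 0 5))))"

text \<open>Only squares are marked; the entries of nonsquares keep the initial memory value
  0.\<close>

definition setup_step :: com where
  "setup_step = Seq (NatOp Sub 4 4 1) (Seq (FieldOp FMul 11 4 4) (Seq (NatOp Add 14 11 2) (Store 14 1)))"

definition prepare :: com where
  "prepare = Seq setup_regs (While 4 setup_step)"

definition count_phase :: com where
  "count_phase = Seq prepare (Seq (search (NatOp Add 16 16 1)) (Seq (NatOp Sub 18 0 1) (NatOp Mul 16 16 18)))"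

text \<open>The count has to precede the list on the tape. Repeating the search after emitting it
  avoids storing the good pairs and costs no more than a constant factor.\<close>

definition program :: com where
  "program = Seq count_phase (Seq (Emit 16) (search emit_all))"

section \<open>Correctness and cost of the search over all pairs\<close>

locale coded_field = finite_odd_field R for R :: "nat ring" (structure) +
  assumes carrier_eq: "carrier R = {..<order R}"
begin

abbreviation q :: nat where "q \<equiv> order R"

text \<open>The largest values are the final count, at most q^2 (q - 1), and the table addresses x +
  20.\<close>

definition B :: nat where "B = q * q * q + 20"

abbreviation U :: nat where "U \<equiv> unit_cost B"

lemma q3: "q \<ge> 3" by (rule order_ge_3)

lemma q_le_qqq: "q \<le> q * q * q" "q * q < q * q * q"
  using q3 by auto

lemma B_bounds: "x \<in> carrier R \<Longrightarrow> x \<le> B" "x \<in> carrier R \<Longrightarrow> x + 20 \<le> B" "q \<le> B" "20 \<le> B" "Suc 0 \<le> B"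
  "x \<le> q * q \<Longrightarrow> Suc x \<le> B" "x \<le> q * q \<Longrightarrow> x * (q - Suc 0) \<le> B" "x \<in> carrier R \<Longrightarrow> y \<in> carrier R \<Longrightarrow> x - y + (y - x) \<le> B"
proof -
  have q: "x < q" if "x \<in> carrier R" for x using that unfolding carrier_eq by simp
  show "x \<in> carrier R \<Longrightarrow> x \<le> B" "x \<in> carrier R \<Longrightarrow> x + 20 \<le> B" "q \<le> B" "20 \<le> B" "Suc 0 \<le> B"
    using q[of x] q_le_qqq unfolding B_def by linarith+
  show "x \<in> carrier R \<Longrightarrow> y \<in> carrier R \<Longrightarrow> x - y + (y - x) \<le> B"
    using q[of x] q[of y] q_le_qqq unfolding B_def by linarith
  show "x \<le> q * q \<Longrightarrow> Suc x \<le> B" using q_le_qqq unfolding B_def by linarith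
  show "x \<le> q * q \<Longrightarrow> x * (q - Suc 0) \<le> B"
    using mult_mono[of x "q * q" "q - Suc 0" q] unfolding B_def by simp
qed

definition env :: "(nat \<Rightarrow> nat) \<Rightarrow> bool" where
  "env m \<longleftrightarrow> m 0 = q \<and> m 1 = 1 \<and> m 2 = 20 \<and> m 3 = \<zero> \<and> m 5 = 0 \<and>
    (\<forall>x\<in>carrier R. m (x + 20) = of_bool (is_square x))"

definition passed :: "nat \<Rightarrow> nat \<Rightarrow> nat \<Rightarrow> bool" where
  "passed d t j \<longleftrightarrow> \<not> is_square (\<ominus> (t \<oplus> d)) \<and> (\<forall>n\<in>{1..2 * j}. \<not> is_square (t \<oplus> orb d n))"

definition frame :: "(nat \<Rightarrow> nat) \<Rightarrow> (nat \<Rightarrow> nat) \<Rightarrow> bool" where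
  "frame m0 m \<longleftrightarrow> (\<forall>r. r \<notin> {9..14} \<longrightarrow> m r = m0 r)"

lemma frame_env: "frame m0 m \<Longrightarrow> env m0 \<Longrightarrow> env m"
  unfolding frame_def env_def by auto

definition walk_inv :: "(nat \<Rightarrow> nat) \<Rightarrow> nat \<Rightarrow> nat \<Rightarrow> nat \<Rightarrow> (nat \<Rightarrow> nat) \<Rightarrow> bool" where
  "walk_inv m0 d t j m \<longleftrightarrow> frame m0 m \<and> m 9 = orb d j \<and> m 10 = orb d (2 * j) \<and>
    m 12 = of_bool (passed d t j) \<and> m 13 = of_bool (alive d t j)"

lemma zero_minus [simp]: "x \<in> carrier R \<Longrightarrow> \<zero> \<ominus> x = \<ominus> x"
  by (simp add: minus_eq)

lemma walk_init_spec:
  assumes "env m" "m 7 = d" "m 8 = t" "d \<in> carrier R" "t \<in> carrier R"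
  shows "wp R B walk_init (\<lambda>m' w. walk_inv m d t 0 m' \<and> w = []) m []"
proof -
  have e: "m 0 = q" "m (Suc 0) = 1" "m 2 = 20" "m 3 = \<zero>" "m 5 = 0"
    "\<And>x. x \<in> carrier R \<Longrightarrow> m (x + 20) = of_bool (is_square x)"
    using assms(1) unfolding env_def by auto
  have "Suc 0 \<le> B" "0 \<le> B" using B_bounds by auto
  then show ?thesis
    using assms(2-) B_bounds(1,2,4,5)
    by (cases "is_square (\<ominus> (t \<oplus> d))")
      (simp_all add: walk_init_def test_square_def e walk_inv_def frame_def passed_def alive_def)
qed

lemma walk_round_spec:
  assumes inv: "walk_inv m0 d t j m" and al: "alive d t j"
    and m0: "env m0" "m0 7 = d" "m0 8 = t" "d \<in> carrier R" "t \<in> carrier R"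
  shows "wp R B walk_round (\<lambda>m' w. walk_inv m0 d t (Suc j) m' \<and> w = []) m []"
proof -
  have fr: "\<And>r. r \<notin> {9..14} \<Longrightarrow> m r = m0 r" using inv unfolding walk_inv_def frame_def by auto
  have "env m" using inv m0(1) frame_env unfolding walk_inv_def by blast
  then have e: "m 0 = q" "m (Suc 0) = 1" "m 2 = 20" "m 3 = \<zero>" "m 5 = 0"
    "\<And>x. x \<in> carrier R \<Longrightarrow> m (x + 20) = of_bool (is_square x)"
    unfolding env_def by auto
  have e0: "m0 0 = q" "m0 (Suc 0) = 1" "m0 2 = 20" "m0 3 = \<zero>" "m0 5 = 0"
    "\<And>x. x \<in> carrier R \<Longrightarrow> m0 (x + 20) = of_bool (is_square x)"
    using m0(1) unfolding env_def by auto
  have m78: "m 7 = d" "m 8 = t" using fr[of 7] fr[of 8] m0 by auto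
  \<comment> \<open>A round is entered only while alive, so register 12 is still 1.\<close>
  have pj: "passed d t j" using al unfolding alive_def passed_def by simp
  have r: "m 9 = orb d j" "m 10 = orb d (2 * j)" "m 12 = 1" using inv pj unfolding walk_inv_def by auto
  define x where "x = orb d (Suc j)"
  define y1 where "y1 = orb d (Suc (2 * j))"
  define y2 where "y2 = orb d (Suc (Suc (2 * j)))"
  have c: "x \<in> carrier R" "y1 \<in> carrier R" "y2 \<in> carrier R" "orb d j \<in> carrier R" "orb d (2 * j) \<in> carrier R"
    "t \<oplus> y1 \<in> carrier R" "t \<oplus> y2 \<in> carrier R"
    using m0 orb_closed unfolding x_def y1_def y2_def by (auto simp del: orb.simps)
  have o: "orb d j \<otimes> orb d j \<oplus> d = x" "orb d (2 * j) \<otimes> orb d (2 * j) \<oplus> d = y1" "y1 \<otimes> y1 \<oplus> d = y2"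
    by (simp_all add: x_def y1_def y2_def)
  have set2: "{1..2 * Suc j} = insert (Suc (Suc (2 * j))) (insert (Suc (2 * j)) {1..2 * j})" by auto
  have p: "passed d t (Suc j) \<longleftrightarrow> \<not> is_square (t \<oplus> y1) \<and> \<not> is_square (t \<oplus> y2)"
    using pj unfolding passed_def set2 y1_def y2_def by (auto simp del: orb.simps)
  have set1: "{1..Suc j} = insert (Suc j) {1..j}" by auto
  have a: "alive d t (Suc j) \<longleftrightarrow> passed d t (Suc j) \<and> x \<noteq> y2"
    using al unfolding alive_def passed_def set1 x_def y2_def by (auto simp del: orb.simps)
  have o2: "orb d (Suc j) = x" "orb d (2 * Suc j) = y2" by (simp_all add: x_def y2_def del: orb.simps)
  have prods: "orb d j \<otimes> orb d j \<in> carrier R" "orb d (2 * j) \<otimes> orb d (2 * j) \<in> carrier R" "y1 \<otimes> y1 \<in> carrier R"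
    using c by auto
  have diffs: "x - y2 \<le> B" "y2 - x \<le> B" "x - y2 + (y2 - x) \<le> B" "Suc 0 \<le> B" "20 \<le> B" "0 \<le> B"
    using B_bounds(8)[OF c(1) c(3)] B_bounds by auto
  have eq0: "x - y2 + (y2 - x) = 0 \<longleftrightarrow> x = y2" by auto
  note le = B_bounds(1)[OF c(1)] B_bounds(1)[OF c(2)] B_bounds(1)[OF c(3)] B_bounds(1)[OF c(4)] B_bounds(1)[OF c(5)]
    B_bounds(1)[OF c(6)] B_bounds(1)[OF c(7)] B_bounds(2)[OF c(6)] B_bounds(2)[OF c(7)]
    B_bounds(1)[OF prods(1)] B_bounds(1)[OF prods(2)] B_bounds(1)[OF prods(3)]
    B_bounds(1)[OF m0(4)] B_bounds(1)[OF m0(5)]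
  show ?thesis
    unfolding walk_inv_def a p o2
    by (cases "is_square (t \<oplus> y1)"; cases "is_square (t \<oplus> y2)"; cases "x = y2")
      (use c m0(4,5) in \<open>simp_all add: walk_round_def advance_def check_def test_square_def e e0 m0(2,3) m78 r o prods le diffs eq0
        frame_def fr del: orb.simps\<close>)
qed

text \<open>8 units for \<open>walk_init\<close>, 1 for the last loop test, and 20 + 1 for each
  round.\<close>

lemma walk_spec:
  assumes "env m" "m 7 = d" "m 8 = t" "d \<in> carrier R" "t \<in> carrier R"
  shows "\<exists>m'. runs R walk m m' (U * (9 + 21 * rounds d t)) [] \<and> frame m m' \<and> m' 12 = of_bool (good d t)"
proof -
  obtain m1 where m1: "runs R walk_init m m1 (steps walk_init * U) []" "walk_inv m d t 0 m1"
    using runs_wp[OF walk_init_spec[OF assms]] by auto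
  have s: "steps walk_round = 20" "steps walk_init = 8"
    by (simp_all add: walk_round_def walk_init_def advance_def check_def test_square_def)
  have ex: "\<exists>m2. runs R (While 13 walk_round) m1 m2 ((\<Sum>i=0..<rounds d t. 20 * U + U) + U)
      (concat (map (\<lambda>_. []) [0..<rounds d t])) \<and> walk_inv m d t (rounds d t) m2"
  proof (rule runs_While[where I = "walk_inv m d t"])
    fix j m' assume j: "j < rounds d t" "walk_inv m d t j m'"
    then have al: "alive d t j" using alive_iff[OF assms(4)] by simp
    then have "m' 13 = 1" using j(2) unfolding walk_inv_def by simp
    moreover have "\<exists>m''. runs R walk_round m' m'' (20 * U) [] \<and> walk_inv m d t (Suc j) m''"
      using runs_wp[OF walk_round_spec[OF j(2) al assms]] s by auto
    ultimately show "m' 13 \<noteq> 0 \<and> m' 13 \<le> B \<and> (\<exists>m''. runs R walk_round m' m'' (20 * U) [] \<and> walk_inv m d t (Suc j) m'')"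
      using B_bounds(5) by simp
  next
    fix m' assume "walk_inv m d t (rounds d t) m'"
    then show "m' 13 = 0" using alive_iff[OF assms(4), of t "rounds d t"] by (simp add: walk_inv_def)
  qed (use m1 in auto)
  obtain m2 where m2: "runs R (While 13 walk_round) m1 m2 (rounds d t * (21 * U) + U) []"
    "walk_inv m d t (rounds d t) m2"
  proof -
    have nil: "concat (map (\<lambda>_. []) [0..<rounds d t]) = ([] :: nat list)" by simp
    show ?thesis using that ex unfolding nil by auto
  qed
  have "good d t \<longleftrightarrow> passed d t (rounds d t)" using good_iff[OF assms(4)] by (simp add: passed_def)
  moreover have "runs R walk m m2 (U * (9 + 21 * rounds d t)) []"
    unfolding walk_def using runs_Seq[OF m1(1) m2(1)] s by (auto intro: runs_mono simp: algebra_simps)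
  ultimately show ?thesis using m2(2) unfolding walk_inv_def by auto
qed

text \<open>One interface for counting (e = 1) and listing (e = 0). The factor \<open>e\<close>
  voids the bound on register 16 while listing, when it holds the final count, which may exceed
  q^2.\<close>

definition body_spec :: "com \<Rightarrow> nat \<Rightarrow> nat \<Rightarrow> (nat \<Rightarrow> nat \<Rightarrow> nat list) \<Rightarrow> bool" where
  "body_spec c n e out \<longleftrightarrow> (\<forall>m. env m \<longrightarrow> m 7 \<in> carrier R \<longrightarrow> m 8 \<in> carrier R \<longrightarrow> good (m 7) (m 8) \<longrightarrow> e * m 16 \<le> q * q \<longrightarrow>
     (\<exists>m'. runs R c m m' n (out (m 7) (m 8)) \<and> env m' \<and> m' 7 = m 7 \<and> m' 8 = m 8 \<and> m' 16 = m 16 + e))"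

lemma element:
  assumes "i < q"
  shows "q - Suc i \<in> carrier R" "q - i - 1 = q - Suc i"
  using assms unfolding carrier_eq by auto

text \<open>The last assumption leaves room for q increments of the counter. Of the 13 units per t,
  9 come from \<open>walk\<close> and one each from the decrement, the conditional, its empty branch
  and the loop test; 2 more start and end the loop.\<close>

lemma t_loop_spec:
  assumes c: "body_spec c n e out" and m: "env m" "m 7 = d" "d \<in> carrier R" "e * (m 16 + e * q) \<le> q * q"
  shows "\<exists>m'. runs R (t_loop c) m m'
      ((\<Sum>i<q. U * (13 + 21 * rounds d (q - Suc i)) + (if good d (q - Suc i) then n else 0)) + 2 * U)
      (concat (map (\<lambda>i. if good d (q - Suc i) then out d (q - Suc i) else []) [0..<q])) \<and>
    env m' \<and> m' 7 = d \<and> m' 16 = m 16 + e * (\<Sum>i<q. of_bool (good d (q - Suc i)))"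
proof -
  define I where "I i m' \<longleftrightarrow> env m' \<and> m' 7 = d \<and> m' 8 = q - i \<and> m' 16 = m 16 + e * (\<Sum>i<i. of_bool (good d (q - Suc i)))" for i m'
  have e: "m 0 = q" "m 5 = 0" using m(1) unfolding env_def by auto
  have "runs R (NatOp Add 8 0 5) m (m(8 := q)) U []"
    using runs_NatOp[of m 0 B 5 Add R 8] e B_bounds(3) by simp
  moreover have "I 0 (m(8 := q))" using m unfolding I_def env_def by auto
  moreover have "\<exists>m'. runs R (While 8 (Seq (NatOp Sub 8 8 1) (Seq walk (If 12 c (Const 15 0))))) (m(8 := q)) m'
      ((\<Sum>i=0..<q. (U * (12 + 21 * rounds d (q - Suc i)) + (if good d (q - Suc i) then n else 0)) + U) + U)
      (concat (map (\<lambda>i. if good d (q - Suc i) then out d (q - Suc i) else []) [0..<q])) \<and> I q m'"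
  proof (rule runs_While[where I = I])
    fix i m1 assume i: "i < q" "I i m1"
    define t where "t = q - Suc i"
    have t: "t \<in> carrier R" unfolding t_def by (rule element(1)[OF i(1)])
    have e1: "env m1" "m1 7 = d" "m1 8 = q - i" using i(2) unfolding I_def by auto
    define m2 where "m2 = m1(8 := t)"
    have v: "m1 1 = 1" using e1(1) unfolding env_def by simp
    have r2: "runs R (NatOp Sub 8 8 1) m1 m2 U []"
      using runs_NatOp[of m1 8 B 1 Sub R 8] e1 v B_bounds(1)[OF t] B_bounds(3,5) i(1) unfolding m2_def t_def by simp
    have env2: "env m2" "m2 7 = d" "m2 8 = t" "m2 16 = m1 16" using e1 unfolding m2_def env_def by auto
    obtain m3 where m3: "runs R walk m2 m3 (U * (9 + 21 * rounds d t)) []" "frame m2 m3" "m3 12 = of_bool (good d t)"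
      using walk_spec[OF env2(1-3) m(3) t] by blast
    have env3: "env m3" "m3 7 = d" "m3 8 = t" "m3 16 = m1 16"
      using frame_env[OF m3(2) env2(1)] m3(2) env2 unfolding frame_def by auto
    have "\<exists>m4. runs R (If 12 c (Const 15 0)) m3 m4 (U + (U + (if good d t then n else 0))) (if good d t then out d t else []) \<and>
        env m4 \<and> m4 7 = d \<and> m4 8 = t \<and> m4 16 = m1 16 + e * of_bool (good d t)"
    proof (cases "good d t")
      case True
      have "(\<Sum>i<i. of_bool (good d (q - Suc i))) \<le> (\<Sum>i<i. 1::nat)" by (intro sum_mono) auto
      then have "(\<Sum>i<i. of_bool (good d (q - Suc i))) \<le> q" using i(1) by simp
      then have "e * (m 16 + e * (\<Sum>i<i. of_bool (good d (q - Suc i)))) \<le> e * (m 16 + e * q)"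
        by (intro mult_left_mono add_left_mono) auto
      from order_trans[OF this m(4)] have "e * m3 16 \<le> q * q" using i(2) env3(4) unfolding I_def by (simp only:)
      then obtain m4 where m4: "runs R c m3 m4 n (out d t)" "env m4" "m4 7 = d" "m4 8 = t" "m4 16 = m3 16 + e"
        using c env3 True m(3) t unfolding body_spec_def by metis
      have "runs R (If 12 c (Const 15 0)) m3 m4 (U + n) (out d t)"
        using m4(1) True m3(3) B_bounds(5) by (intro runs_If) auto
      then have "runs R (If 12 c (Const 15 0)) m3 m4 (U + (U + n)) (out d t)" by (rule runs_mono) simp
      then show ?thesis using m4 env3(4) True by auto
    next
      case False
      have "runs R (If 12 c (Const 15 0)) m3 (m3(15 := 0)) (U + U) []"
        using False m3(3) runs_Const[of 0 B R 15 m3] by (intro runs_If) auto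
      moreover have "env (m3(15 := 0))" using env3 unfolding env_def by auto
      ultimately show ?thesis using env3 False by auto
    qed
    then obtain m4 where m4: "runs R (If 12 c (Const 15 0)) m3 m4 (U + (U + (if good d t then n else 0))) (if good d t then out d t else [])"
      "env m4" "m4 7 = d" "m4 8 = t" "m4 16 = m1 16 + e * of_bool (good d t)" by blast
    have "runs R (Seq (NatOp Sub 8 8 1) (Seq walk (If 12 c (Const 15 0)))) m1 m4
        (U * (12 + 21 * rounds d t) + (if good d t then n else 0)) (if good d t then out d t else [])"
      using runs_Seq[OF r2 runs_Seq[OF m3(1) m4(1)]] by (auto intro: runs_mono simp: algebra_simps)
    moreover have "I (Suc i) m4"
      using m4 i unfolding I_def t_def by (auto simp: algebra_simps)
    moreover have "m1 8 \<noteq> 0" "m1 8 \<le> B" using e1 i(1) B_bounds(3) by auto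
    ultimately show "m1 8 \<noteq> 0 \<and> m1 8 \<le> B \<and> (\<exists>m'. runs R (Seq (NatOp Sub 8 8 1) (Seq walk (If 12 c (Const 15 0)))) m1 m'
        (U * (12 + 21 * rounds d (q - Suc i)) + (if good d (q - Suc i) then n else 0))
        (if good d (q - Suc i) then out d (q - Suc i) else []) \<and> I (Suc i) m')"
      unfolding t_def by blast
  next
    show "I q m' \<Longrightarrow> m' 8 = 0" for m' by (simp add: I_def)
  qed (use calculation in auto)
  ultimately obtain m' where m': "runs R (NatOp Add 8 0 5) m (m(8 := q)) U []"
    "runs R (While 8 (Seq (NatOp Sub 8 8 1) (Seq walk (If 12 c (Const 15 0))))) (m(8 := q)) m'
      ((\<Sum>i=0..<q. (U * (12 + 21 * rounds d (q - Suc i)) + (if good d (q - Suc i) then n else 0)) + U) + U)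
      (concat (map (\<lambda>i. if good d (q - Suc i) then out d (q - Suc i) else []) [0..<q]))" "I q m'" by blast
  have sum_eq: "U + ((\<Sum>i=0..<q. (U * (12 + 21 * rounds d (q - Suc i)) + (if good d (q - Suc i) then n else 0)) + U) + U) =
      (\<Sum>i<q. U * (13 + 21 * rounds d (q - Suc i)) + (if good d (q - Suc i) then n else 0)) + 2 * U"
    by (simp add: atLeast0LessThan algebra_simps)
  have "runs R (t_loop c) m m'
      ((\<Sum>i<q. U * (13 + 21 * rounds d (q - Suc i)) + (if good d (q - Suc i) then n else 0)) + 2 * U)
      (concat (map (\<lambda>i. if good d (q - Suc i) then out d (q - Suc i) else []) [0..<q]))"
    using runs_Seq[OF m'(1,2)] unfolding t_loop_def sum_eq by simp
  then show ?thesis using m'(3) unfolding I_def by blast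
qed

text \<open>The 4 units per \<open>d\<close> are start and end of the inner loop, the decrement and
  the outer loop test; the last 2 start and end the outer loop.\<close>

definition search_cost :: "nat \<Rightarrow> nat" where
  "search_cost n = (\<Sum>d\<in>carrier R. \<Sum>t\<in>carrier R. U * (13 + 21 * rounds d t) + (if good d t then n else 0)) + q * (4 * U) + 2 * U"

lemma sum_elements: "(\<Sum>i<q. h (q - Suc i)) = (\<Sum>x\<in>carrier R. h x)"
  using sum.nat_diff_reindex[of h q] by (simp add: carrier_eq)

lemma card_good_pairs_eq: "(\<Sum>d\<in>carrier R. \<Sum>t\<in>carrier R. of_bool (good d t)) = card good_pairs"
proof -
  have "good_pairs = (SIGMA d:carrier R. {t \<in> carrier R. good d t})" by (auto simp: good_pairs_def)
  then have "card good_pairs = (\<Sum>d\<in>carrier R. card {t \<in> carrier R. good d t})"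
    using finite_carrier by (simp add: card_SigmaI)
  also have "\<dots> = (\<Sum>d\<in>carrier R. \<Sum>t\<in>carrier R. of_bool (good d t))"
    using finite_carrier by (intro sum.cong refl) (simp add: of_bool_def sum.If_cases Int_def)
  finally show ?thesis ..
qed

text \<open>\<open>e * m 16 = 0\<close> covers both passes: the counter starts at 0, or it is not
  touched.\<close>

lemma search_spec:
  assumes c: "body_spec c n e out" and e1: "e \<le> 1" and m: "env m" "e * m 16 = 0"
  shows "\<exists>m'. runs R (search c) m m' (search_cost n)
      (concat (map (\<lambda>j. concat (map (\<lambda>i. if good (q - Suc j) (q - Suc i) then out (q - Suc j) (q - Suc i) else []) [0..<q])) [0..<q])) \<and>
    env m' \<and> m' 16 = m 16 + e * card good_pairs"
proof -
  define g where "g d = (\<Sum>i<q. of_bool (good d (q - Suc i)) :: nat)" for d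
  define N where "N d = (\<Sum>i<q. U * (13 + 21 * rounds d (q - Suc i)) + (if good d (q - Suc i) then n else 0)) + 2 * U" for d
  define Out where "Out d = concat (map (\<lambda>i. if good d (q - Suc i) then out d (q - Suc i) else []) [0..<q])" for d
  define I where "I j m' \<longleftrightarrow> env m' \<and> m' 7 = q - j \<and> m' 16 = m 16 + e * (\<Sum>j<j. g (q - Suc j))" for j m'
  have em: "m 0 = q" "m 5 = 0" using m(1) unfolding env_def by auto
  have r0: "runs R (NatOp Add 7 0 5) m (m(7 := q)) U []"
    using runs_NatOp[of m 0 B 5 Add R 7] em B_bounds(3) by simp
  have I0: "I 0 (m(7 := q))" using m unfolding I_def env_def by auto
  have gq: "g d \<le> q" for d
  proof -
    have "g d \<le> (\<Sum>i<q. 1)" unfolding g_def by (intro sum_mono) auto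
    then show ?thesis by simp
  qed
  have "\<exists>m'. runs R (While 7 (Seq (NatOp Sub 7 7 1) (t_loop c))) (m(7 := q)) m'
      ((\<Sum>j=0..<q. (U + N (q - Suc j)) + U) + U) (concat (map (\<lambda>j. Out (q - Suc j)) [0..<q])) \<and> I q m'"
  proof (rule runs_While[where I = I])
    fix j m1 assume j: "j < q" "I j m1"
    define d where "d = q - Suc j"
    have d: "d \<in> carrier R" unfolding d_def by (rule element(1)[OF j(1)])
    have e1': "env m1" "m1 7 = q - j" using j(2) unfolding I_def by auto
    define m2 where "m2 = m1(7 := d)"
    have v: "m1 1 = 1" using e1'(1) unfolding env_def by simp
    have r2: "runs R (NatOp Sub 7 7 1) m1 m2 U []"
      using runs_NatOp[of m1 7 B 1 Sub R 7] e1' v B_bounds(1)[OF d] B_bounds(3,5) j(1) unfolding m2_def d_def by simp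
    have env2: "env m2" "m2 7 = d" "m2 16 = m1 16" using e1' unfolding m2_def env_def by auto
    have "(\<Sum>j<j. g (q - Suc j)) \<le> (\<Sum>j<j. q)" by (intro sum_mono gq)
    then have "(\<Sum>j<j. g (q - Suc j)) \<le> j * q" by simp
    then have "(\<Sum>j<j. g (q - Suc j)) + q \<le> Suc j * q" by simp
    also have "\<dots> \<le> q * q" using j(1) by (intro mult_right_mono) auto
    finally have "e * (m2 16 + e * q) \<le> q * q"
      using j(2) m(2) env2(3) e1 unfolding I_def by (cases e) auto
    from t_loop_spec[OF c env2(1,2) d this] obtain m3 where m3: "runs R (t_loop c) m2 m3 (N d) (Out d)" "env m3" "m3 7 = d"
      "m3 16 = m2 16 + e * g d" unfolding N_def Out_def g_def by blast
    have "runs R (Seq (NatOp Sub 7 7 1) (t_loop c)) m1 m3 (U + N d) (Out d)"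
      using runs_Seq[OF r2 m3(1)] by simp
    moreover have "I (Suc j) m3"
      using m3 j env2 unfolding I_def d_def by (auto simp: algebra_simps)
    moreover have "m1 7 \<noteq> 0" "m1 7 \<le> B" using e1' j(1) B_bounds(3) by auto
    ultimately show "m1 7 \<noteq> 0 \<and> m1 7 \<le> B \<and> (\<exists>m'. runs R (Seq (NatOp Sub 7 7 1) (t_loop c)) m1 m'
        (U + N (q - Suc j)) (Out (q - Suc j)) \<and> I (Suc j) m')" unfolding d_def by blast
  next
    show "I q m' \<Longrightarrow> m' 7 = 0" for m' by (simp add: I_def)
  qed (use I0 in auto)
  then obtain m' where m': "runs R (While 7 (Seq (NatOp Sub 7 7 1) (t_loop c))) (m(7 := q)) m'
      ((\<Sum>j=0..<q. (U + N (q - Suc j)) + U) + U) (concat (map (\<lambda>j. Out (q - Suc j)) [0..<q]))" "I q m'" by blast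
  have "(\<Sum>j<q. N (q - Suc j)) = (\<Sum>d\<in>carrier R. N d)" by (rule sum_elements)
  also have "\<dots> = (\<Sum>d\<in>carrier R. (\<Sum>t\<in>carrier R. U * (13 + 21 * rounds d t) + (if good d t then n else 0)) + 2 * U)"
    unfolding N_def by (intro sum.cong refl arg_cong2[of _ _ _ _ "(+)"] sum_elements)
  finally have sN: "(\<Sum>j<q. N (q - Suc j)) =
      (\<Sum>d\<in>carrier R. \<Sum>t\<in>carrier R. U * (13 + 21 * rounds d t) + (if good d t then n else 0)) + q * (2 * U)"
    by (simp add: sum.distrib order_def)
  have "U + ((\<Sum>j=0..<q. (U + N (q - Suc j)) + U) + U) = (\<Sum>j<q. N (q - Suc j)) + q * (2 * U) + 2 * U"
    by (simp add: atLeast0LessThan sum.distrib algebra_simps)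
  then have cost: "U + ((\<Sum>j=0..<q. (U + N (q - Suc j)) + U) + U) = search_cost n"
    unfolding sN search_cost_def by simp
  have "runs R (search c) m m' (search_cost n) (concat (map (\<lambda>j. Out (q - Suc j)) [0..<q]))"
    using runs_Seq[OF r0 m'(1)] unfolding search_def cost by simp
  moreover have "(\<Sum>j<q. g (q - Suc j)) = card good_pairs"
  proof -
    have "(\<Sum>j<q. g (q - Suc j)) = (\<Sum>d\<in>carrier R. g d)" by (rule sum_elements)
    also have "\<dots> = (\<Sum>d\<in>carrier R. \<Sum>t\<in>carrier R. of_bool (good d t))"
      unfolding g_def by (intro sum.cong refl sum_elements)
    finally show ?thesis using card_good_pairs_eq by simp
  qed
  ultimately show ?thesis using m'(2) unfolding I_def Out_def by auto
qed

end

lemma concat_map_filter: "concat (map h (filter Q xs)) = concat (map (\<lambda>x. if Q x then h x else []) xs)"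
  by (induction xs) auto

lemma concat_map_product:
  "concat (map h (List.product xs ys)) = concat (map (\<lambda>x. concat (map (\<lambda>y. h (x, y)) ys)) xs)"
  by (induction xs) (auto simp: comp_def)

context coded_field
begin

section \<open>The two loop bodies, the table of squares and the whole program\<close>

lemma count_spec: "body_spec (NatOp Add 16 16 1) U 1 (\<lambda>_ _. [])"
  unfolding body_spec_def
proof (intro allI impI)
  fix m :: "nat \<Rightarrow> nat" assume m: "env m" "1 * m 16 \<le> q * q"
  have "m 1 = 1" using m(1) unfolding env_def by simp
  moreover have "Suc (m 16) \<le> B" by (rule B_bounds(6)) (use m(2) in simp)
  ultimately have "runs R (NatOp Add 16 16 1) m (m(16 := m 16 + 1)) U []"
    using runs_NatOp[of m 16 B 1 Add R 16] B_bounds(5) by simp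
  moreover have "env (m(16 := m 16 + 1))" using m(1) unfolding env_def by auto
  ultimately show "\<exists>m'. runs R (NatOp Add 16 16 1) m m' U [] \<and> env m' \<and> m' 7 = m 7 \<and> m' 8 = m 8 \<and> m' 16 = m 16 + 1"
    by (intro exI[of _ "m(16 := m 16 + 1)"]) simp
qed

definition emit_inv :: "(nat \<Rightarrow> nat) \<Rightarrow> nat \<Rightarrow> (nat \<Rightarrow> nat) \<Rightarrow> bool" where
  "emit_inv m0 a m \<longleftrightarrow> env m \<and> m 7 = m0 7 \<and> m 8 = m0 8 \<and> m 16 = m0 16 \<and> m 17 = a"

lemma emit_one_spec:
  assumes inv: "emit_inv m0 a m" and c: "a \<in> carrier R" "m0 7 \<in> carrier R" "m0 8 \<in> carrier R"
  shows "wp R B emit_one (\<lambda>m' w. emit_inv m0 a m' \<and> w = (if a \<noteq> \<zero> then quad a (m0 7) (m0 8) else [])) m []"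
proof -
  define d where "d = m0 7"
  define t where "t = m0 8"
  have e: "m 0 = q" "m (Suc 0) = 1" "m 2 = 20" "m 3 = \<zero>" "m 5 = 0"
    "\<And>x. x \<in> carrier R \<Longrightarrow> m (x + 20) = of_bool (is_square x)"
    "m 7 = d" "m 8 = t" "m 16 = m0 16" "m 17 = a"
    using inv unfolding emit_inv_def env_def d_def t_def by auto
  have dt: "d \<in> carrier R" "t \<in> carrier R" using c by (auto simp: d_def t_def)
  have diff: "a - \<zero> \<le> B" "\<zero> - a \<le> B" "a - \<zero> + (\<zero> - a) \<le> B" "0 \<le> B"
    using B_bounds(8)[OF c(1) zero_closed] by auto
  have eq0: "a - \<zero> + (\<zero> - a) = 0 \<longleftrightarrow> a = \<zero>" by auto
  show ?thesis
  proof (cases "a = \<zero>")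
    case True
    then show ?thesis using e diff B_bounds(1)[OF zero_closed]
      by (simp add: emit_one_def emit_inv_def env_def d_def t_def)
  next
    case False
    then have ia: "inv a \<in> carrier R" using c by (simp add: field_Units)
    define s where "s = t \<otimes> t \<oplus> t \<oplus> d"
    have cl: "t \<oplus> t \<in> carrier R" "\<ominus> (t \<oplus> t) \<in> carrier R" "t \<otimes> t \<in> carrier R" "t \<otimes> t \<oplus> t \<in> carrier R"
      "s \<in> carrier R" "s \<otimes> inv a \<in> carrier R" using dt ia by (auto simp: s_def)
    note le = cl[THEN B_bounds(1)] B_bounds(1)[OF c(1)] B_bounds(1)[OF dt(1)] B_bounds(1)[OF dt(2)] B_bounds(1)[OF zero_closed]
    have nz: "\<not> (a \<le> \<zero> \<and> \<zero> \<le> a)" using False by auto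
    show ?thesis
      unfolding d_def[symmetric] t_def[symmetric]
      using False e diff le cl dt c(1) nz s_def[symmetric]
      by (auto simp: emit_one_def emit_inv_def env_def quad_def d_def[symmetric] t_def[symmetric] eq0)
  qed
qed

definition polys :: "nat \<Rightarrow> nat \<Rightarrow> nat list" where
  "polys d t = concat (map (\<lambda>i. if q - Suc i \<noteq> \<zero> then quad (q - Suc i) d t else []) [0..<q])"

text \<open>For each leading coefficient 14 units for \<open>emit_one\<close>, the decrement and the
  loop test.\<close>

lemma emit_all_spec: "body_spec emit_all (U * (16 * q + 2)) 0 polys"
  unfolding body_spec_def
proof (intro allI impI)
  fix m :: "nat \<Rightarrow> nat" assume m: "env m" "m 7 \<in> carrier R" "m 8 \<in> carrier R"
  have e: "m 0 = q" "m 5 = 0" using m(1) unfolding env_def by auto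
  have r0: "runs R (NatOp Add 17 0 5) m (m(17 := q)) U []"
    using runs_NatOp[of m 0 B 5 Add R 17] e B_bounds(3) by simp
  have s: "steps emit_one = 14" by (simp add: emit_one_def)
  have "\<exists>m'. runs R (While 17 (Seq (NatOp Sub 17 17 1) emit_one)) (m(17 := q)) m'
      ((\<Sum>i=0..<q. 15 * U + U) + U)
      (concat (map (\<lambda>i. if q - Suc i \<noteq> \<zero> then quad (q - Suc i) (m 7) (m 8) else []) [0..<q])) \<and> emit_inv m (q - q) m'"
  proof (rule runs_While[where I = "\<lambda>i. emit_inv m (q - i)"])
    fix i m1 assume i: "i < q" "emit_inv m (q - i) m1"
    define a where "a = q - Suc i"
    have a: "a \<in> carrier R" unfolding a_def by (rule element(1)[OF i(1)])
    have e1: "env m1" "m1 17 = q - i" using i(2) unfolding emit_inv_def by auto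
    have v: "m1 1 = 1" using e1(1) unfolding env_def by simp
    have r2: "runs R (NatOp Sub 17 17 1) m1 (m1(17 := a)) U []"
      using runs_NatOp[of m1 17 B 1 Sub R 17] e1 v B_bounds(1)[OF a] B_bounds(3,5) i(1) unfolding a_def by simp
    have "emit_inv m a (m1(17 := a))" using i(2) unfolding emit_inv_def env_def by auto
    from runs_wp[OF emit_one_spec[OF this a m(2,3)]] s obtain m2 where
      m2: "runs R emit_one (m1(17 := a)) m2 (14 * U) (if a \<noteq> \<zero> then quad a (m 7) (m 8) else [])" "emit_inv m a m2"
      by auto
    have "runs R (Seq (NatOp Sub 17 17 1) emit_one) m1 m2 (15 * U) (if a \<noteq> \<zero> then quad a (m 7) (m 8) else [])"
      using runs_Seq[OF r2 m2(1)] by simp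
    moreover have "m1 17 \<noteq> 0" "m1 17 \<le> B" using e1 i(1) B_bounds(3) by auto
    ultimately show "m1 17 \<noteq> 0 \<and> m1 17 \<le> B \<and> (\<exists>m'. runs R (Seq (NatOp Sub 17 17 1) emit_one) m1 m' (15 * U)
        (if q - Suc i \<noteq> \<zero> then quad (q - Suc i) (m 7) (m 8) else []) \<and> emit_inv m (q - Suc i) m')"
      using m2(2) unfolding a_def by blast
  next
    show "emit_inv m (q - q) m' \<Longrightarrow> m' 17 = 0" for m' by (simp add: emit_inv_def)
    show "emit_inv m (q - 0) (m(17 := q))" using m(1) unfolding emit_inv_def env_def by auto
  qed simp
  then obtain m' where m': "runs R (While 17 (Seq (NatOp Sub 17 17 1) emit_one)) (m(17 := q)) m'
      ((\<Sum>i=0..<q. 15 * U + U) + U) (polys (m 7) (m 8))" "emit_inv m 0 m'"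
    unfolding polys_def by auto
  have "runs R emit_all m m' (U * (16 * q + 2)) (polys (m 7) (m 8))"
    unfolding emit_all_def using runs_Seq[OF r0 m'(1)] by (auto intro: runs_mono simp: algebra_simps)
  then show "\<exists>m'. runs R emit_all m m' (U * (16 * q + 2)) (polys (m 7) (m 8)) \<and> env m' \<and> m' 7 = m 7 \<and> m' 8 = m 8 \<and> m' 16 = m 16 + 0"
    using m'(2) unfolding emit_inv_def by auto
qed

text \<open>The loop counts down, so after j rounds the squares of the codes from q - j on are
  marked; for j = q the restriction is void.\<close>

definition table_inv :: "nat \<Rightarrow> (nat \<Rightarrow> nat) \<Rightarrow> bool" where
  "table_inv j m \<longleftrightarrow> m 0 = q \<and> m 1 = 1 \<and> m 2 = 20 \<and> m 3 = \<zero> \<and> m 5 = 0 \<and> m 16 = 0 \<and> m 4 = q - j \<and>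
    (\<forall>x\<in>carrier R. m (x + 20) = of_bool (\<exists>y\<in>carrier R. q - j \<le> y \<and> x = y \<otimes> y))"

lemma setup_step_spec:
  assumes inv: "table_inv j m" and j: "j < q"
  shows "wp R B setup_step (\<lambda>m' w. table_inv (Suc j) m' \<and> w = []) m []"
proof -
  define y where "y = q - Suc j"
  have y: "y \<in> carrier R" unfolding y_def by (rule element(1)[OF j])
  have yy: "y \<otimes> y \<in> carrier R" using y by simp
  have e: "m 0 = q" "m (Suc 0) = 1" "m 2 = 20" "m 3 = \<zero>" "m 5 = 0" "m 16 = 0" "m 4 - Suc 0 = y" "m 4 \<le> B"
    "\<And>x. x \<in> carrier R \<Longrightarrow> m (x + 20) = of_bool (\<exists>y\<in>carrier R. q - j \<le> y \<and> x = y \<otimes> y)"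
    using inv B_bounds(3) unfolding table_inv_def y_def by auto
  have split: "q - Suc j \<le> z \<longleftrightarrow> z = y \<or> q - j \<le> z" for z unfolding y_def using j by auto
  show ?thesis
    using e y B_bounds(1)[OF y] B_bounds(1)[OF yy] B_bounds(2)[OF yy] B_bounds(4,5)
    unfolding setup_step_def table_inv_def split by (auto simp: y_def[symmetric])
qed

lemma prepare_spec:
  "\<exists>m'. runs R prepare ((\<lambda>_. 0)(0 := q)) m' (U * (5 * q + 6)) [] \<and> env m' \<and> m' 16 = 0"
proof -
  have "wp R B setup_regs (\<lambda>m' w. table_inv 0 m' \<and> w = []) ((\<lambda>_. 0)(0 := q)) []"
    using B_bounds(1)[OF zero_closed] B_bounds(3-5)
    by (auto simp: setup_regs_def table_inv_def carrier_eq)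
  moreover have "steps setup_regs = 5" "steps setup_step = 4" by (simp_all add: setup_regs_def setup_step_def)
  ultimately obtain m1 where m1: "runs R setup_regs ((\<lambda>_. 0)(0 := q)) m1 (5 * U) []" "table_inv 0 m1"
    and s: "steps setup_step = 4" using runs_wp[of R B setup_regs] by fastforce
  have ex: "\<exists>m2. runs R (While 4 setup_step) m1 m2 ((\<Sum>i=0..<q. 4 * U + U) + U)
      (concat (map (\<lambda>_. []) [0..<q])) \<and> table_inv q m2"
  proof (rule runs_While[where I = table_inv])
    fix j m assume j: "j < q" "table_inv j m"
    have "\<exists>m'. runs R setup_step m m' (4 * U) [] \<and> table_inv (Suc j) m'"
      using runs_wp[OF setup_step_spec[OF j(2,1)]] s by auto
    moreover have "m 4 \<noteq> 0" "m 4 \<le> B" using j B_bounds(3) unfolding table_inv_def by auto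
    ultimately show "m 4 \<noteq> 0 \<and> m 4 \<le> B \<and> (\<exists>m'. runs R setup_step m m' (4 * U) [] \<and> table_inv (Suc j) m')" by blast
  next
    show "table_inv q m \<Longrightarrow> m 4 = 0" for m by (simp add: table_inv_def)
  qed (use m1 in auto)
  have nil: "concat (map (\<lambda>_. []) [0..<q]) = ([] :: nat list)" by simp
  obtain m2 where m2: "runs R (While 4 setup_step) m1 m2 ((\<Sum>i=0..<q. 4 * U + U) + U) []" "table_inv q m2"
    using ex unfolding nil by blast
  have "runs R prepare ((\<lambda>_. 0)(0 := q)) m2 (U * (5 * q + 6)) []"
    unfolding prepare_def using runs_Seq[OF m1(1) m2(1)] by (auto intro: runs_mono simp: algebra_simps)
  moreover have "env m2" "m2 16 = 0" using m2(2) unfolding table_inv_def env_def is_square_def by auto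
  ultimately show ?thesis by blast
qed

definition cost1 :: nat where
  "cost1 = U * (5 * q + 8) + search_cost U"

definition cost2 :: nat where
  "cost2 = search_cost (U * (16 * q + 2))"

lemma count_phase_spec:
  "\<exists>m'. runs R count_phase ((\<lambda>_. 0)(0 := q)) m' cost1 [] \<and> env m' \<and> m' 16 = card (DI_set R)"
proof -
  obtain m1 where m1: "runs R prepare ((\<lambda>_. 0)(0 := q)) m1 (U * (5 * q + 6)) []" "env m1" "m1 16 = 0"
    using prepare_spec by blast
  have "1 * m1 16 = 0" using m1 by simp
  have nil: "concat (map (\<lambda>j. concat (map (\<lambda>i. if good (q - Suc j) (q - Suc i) then [] else []) [0..<q])) [0..<q]) =
      ([] :: nat list)" by simp
  from search_spec[OF count_spec order_refl m1(2) \<open>1 * m1 16 = 0\<close>, unfolded nil] obtain m2 where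
    m2: "runs R (search (NatOp Add 16 16 1)) m1 m2 (search_cost U) []" "env m2" "m2 16 = card good_pairs"
    using m1(3) by auto
  have e: "m2 0 = q" "m2 (Suc 0) = 1" using m2(2) unfolding env_def by auto
  have "good_pairs \<subseteq> carrier R \<times> carrier R" by (auto simp: good_pairs_def)
  then have le: "card good_pairs \<le> q * q"
    using card_mono[of "carrier R \<times> carrier R" good_pairs] finite_carrier by (simp add: order_def)
  define m3 where "m3 = m2(18 := q - 1)"
  have r3: "runs R (NatOp Sub 18 0 1) m2 m3 U []"
    using runs_NatOp[of m2 0 B 1 Sub R 18] e B_bounds(3,5) unfolding m3_def by simp
  define m4 where "m4 = m3(16 := card good_pairs * (q - 1))"
  have r4: "runs R (NatOp Mul 16 16 18) m3 m4 U []"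
    using runs_NatOp[of m3 16 B 18 Mul R 16] m2(3) B_bounds(3) B_bounds(6,7)[OF le] unfolding m3_def m4_def by simp
  have "runs R count_phase ((\<lambda>_. 0)(0 := q)) m4 cost1 []"
    unfolding count_phase_def using runs_Seq[OF m1(1) runs_Seq[OF m2(1) runs_Seq[OF r3 r4]]]
    by (auto intro: runs_mono simp: cost1_def algebra_simps)
  moreover have "env m4" using m2(2) unfolding m4_def m3_def env_def by auto
  ultimately show ?thesis using card_DI_set unfolding m4_def by auto
qed

lemma program_correct:
  assumes T: "real (cost1 + U) \<le> T" and T': "real (cost1 + U + cost2) \<le> T'"
  shows "computes_and_constructs_DI program q R T T'"
proof -
  obtain m1 where m1: "runs R count_phase ((\<lambda>_. 0)(0 := q)) m1 cost1 []" "env m1" "m1 16 = card (DI_set R)"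
    using count_phase_spec by blast
  define E where "E = map (\<lambda>i. q - Suc i) [0..<q]"
  have E: "distinct E" "set E = carrier R"
  proof -
    show "distinct E" unfolding E_def distinct_map by (auto simp: inj_on_def)
    have "x \<in> (\<lambda>i. q - Suc i) ` {0..<q}" if "x < q" for x
      using that by (intro image_eqI[of _ _ "q - Suc x"]) auto
    then show "set E = carrier R" unfolding E_def carrier_eq using q3 by auto
  qed
  \<comment> \<open>Triples in the nesting order d, t, a of the program's loops, so that the output
    agrees literally with \<open>concat fs\<close>.\<close>
  define ts where "ts = filter (\<lambda>(d, t, a). good d t \<and> a \<noteq> \<zero>) (List.product E (List.product E E))"
  define fs where "fs = map (\<lambda>(d, t, a). quad a d t) ts"
  have "bij_betw (\<lambda>(d, t, a). (a, d, t)) (set ts) ((carrier R - {\<zero>}) \<times> good_pairs)"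
    by (rule bij_betwI[where g = "\<lambda>(a, d, t). (d, t, a)"]) (auto simp: ts_def E good_pairs_def)
  then have im: "(\<lambda>(d, t, a). (a, d, t)) ` set ts = (carrier R - {\<zero>}) \<times> good_pairs"
    and inj: "inj_on (\<lambda>(d, t, a). (a, d, t)) (set ts)" by (auto simp: bij_betw_def)
  have comp: "(\<lambda>(d, t, a). quad a d t) = (\<lambda>(a, d, t). quad a d t) \<circ> (\<lambda>(d, t, a). (a, d, t))" by auto
  have "distinct ts" unfolding ts_def using E by (simp add: distinct_product)
  moreover have "inj_on (\<lambda>(d, t, a). quad a d t) (set ts)"
    unfolding comp using inj inj_on_quad unfolding im[symmetric] by (rule comp_inj_on)
  ultimately have fs: "distinct fs" unfolding fs_def by (simp add: distinct_map)
  have set_fs: "set fs = DI_set R"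
    unfolding fs_def DI_set_eq im[symmetric] comp by (simp add: image_comp)
  have out: "concat fs = concat (map (\<lambda>j. concat (map (\<lambda>i. if good (q - Suc j) (q - Suc i) then polys (q - Suc j) (q - Suc i) else []) [0..<q])) [0..<q])"
  proof -
    have "(if good d t then polys d t else []) = concat (map (\<lambda>a. if good d t \<and> a \<noteq> \<zero> then quad a d t else []) E)" for d t
      by (auto simp: polys_def E_def comp_def)
    then show ?thesis
      unfolding fs_def ts_def concat_map_filter concat_map_product
      by (simp add: E_def comp_def case_prod_beta cong: if_cong)
  qed
  have "0 * m1 16 = 0" by simp
  from search_spec[OF emit_all_spec _ m1(2) this] obtain m2 where
    m2: "runs R (search emit_all) m1 m2 cost2 (concat fs)" unfolding out cost2_def by auto
  obtain k1 w1 where x1: "exec R count_phase (initial_state q) \<lparr>mem = m1, clock = k1, tape = [] @ w1\<rparr>" "map fst w1 = []" "k1 \<le> 0 + cost1"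
    using m1(1) unfolding runs_def initial_state_def by blast
  \<comment> \<open>\<open>runs\<close> conceals time stamps, and the one of the first output is
    needed; hence this instruction is executed explicitly.\<close>
  define k2 where "k2 = k1 + 1 + bits (m1 16)"
  have x2: "exec R (Emit 16) \<lparr>mem = m1, clock = k1, tape = [] @ w1\<rparr> \<lparr>mem = m1, clock = k2, tape = [(m1 16, k2)]\<rparr>"
    using exec.Emit[of R 16 "\<lparr>mem = m1, clock = k1, tape = [] @ w1\<rparr>"] x1(2)
    by (simp add: append_tape_def tick_def k2_def)
  obtain k3 w3 where x3: "exec R (search emit_all) \<lparr>mem = m1, clock = k2, tape = [(m1 16, k2)]\<rparr>
      \<lparr>mem = m2, clock = k3, tape = [(m1 16, k2)] @ w3\<rparr>" "map fst w3 = concat fs" "k3 \<le> k2 + cost2"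
    using m2 unfolding runs_def by blast
  have "card (DI_set R) \<le> B"
  proof -
    have "good_pairs \<subseteq> carrier R \<times> carrier R" by (auto simp: good_pairs_def)
    then have "card good_pairs \<le> q * q"
      using card_mono[of "carrier R \<times> carrier R" good_pairs] finite_carrier by (simp add: order_def)
    then show ?thesis using B_bounds(7) by (simp add: card_DI_set)
  qed
  then have "k2 \<le> cost1 + U" using x1(3) bits_le[of "m1 16" B] m1(3) by (simp add: k2_def unit_cost_def)
  moreover have "exec R program (initial_state q) \<lparr>mem = m2, clock = k3, tape = [(m1 16, k2)] @ w3\<rparr>"
    unfolding program_def by (rule exec.Seq[OF x1(1) exec.Seq[OF x2 x3(1)]])
  ultimately show ?thesis
    unfolding computes_and_constructs_DI_def
    using T T' m1(3) x3 fs set_fs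
    by (intro exI[of _ "\<lparr>mem = m2, clock = k3, tape = [(m1 16, k2)] @ w3\<rparr>"] exI[of _ k2] exI[of _ w3] exI[of _ fs]) auto
qed

section \<open>Explicit real bounds for the running times\<close>

lemma of_nat_order: "real q \<ge> 3"
  using q3 by simp

lemma order_sq: "3 * real q \<le> (real q)\<^sup>2"
  unfolding power2_eq_square by (rule mult_right_mono[OF of_nat_order]) simp

lemma ln_order: "ln (real q) \<ge> 0"
  using of_nat_order by simp

lemma bits_le_ln: "1 \<le> x \<Longrightarrow> real (bits x) \<le> 1 + 2 * ln (real x)"
proof -
  assume x: "1 \<le> x"
  have l2: "ln (2::real) \<ge> 1 / 2" using ln_le_minus_one[of "1 / 2 :: real"] by (simp add: ln_div)
  have lx: "ln (real x) \<ge> 0" using x by simp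
  have "real (bits x) = real_of_int \<lfloor>log 2 (real x)\<rfloor> + 1"
    using x by (simp add: floorlog_def)
  also have "\<dots> \<le> log 2 (real x) + 1" by simp
  also have "log 2 (real x) = ln (real x) / ln 2" by (simp add: log_def)
  also have "\<dots> \<le> ln (real x) / (1 / 2)" using l2 lx by (intro divide_left_mono) auto
  finally show ?thesis by simp
qed

text \<open>From B \<le> q^4 one gets bits B \<le> 1 + 8 ln q, and 2 + 3 (1 + 8 ln q) = 5 + 24 ln q;
  29 is the sum of both coefficients.\<close>

lemma unit_cost_le: "real U \<le> 29 * (1 + ln (real q))"
proof -
  have "q * q * q \<ge> 3 * 3 * 3" using q3 by (intro mult_mono) auto
  moreover have "3 * (q * q * q) \<le> q * (q * q * q)" using q3 by (intro mult_right_mono) auto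
  moreover have "q * (q * q * q) = q ^ 4" by (simp add: numeral_eq_Suc)
  ultimately have "B \<le> q ^ 4" unfolding B_def by linarith
  then have "real (bits B) \<le> real (bits (q ^ 4))" using bits_le by simp
  also have "\<dots> \<le> 1 + 2 * ln (real (q ^ 4))" using q3 by (intro bits_le_ln) simp
  also have "ln (real (q ^ 4)) = 4 * ln (real q)" using q3 by (simp add: ln_realpow)
  finally show ?thesis using ln_order by (simp add: unit_cost_def)
qed

text \<open>58 = 13 + 2 * 21 + 3: fixed costs per pair, the summand 2 of
  \<open>sum_rounds_le\<close>, and the lower order terms.\<close>

lemma search_cost_le:
  "real (search_cost n) \<le> real U * (real q)\<^sup>2 * (58 + 21 * ln (real q)) + real (card good_pairs) * real n"
proof -
  have "(\<Sum>d\<in>carrier R. \<Sum>t\<in>carrier R. U * (13 + 21 * rounds d t) + (if good d t then n else 0)) =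
      (\<Sum>d\<in>carrier R. \<Sum>t\<in>carrier R. 13 * U + 21 * U * rounds d t + n * of_bool (good d t))"
    by (intro sum.cong refl) (auto simp: algebra_simps)
  also have "\<dots> = q * q * (13 * U) + 21 * U * (\<Sum>d\<in>carrier R. \<Sum>t\<in>carrier R. rounds d t) + n * card good_pairs"
    unfolding card_good_pairs_eq[symmetric] by (simp add: sum.distrib sum_distrib_left order_def)
  finally have "search_cost n = q * q * (13 * U) + 21 * U * (\<Sum>d\<in>carrier R. \<Sum>t\<in>carrier R. rounds d t) +
      n * card good_pairs + q * (4 * U) + 2 * U" by (simp add: search_cost_def)
  then have "real (search_cost n) = (real q)\<^sup>2 * (13 * real U) + 21 * real U * real (\<Sum>d\<in>carrier R. \<Sum>t\<in>carrier R. rounds d t) +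
      real n * real (card good_pairs) + real q * (4 * real U) + 2 * real U" by (simp add: power2_eq_square)
  moreover have "real (\<Sum>d\<in>carrier R. \<Sum>t\<in>carrier R. rounds d t) \<le> (real q)\<^sup>2 * (2 + ln (real q))"
  proof -
    have "real (\<Sum>d\<in>carrier R. \<Sum>t\<in>carrier R. rounds d t) = (\<Sum>d\<in>carrier R. real (\<Sum>t\<in>carrier R. rounds d t))" by simp
    also have "\<dots> \<le> (\<Sum>d\<in>carrier R. real q * (2 + ln (real q)))" by (intro sum_mono sum_rounds_le)
    finally show ?thesis by (simp add: order_def power2_eq_square)
  qed
  then have "21 * real U * real (\<Sum>d\<in>carrier R. \<Sum>t\<in>carrier R. rounds d t) \<le> 21 * real U * ((real q)\<^sup>2 * (2 + ln (real q)))"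
    by (intro mult_left_mono) auto
  moreover have "real q * (4 * real U) + 2 * real U \<le> (real q)\<^sup>2 * (3 * real U)"
  proof -
    have "4 * real q + 2 \<le> 3 * (real q)\<^sup>2"
      using order_sq of_nat_order by linarith
    then have "(4 * real q + 2) * real U \<le> 3 * (real q)\<^sup>2 * real U" by (intro mult_right_mono) auto
    then show ?thesis by (simp add: algebra_simps)
  qed
  ultimately show ?thesis by (simp add: algebra_simps)
qed

text \<open>While counting, a good pair costs one unit and the trivial bound suffices. While
  listing, it costs about q units, and the second bound, from \<open>card_good_pairs\<close>, is
  essential; 144 = 36 * 2^2.\<close>

lemma real_card_good_pairs: "real (card good_pairs) \<le> (real q)\<^sup>2"
    "real (card good_pairs) \<le> real q * sqrt (real q) * (144 * (1 + ln (real q))\<^sup>2)"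
proof -
  have "good_pairs \<subseteq> carrier R \<times> carrier R" by (auto simp: good_pairs_def)
  then have "card good_pairs \<le> q * q"
    using card_mono[of "carrier R \<times> carrier R" good_pairs] finite_carrier by (simp add: order_def)
  then have "real (card good_pairs) \<le> real (q * q)" by (rule of_nat_mono)
  then show "real (card good_pairs) \<le> (real q)\<^sup>2" by (simp add: power2_eq_square)
  have "real root_order * real root_order \<le> real q"
    using of_nat_mono[OF root_order(1), where 'a = real] by simp
  then have "(real root_order)\<^sup>2 \<le> real q" by (simp only: power2_eq_square)
  then have r: "real root_order \<le> sqrt (real q)" by (rule real_le_rsqrt)
  have "real (bits q) \<le> 2 * (1 + ln (real q))" using bits_le_ln[of q] q3 by simp
  then have b: "(real (bits q))\<^sup>2 \<le> (2 * (1 + ln (real q)))\<^sup>2" by (intro power_mono) auto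
  have "real (card good_pairs) \<le> real q * real root_order * (36 * (real (bits q))\<^sup>2)"
    using of_nat_mono[OF card_good_pairs, where 'a = real] by simp
  also have "\<dots> \<le> real q * sqrt (real q) * (36 * (2 * (1 + ln (real q)))\<^sup>2)"
    using r b by (intro mult_mono) auto
  also have "36 * (2 * (1 + ln (real q)))\<^sup>2 = 144 * (1 + ln (real q))\<^sup>2"
    by (simp only: power_mult_distrib) simp
  finally show "real (card good_pairs) \<le> real q * sqrt (real q) * (144 * (1 + ln (real q))\<^sup>2)" .
qed

text \<open>62 = 58 + 3 + 1, for the search, the preparation and the increments of the counter; 29 *
  62 = 1798.\<close>

lemma cost1_le: "real (cost1 + U) \<le> 2000 * (1 + ln (real q))\<^sup>2 * (real q)\<^sup>2"
proof -
  let ?l = "1 + ln (real q)"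
  have "5 * real q + 9 \<le> 3 * (real q)\<^sup>2"
    using order_sq of_nat_order by linarith
  then have "real U * (5 * real q + 9) \<le> real U * (3 * (real q)\<^sup>2)" by (intro mult_left_mono) auto
  moreover have "real (card good_pairs) * real U \<le> (real q)\<^sup>2 * real U"
    by (intro mult_right_mono real_card_good_pairs) auto
  moreover have "real (cost1 + U) = real U * (5 * real q + 9) + real (search_cost U)"
    by (simp add: cost1_def algebra_simps)
  ultimately have "real (cost1 + U) \<le> real U * (real q)\<^sup>2 * (62 + 21 * ln (real q))"
    using search_cost_le[of U] by (simp add: algebra_simps)
  also have "\<dots> \<le> (29 * ?l) * (real q)\<^sup>2 * (62 * ?l)"
    using unit_cost_le ln_order by (intro mult_mono) auto
  also have "\<dots> = 1798 * (?l\<^sup>2 * (real q)\<^sup>2)" by (simp add: power2_eq_square algebra_simps)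
  also have "\<dots> \<le> 2000 * (?l\<^sup>2 * (real q)\<^sup>2)" by (intro mult_right_mono) auto
  finally show ?thesis by (simp add: mult.assoc)
qed

text \<open>29 * 58 = 1682 for the second search and 144 * 29 * 17 = 70992 for the output; together
  with 2000 this is below 100000.\<close>

lemma cost2_le: "real (cost1 + U + cost2) \<le> 100000 * (1 + ln (real q)) ^ 3 * ((real q)\<^sup>2 * sqrt (real q))"
proof -
  let ?l = "1 + ln (real q)"
  have l1: "?l \<ge> 1" using ln_order by simp
  have s1: "sqrt (real q) \<ge> 1" using of_nat_order by simp
  have q0: "(real q)\<^sup>2 \<ge> 0" by simp
  have l23: "?l\<^sup>2 \<le> ?l ^ 3" using l1 by (intro power_increasing) auto
  have c2: "real cost2 \<le> real U * (real q)\<^sup>2 * (58 + 21 * ln (real q)) + real (card good_pairs) * (real U * (16 * real q + 2))"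
    using search_cost_le[of "U * (16 * q + 2)"] unfolding cost2_def of_nat_mult of_nat_add of_nat_numeral .
  have "real U * (real q)\<^sup>2 * (58 + 21 * ln (real q)) \<le> (29 * ?l) * (real q)\<^sup>2 * (58 * ?l)"
    using unit_cost_le ln_order by (intro mult_mono) auto
  also have "\<dots> = 1682 * (?l\<^sup>2 * (real q)\<^sup>2)" by (simp add: power2_eq_square algebra_simps)
  finally have a: "real U * (real q)\<^sup>2 * (58 + 21 * ln (real q)) \<le> 1682 * (?l\<^sup>2 * (real q)\<^sup>2)" .
  have "16 * real q + 2 \<le> 17 * real q" using of_nat_order by simp
  then have "real (card good_pairs) * (real U * (16 * real q + 2)) \<le>
      (real q * sqrt (real q) * (144 * ?l\<^sup>2)) * ((29 * ?l) * (17 * real q))"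
    using unit_cost_le ln_order real_card_good_pairs(2) by (intro mult_mono) auto
  also have "\<dots> = 70992 * (?l ^ 3 * ((real q)\<^sup>2 * sqrt (real q)))"
  proof -
    have "(a * s * (144 * l\<^sup>2)) * ((29 * l) * (17 * a)) = 70992 * (l ^ 3 * (a\<^sup>2 * s))" for a s l :: real
      by (simp add: power2_eq_square power3_eq_cube)
    then show ?thesis .
  qed
  finally have b: "real (card good_pairs) * (real U * (16 * real q + 2)) \<le> 70992 * (?l ^ 3 * ((real q)\<^sup>2 * sqrt (real q)))" .
  have c: "?l\<^sup>2 * (real q)\<^sup>2 \<le> ?l ^ 3 * ((real q)\<^sup>2 * sqrt (real q))"
  proof (rule mult_mono[OF l23])
    show "(real q)\<^sup>2 \<le> (real q)\<^sup>2 * sqrt (real q)" using mult_left_mono[OF s1 q0] by simp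
  qed (use l1 in auto)
  have "0 \<le> ?l ^ 3 * ((real q)\<^sup>2 * sqrt (real q))" using l1 by simp
  moreover have "real (cost1 + U + cost2) = real (cost1 + U) + real cost2" by simp
  ultimately show ?thesis using cost1_le c2 a b c by (simp only: mult.assoc)
qed

end

theorem theorem1p1:
  shows "\<exists>(A :: com) (\<epsilon> :: nat \<Rightarrow> real) (\<epsilon>' :: nat \<Rightarrow> real).
    \<epsilon> \<longlonglongrightarrow> 0 \<and> \<epsilon>' \<longlonglongrightarrow> 0 \<and>
    (\<forall>(q :: nat) (R :: nat ring).
       primepow q \<and> odd q \<and> field R \<and> carrier R = {..<q} \<longrightarrow>
       computes_and_constructs_DI A q R
         (real q powr (9/4 + \<epsilon> q)) (real q powr (5/2 + \<epsilon>' q)))"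
proof -
  \<comment> \<open>Chosen such that q^\<epsilon> is exactly 100000 (1 + ln q)^3, which absorbs all
    constants and logarithms of both phases.\<close>
  define \<epsilon> where "\<epsilon> q = ln (100000 * (1 + ln (real q)) ^ 3) / ln (real q)" for q :: nat
  have lim: "\<epsilon> \<longlonglongrightarrow> 0" unfolding \<epsilon>_def by real_asymp
  have "computes_and_constructs_DI program q R (real q powr (9/4 + \<epsilon> q)) (real q powr (5/2 + \<epsilon> q))"
    if q: "odd q" and R: "field R" "carrier R = {..<q}" for q :: nat and R :: "nat ring"
  proof -
    have ord: "order R = q" using R(2) by (simp add: order_def)
    interpret F: field R by (rule R(1))
    interpret coded_field R
      by standard (use q R(2) ord in auto)
    let ?l = "1 + ln (real q)"
    have q3: "real q \<ge> 3" using of_nat_order ord by simp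
    then have lq: "ln (real q) > 0" by simp
    have l1: "?l \<ge> 1" using lq by simp
    have eps: "real q powr \<epsilon> q = 100000 * ?l ^ 3"
    proof -
      have "real q powr \<epsilon> q = exp (ln (100000 * ?l ^ 3))" using q3 lq by (simp add: powr_def \<epsilon>_def)
      then show ?thesis using l1 by simp
    qed
    have "real (cost1 + U) \<le> real q powr (9/4 + \<epsilon> q)"
    proof -
      have "real (cost1 + U) \<le> 2000 * ?l\<^sup>2 * (real q)\<^sup>2" using cost1_le unfolding ord .
      also have "\<dots> \<le> (100000 * ?l ^ 3) * real q powr (9/4)"
      proof (rule mult_mono)
        have "?l\<^sup>2 \<le> ?l ^ 3" using l1 by (intro power_increasing) auto
        then show "2000 * ?l\<^sup>2 \<le> 100000 * ?l ^ 3" by (intro mult_mono) auto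
        \<comment> \<open>The counting phase takes only q^2 up to logarithms; the exponent is
          relaxed to 9/4 here.\<close>
        have "(real q)\<^sup>2 = real q powr 2" using q3 by (simp add: powr_numeral)
        also have "\<dots> \<le> real q powr (9/4)" using q3 by (intro powr_mono) auto
        finally show "(real q)\<^sup>2 \<le> real q powr (9/4)" .
      qed (use l1 in auto)
      finally show ?thesis by (simp only: eps powr_add mult.commute[of "real q powr (9/4)"])
    qed
    moreover have "real (cost1 + U + cost2) \<le> real q powr (5/2 + \<epsilon> q)"
    proof -
      have "(real q)\<^sup>2 * sqrt (real q) = real q powr 2 * real q powr (1/2)"
        using q3 by (simp add: powr_numeral powr_half_sqrt)
      also have "\<dots> = real q powr (5/2)" by (simp only: powr_add[symmetric]) simp
      finally show ?thesis using cost2_le unfolding ord by (simp add: eps powr_add mult.commute)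
    qed
    ultimately show ?thesis using program_correct unfolding ord by blast
  qed
  then show ?thesis using lim by blast
qed

end
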